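(* Let $T:Z\to Z$ be a Young tower with invariant probability measure $\pi$ and basis $Z_0$, for which the return time $\tau$ to the basis satisfies $\pi\{z\in Z_0:\tau(z)=n\}\sim c/n^{p+1}$ as $n\to\infty$, for some $c>0$ and some $p>2$. Let $f=\pi(Z_0)-\mathbf{1}_{Z_0}$, and let $(Y_i)_{i\ge0}$ be the stationary Markov chain dual to $T$, with $Y_0$ distributed according to $\pi$. There exists $\kappa>0$ such that, for any integer $n\ge1$ and any $x\in[\kappa n^{1/p},\kappa^{-1}n]$, $$\mathbb{P}\Big(\sum_{i=0}^{n-1}f(Y_i)\ge x\Big)\ge\kappa^{-1}\frac{n}{x^p}.$$
   Context: Young tower. A Young tower is a probability space $(Z,\pi)$ with a measurable map $T:Z\to Z$ preserving $\pi$ and a finite or countable partition $\{\Delta_{\alpha,\ell}: \alpha\in\mathcal{A},\ 0\le \ell<h_\alpha\}$ of $Z$ into measurable sets of positive measure (with integers $h_\alpha\ge1$), such that: (i) $T$ maps $\Delta_{\alpha,\ell}$ bijectively and bimeasurably onto $\Delta_{\alpha,\ell+1}$ if $\ell<h_\alpha-1$, and maps $\Delta_{\alpha,h_\alpha-1}$ bijectively and bimeasurably onto the basis $Z_0=\bigcup_\alpha\Delta_{\alpha,0}$. The return time $\tau:Z_0\to\mathbb{N}$ equals $h_\alpha$ on $\Delta_{\alpha,0}$, and $T_0=T^\tau:Z_0\to Z_0$ is the induced map. (ii) The separation time $s(x,y)$ of $x,y\in Z_0$ is the least $k\ge0$ such that $T_0^kx$ and $T_0^ky$ lie in different sets $\Delta_{\alpha,0}$;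 it is finite for $x\neq y$. If $x,y$ belong to the same $\Delta_{\alpha,\ell}$, then $s(x,y)=s(x_0,y_0)$, where $x_0,y_0\in\Delta_{\alpha,0}$ are the points with $T^\ell x_0=x$, $T^\ell y_0=y$; if $x,y$ belong to different sets $\Delta_{\alpha,\ell}$ and are not both in $Z_0$, then $s(x,y)=0$. The space $Z$ carries the metric $d(x,y)=\beta^{s(x,y)}$ for $x\ne y$ (and $d(x,x)=0$), for some fixed $\beta\in(0,1)$, and measurability refers to its Borel $\sigma$-algebra. (iii) Bounded distortion: let $\pi_0$ be the normalized restriction of $\pi$ to $Z_0$; it is $T_0$-invariant. On each $\Delta_{\alpha,0}$ the map $T_0$ is non-singular with Jacobian $J$ with respect to $\pi_0$, and there is $C$ with $|\log J(x)-\log J(y)|\le C\,d(T_0x,T_0y)$ for all $x,y$ in the same $\Delta_{\alpha,0}$. (iv) $\gcd\{h_\alpha:\alpha\in\mathcal{A}\}=1$. Dual Markov chain: its transition operator $K$ is defined by duality, $\int (u\circ T)\,v\,d\pi=\int u\,K(v)\,d\pi$ for bounded measurable $u,v$ (from $z$ the chain jumps to a random preimage of $z$ under $T$). It has $\pi$ as stationary measure, and $(Y_0,\dots,Y_{n-1})$ is distributed like $(T^{n-1}z,\dots,Tz,z)$ when $z$ is distributed according to $\pi$. *)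

theory Defs
  imports
    "HOL-Probability.Probability"
    "HOL-Library.Landau_Symbols"
begin

section \<open>Tower combinatorics\<close>

text \<open>
  A tower is given by a map \<open>T\<close>, an index set \<open>A\<close>, heights \<open>h\<close> and cells \<open>\<Delta> \<alpha> l\<close>; only the
  cells with \<open>\<alpha> \<in> A\<close> and \<open>l < h \<alpha>\<close> matter.
\<close>

definition tower_basis :: "'i set \<Rightarrow> ('i \<Rightarrow> nat \<Rightarrow> 'a set) \<Rightarrow> 'a set" where
  "tower_basis A \<Delta> = (\<Union>\<alpha>\<in>A. \<Delta> \<alpha> 0)"

definition return_time :: "'i set \<Rightarrow> ('i \<Rightarrow> nat) \<Rightarrow> ('i \<Rightarrow> nat \<Rightarrow> 'a set) \<Rightarrow> 'a \<Rightarrow> nat" where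
  "return_time A h \<Delta> x = h (THE \<alpha>. \<alpha> \<in> A \<and> x \<in> \<Delta> \<alpha> 0)"

definition induced_map ::
  "('a \<Rightarrow> 'a) \<Rightarrow> 'i set \<Rightarrow> ('i \<Rightarrow> nat) \<Rightarrow> ('i \<Rightarrow> nat \<Rightarrow> 'a set) \<Rightarrow> 'a \<Rightarrow> 'a" where
  "induced_map T A h \<Delta> x = (T ^^ return_time A h \<Delta> x) x"

definition separated_at ::
  "('a \<Rightarrow> 'a) \<Rightarrow> 'i set \<Rightarrow> ('i \<Rightarrow> nat) \<Rightarrow> ('i \<Rightarrow> nat \<Rightarrow> 'a set) \<Rightarrow> 'a \<Rightarrow> 'a \<Rightarrow> nat \<Rightarrow> bool" where
  "separated_at T A h \<Delta> x y k \<longleftrightarrow>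
     \<not> (\<exists>\<alpha>\<in>A. (induced_map T A h \<Delta> ^^ k) x \<in> \<Delta> \<alpha> 0 \<and> (induced_map T A h \<Delta> ^^ k) y \<in> \<Delta> \<alpha> 0)"

definition same_cell :: "'i set \<Rightarrow> ('i \<Rightarrow> nat) \<Rightarrow> ('i \<Rightarrow> nat \<Rightarrow> 'a set) \<Rightarrow> 'a \<Rightarrow> 'a \<Rightarrow> bool" where
  "same_cell A h \<Delta> x y \<longleftrightarrow> (\<exists>\<alpha>\<in>A. \<exists>l<h \<alpha>. x \<in> \<Delta> \<alpha> l \<and> y \<in> \<Delta> \<alpha> l)"

definition base_point ::
  "('a \<Rightarrow> 'a) \<Rightarrow> 'i set \<Rightarrow> ('i \<Rightarrow> nat) \<Rightarrow> ('i \<Rightarrow> nat \<Rightarrow> 'a set) \<Rightarrow> 'a \<Rightarrow> 'a" where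
  "base_point T A h \<Delta> x =
     (THE x0. \<exists>\<alpha>\<in>A. \<exists>l<h \<alpha>. x \<in> \<Delta> \<alpha> l \<and> x0 \<in> \<Delta> \<alpha> 0 \<and> (T ^^ l) x0 = x)"

text \<open>
  The separation time is used for distinct points only; there it is finite by the tower axioms,
  so that \<open>LEAST\<close> is meaningful.
\<close>

definition separation_time ::
  "('a \<Rightarrow> 'a) \<Rightarrow> 'i set \<Rightarrow> ('i \<Rightarrow> nat) \<Rightarrow> ('i \<Rightarrow> nat \<Rightarrow> 'a set) \<Rightarrow> 'a \<Rightarrow> 'a \<Rightarrow> nat" where
  "separation_time T A h \<Delta> x y =
     (if x \<in> tower_basis A \<Delta> \<and> y \<in> tower_basis A \<Delta> then (LEAST k. separated_at T A h \<Delta> x y k)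
      else if same_cell A h \<Delta> x y
        then (LEAST k. separated_at T A h \<Delta> (base_point T A h \<Delta> x) (base_point T A h \<Delta> y) k)
      else 0)"

definition tower_dist ::
  "('a \<Rightarrow> 'a) \<Rightarrow> 'i set \<Rightarrow> ('i \<Rightarrow> nat) \<Rightarrow> ('i \<Rightarrow> nat \<Rightarrow> 'a set) \<Rightarrow> real \<Rightarrow> 'a \<Rightarrow> 'a \<Rightarrow> real" where
  "tower_dist T A h \<Delta> \<beta> x y = (if x = y then 0 else \<beta> ^ separation_time T A h \<Delta> x y)"

section \<open>Young towers\<close>

definition measure_preserving_map :: "'a measure \<Rightarrow> ('a \<Rightarrow> 'a) \<Rightarrow> bool" where
  "measure_preserving_map M S \<longleftrightarrow> S \<in> measurable M M \<and> distr M M S = M"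

definition bimeasurable_bij :: "'a measure \<Rightarrow> ('a \<Rightarrow> 'a) \<Rightarrow> 'a set \<Rightarrow> 'a set \<Rightarrow> bool" where
  "bimeasurable_bij M S B C \<longleftrightarrow>
     bij_betw S B C \<and>
     S \<in> measurable (restrict_space M B) (restrict_space M C) \<and>
     the_inv_into B S \<in> measurable (restrict_space M C) (restrict_space M B)"

definition normalized_restriction :: "'a measure \<Rightarrow> 'a set \<Rightarrow> 'a measure" where
  "normalized_restriction M B = scale_measure (1 / emeasure M B) (restrict_space M B)"

text \<open>
  \<open>J\<close> is the Jacobian with respect to \<open>N\<close> of a map \<open>S\<close> that is injective on \<open>B\<close>. Since \<open>J\<close> is
  positive, this includes non-singularity of \<open>S\<close> on \<open>B\<close>.
\<close>

definition jacobian_on :: "'a measure \<Rightarrow> ('a \<Rightarrow> 'a) \<Rightarrow> 'a set \<Rightarrow> ('a \<Rightarrow> real) \<Rightarrow> bool" where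
  "jacobian_on N S B J \<longleftrightarrow>
     J \<in> borel_measurable (restrict_space N B) \<and>
     (\<forall>x\<in>B. J x > 0) \<and>
     (\<forall>E\<in>sets N. E \<subseteq> B \<longrightarrow>
        S ` E \<in> sets N \<and> emeasure N (S ` E) = (\<integral>\<^sup>+x\<in>E. ennreal (J x) \<partial>N))"

locale young_tower = prob_space M
  for M :: "'a measure" and T :: "'a \<Rightarrow> 'a"
    and A :: "'i set" and h :: "'i \<Rightarrow> nat" and \<Delta> :: "'i \<Rightarrow> nat \<Rightarrow> 'a set" and \<beta> :: real +
  assumes preserving: "measure_preserving_map M T"
    and countable_index: "countable A"
    and height_pos: "\<And>\<alpha>. \<alpha> \<in> A \<Longrightarrow> h \<alpha> \<ge> 1"
    and cells_disjoint: "disjoint_family_on (\<lambda>(\<alpha>, l). \<Delta> \<alpha> l) (SIGMA \<alpha>:A. {..<h \<alpha>})"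
    and cells_cover: "(\<Union>\<alpha>\<in>A. \<Union>l<h \<alpha>. \<Delta> \<alpha> l) = space M"
    and cells_measurable: "\<And>\<alpha> l. \<alpha> \<in> A \<Longrightarrow> l < h \<alpha> \<Longrightarrow> \<Delta> \<alpha> l \<in> sets M"
    and cells_pos: "\<And>\<alpha> l. \<alpha> \<in> A \<Longrightarrow> l < h \<alpha> \<Longrightarrow> prob (\<Delta> \<alpha> l) > 0"
    and climb: "\<And>\<alpha> l. \<alpha> \<in> A \<Longrightarrow> l + 1 < h \<alpha> \<Longrightarrow>
        bimeasurable_bij M T (\<Delta> \<alpha> l) (\<Delta> \<alpha> (l + 1))"
    and return: "\<And>\<alpha>. \<alpha> \<in> A \<Longrightarrow>
        bimeasurable_bij M T (\<Delta> \<alpha> (h \<alpha> - 1)) (tower_basis A \<Delta>)"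
    and separation_finite: "\<And>x y. x \<in> tower_basis A \<Delta> \<Longrightarrow> y \<in> tower_basis A \<Delta> \<Longrightarrow> x \<noteq> y \<Longrightarrow>
        \<exists>k. separated_at T A h \<Delta> x y k"
    and beta: "0 < \<beta>" "\<beta> < 1"
    and sets_borel: "sets M = sigma_sets (space M)
        {U. openin (Metric_space.mtopology (space M) (tower_dist T A h \<Delta> \<beta>)) U}"
    and induced_preserving: "measure_preserving_map
        (normalized_restriction M (tower_basis A \<Delta>)) (induced_map T A h \<Delta>)"
    and bounded_distortion: "\<exists>J C. \<forall>\<alpha>\<in>A.
        jacobian_on (normalized_restriction M (tower_basis A \<Delta>)) (induced_map T A h \<Delta>) (\<Delta> \<alpha> 0) J \<and>
        (\<forall>x\<in>\<Delta> \<alpha> 0. \<forall>y\<in>\<Delta> \<alpha> 0. \<bar>ln (J x) - ln (J y)\<bar>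
           \<le> C * tower_dist T A h \<Delta> \<beta> (induced_map T A h \<Delta> x) (induced_map T A h \<Delta> y))"
    and heights_coprime: "Gcd (h ` A) = 1"
begin

text \<open>
  The assumption \<open>sets_borel\<close> uses \<open>Metric_space.mtopology\<close> before \<open>tower_dist\<close> is known to be a
  metric. The remaining axioms imply that it is one.
\<close>

lemma cell_unique:
  assumes "\<alpha> \<in> A" "l < h \<alpha>" "x \<in> \<Delta> \<alpha> l" "\<alpha>' \<in> A" "l' < h \<alpha>'" "x \<in> \<Delta> \<alpha>' l'"
  shows "\<alpha> = \<alpha>' \<and> l = l'"
proof (rule ccontr)
  assume "\<not> ?thesis"
  then have "(\<alpha>, l) \<noteq> (\<alpha>', l')"
    by simp
  moreover have "(\<alpha>, l) \<in> (SIGMA \<alpha>:A. {..<h \<alpha>})" "(\<alpha>', l') \<in> (SIGMA \<alpha>:A. {..<h \<alpha>})"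
    using assms by auto
  ultimately have "(case (\<alpha>, l) of (\<alpha>, l) \<Rightarrow> \<Delta> \<alpha> l) \<inter> (case (\<alpha>', l') of (\<alpha>, l) \<Rightarrow> \<Delta> \<alpha> l) = {}"
    by (rule disjoint_family_onD[OF cells_disjoint, rotated 2])
  then show False
    using assms by auto
qed

lemma bij_climb:
  assumes "\<alpha> \<in> A"
  shows "l < h \<alpha> \<Longrightarrow> bij_betw (T ^^ l) (\<Delta> \<alpha> 0) (\<Delta> \<alpha> l)"
proof (induction l)
  case 0
  show ?case by (simp add: bij_betw_def)
next
  case (Suc l)
  have "bij_betw T (\<Delta> \<alpha> l) (\<Delta> \<alpha> (Suc l))"
    using climb[OF assms, of l] Suc.prems by (simp add: bimeasurable_bij_def)
  moreover have "bij_betw (T ^^ l) (\<Delta> \<alpha> 0) (\<Delta> \<alpha> l)"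
    using Suc by simp
  ultimately have "bij_betw (T \<circ> T ^^ l) (\<Delta> \<alpha> 0) (\<Delta> \<alpha> (Suc l))"
    using bij_betw_trans by blast
  then show ?case
    by (simp only: funpow.simps)
qed

lemma base_point_eq:
  assumes "\<alpha> \<in> A" "l < h \<alpha>" "x0 \<in> \<Delta> \<alpha> 0"
  shows "base_point T A h \<Delta> ((T ^^ l) x0) = x0"
  unfolding base_point_def
proof (rule the_equality)
  have "(T ^^ l) x0 \<in> \<Delta> \<alpha> l"
    using bij_climb[OF assms(1,2)] assms(3) by (auto simp: bij_betw_def)
  then show "\<exists>\<alpha>\<in>A. \<exists>k<h \<alpha>. (T ^^ l) x0 \<in> \<Delta> \<alpha> k \<and> x0 \<in> \<Delta> \<alpha> 0 \<and> (T ^^ k) x0 = (T ^^ l) x0"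
    using assms by blast
  fix y
  assume "\<exists>\<alpha>\<in>A. \<exists>k<h \<alpha>. (T ^^ l) x0 \<in> \<Delta> \<alpha> k \<and> y \<in> \<Delta> \<alpha> 0 \<and> (T ^^ k) y = (T ^^ l) x0"
  then obtain \<alpha>' k where *: "\<alpha>' \<in> A" "k < h \<alpha>'" "(T ^^ l) x0 \<in> \<Delta> \<alpha>' k"
      "y \<in> \<Delta> \<alpha>' 0" "(T ^^ k) y = (T ^^ l) x0"
    by blast
  have eq: "\<alpha> = \<alpha>' \<and> l = k"
    by (rule cell_unique[OF assms(1,2) \<open>(T ^^ l) x0 \<in> \<Delta> \<alpha> l\<close> *(1-3)])
  have "inj_on (T ^^ l) (\<Delta> \<alpha> 0)"
    using bij_climb[OF assms(1,2)] by (rule bij_betw_imp_inj_on)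
  then show "y = x0"
    by (rule inj_onD) (use * eq assms in simp_all)
qed

lemma base_pointE:
  assumes "\<alpha> \<in> A" "l < h \<alpha>" "x \<in> \<Delta> \<alpha> l"
  shows "base_point T A h \<Delta> x \<in> \<Delta> \<alpha> 0" "(T ^^ l) (base_point T A h \<Delta> x) = x"
proof -
  obtain x0 where "x0 \<in> \<Delta> \<alpha> 0" "x = (T ^^ l) x0"
    using bij_climb[OF assms(1,2)] assms(3) by (auto simp: bij_betw_def)
  then show "base_point T A h \<Delta> x \<in> \<Delta> \<alpha> 0" "(T ^^ l) (base_point T A h \<Delta> x) = x"
    using base_point_eq assms by auto
qed

lemma separation_time_same_cell:
  assumes "same_cell A h \<Delta> x y"
  shows "separation_time T A h \<Delta> x y =
    (LEAST k. separated_at T A h \<Delta> (base_point T A h \<Delta> x) (base_point T A h \<Delta> y) k)"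
proof -
  have "base_point T A h \<Delta> z = z" if z: "z \<in> tower_basis A \<Delta>" for z
  proof -
    obtain \<alpha> where "\<alpha> \<in> A" "z \<in> \<Delta> \<alpha> 0"
      using z by (auto simp: tower_basis_def)
    then show ?thesis
      using base_point_eq[of \<alpha> 0 z] height_pos[of \<alpha>] by simp
  qed
  then show ?thesis
    using assms by (auto simp: separation_time_def)
qed

lemma separation_time_different_cells:
  assumes "\<not> same_cell A h \<Delta> x y"
  shows "separation_time T A h \<Delta> x y = 0"
proof -
  have "separated_at T A h \<Delta> x y 0"
    unfolding separated_at_def
  proof
    assume "\<exists>\<alpha>\<in>A. (induced_map T A h \<Delta> ^^ 0) x \<in> \<Delta> \<alpha> 0 \<and> (induced_map T A h \<Delta> ^^ 0) y \<in> \<Delta> \<alpha> 0"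
    then obtain \<alpha> where "\<alpha> \<in> A" "x \<in> \<Delta> \<alpha> 0" "y \<in> \<Delta> \<alpha> 0"
      by auto
    moreover have "0 < h \<alpha>"
      using height_pos[OF \<open>\<alpha> \<in> A\<close>] by simp
    ultimately show False
      using assms unfolding same_cell_def by blast
  qed
  then show ?thesis
    using assms by (auto simp: separation_time_def intro: Least_eq_0)
qed

lemma separated_at_trans:
  assumes "separated_at T A h \<Delta> x z k"
  shows "separated_at T A h \<Delta> x y k \<or> separated_at T A h \<Delta> y z k"
proof (rule ccontr)
  let ?S = "induced_map T A h \<Delta> ^^ k"
  assume "\<not> ?thesis"
  then obtain \<alpha> \<alpha>' where *: "\<alpha> \<in> A" "?S x \<in> \<Delta> \<alpha> 0" "?S y \<in> \<Delta> \<alpha> 0"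
      "\<alpha>' \<in> A" "?S y \<in> \<Delta> \<alpha>' 0" "?S z \<in> \<Delta> \<alpha>' 0"
    by (auto simp: separated_at_def)
  then have "\<alpha> = \<alpha>'"
    using cell_unique[of \<alpha> 0 "?S y" \<alpha>' 0] height_pos[of \<alpha>] height_pos[of \<alpha>'] by simp
  then show False
    using assms * by (auto simp: separated_at_def)
qed

lemma same_cell_trans:
  assumes "same_cell A h \<Delta> x y" "same_cell A h \<Delta> y z"
  shows "same_cell A h \<Delta> x z"
proof -
  obtain \<alpha> l where 1: "\<alpha> \<in> A" "l < h \<alpha>" "x \<in> \<Delta> \<alpha> l" "y \<in> \<Delta> \<alpha> l"
    using assms(1) unfolding same_cell_def by blast
  obtain \<alpha>' l' where 2: "\<alpha>' \<in> A" "l' < h \<alpha>'" "y \<in> \<Delta> \<alpha>' l'" "z \<in> \<Delta> \<alpha>' l'"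
    using assms(2) unfolding same_cell_def by blast
  have "\<alpha> = \<alpha>' \<and> l = l'"
    by (rule cell_unique[OF 1(1,2,4) 2(1-3)])
  then show ?thesis
    using 1 2 unfolding same_cell_def by blast
qed

lemma tower_dist_ultrametric:
  "tower_dist T A h \<Delta> \<beta> x z \<le> max (tower_dist T A h \<Delta> \<beta> x y) (tower_dist T A h \<Delta> \<beta> y z)"
proof (cases "x = z \<or> x = y \<or> y = z")
  case True
  then show ?thesis
    using beta by (auto simp: tower_dist_def le_max_iff_disj)
next
  case False
  let ?s = "separation_time T A h \<Delta>"
  have "min (?s x y) (?s y z) \<le> ?s x z"
  proof (cases "same_cell A h \<Delta> x y \<and> same_cell A h \<Delta> y z")
    case True
    then have xz: "same_cell A h \<Delta> x z"
      using same_cell_trans by blast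
    then obtain \<alpha> l where al: "\<alpha> \<in> A" "l < h \<alpha>" "x \<in> \<Delta> \<alpha> l" "z \<in> \<Delta> \<alpha> l"
      by (auto simp: same_cell_def)
    let ?b = "base_point T A h \<Delta>"
    have ne: "?b x \<noteq> ?b z"
      using base_pointE(2)[OF al(1-3)] base_pointE(2)[OF al(1,2,4)] False by metis
    have "?b x \<in> tower_basis A \<Delta>" "?b z \<in> tower_basis A \<Delta>"
      using base_pointE(1)[OF al(1-3)] base_pointE(1)[OF al(1,2,4)] al(1)
      by (auto simp: tower_basis_def)
    then obtain k where "separated_at T A h \<Delta> (?b x) (?b z) k"
      using separation_finite ne by blast
    then have "separated_at T A h \<Delta> (?b x) (?b z) (?s x z)"
      unfolding separation_time_same_cell[OF xz] by (rule LeastI)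
    then have "separated_at T A h \<Delta> (?b x) (?b y) (?s x z) \<or>
        separated_at T A h \<Delta> (?b y) (?b z) (?s x z)"
      by (rule separated_at_trans)
    then have "?s x y \<le> ?s x z \<or> ?s y z \<le> ?s x z"
      using True by (auto simp: separation_time_same_cell intro: Least_le)
    then show ?thesis
      by linarith
  qed (auto simp: separation_time_different_cells)
  then have "?s x y \<le> ?s x z \<or> ?s y z \<le> ?s x z"
    by linarith
  then have "\<beta> ^ ?s x z \<le> \<beta> ^ ?s x y \<or> \<beta> ^ ?s x z \<le> \<beta> ^ ?s y z"
    using beta by (auto intro: power_decreasing)
  then show ?thesis
    using False by (auto simp: tower_dist_def le_max_iff_disj)
qed

lemma separated_at_commute: "separated_at T A h \<Delta> x y k \<longleftrightarrow> separated_at T A h \<Delta> y x k"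
  by (auto simp: separated_at_def)

lemma tower_dist_metric: "Metric_space (space M) (tower_dist T A h \<Delta> \<beta>)"
proof
  fix x y z
  show nonneg: "0 \<le> tower_dist T A h \<Delta> \<beta> x y" for x y
    using beta by (auto simp: tower_dist_def)
  have cell: "same_cell A h \<Delta> x y \<longleftrightarrow> same_cell A h \<Delta> y x"
    unfolding same_cell_def by blast
  have sep: "separated_at T A h \<Delta> a b = separated_at T A h \<Delta> b a" for a b
    by (rule ext) (rule separated_at_commute)
  have "separation_time T A h \<Delta> x y = separation_time T A h \<Delta> y x"
    unfolding separation_time_def cell sep[of x y]
      sep[of "base_point T A h \<Delta> x" "base_point T A h \<Delta> y"]
    by (simp only: conj_commute)
  then show "tower_dist T A h \<Delta> \<beta> x y = tower_dist T A h \<Delta> \<beta> y x"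
    by (simp add: tower_dist_def eq_commute)
  show "tower_dist T A h \<Delta> \<beta> x y = 0 \<longleftrightarrow> x = y"
    using beta by (auto simp: tower_dist_def)
  show "tower_dist T A h \<Delta> \<beta> x z \<le> tower_dist T A h \<Delta> \<beta> x y + tower_dist T A h \<Delta> \<beta> y z"
    using tower_dist_ultrametric[of x z y] nonneg[of x y] nonneg[of y z] by linarith
qed

end

section \<open>The dual Markov chain\<close>

definition bounded_measurable :: "'a measure \<Rightarrow> ('a \<Rightarrow> real) \<Rightarrow> bool" where
  "bounded_measurable M v \<longleftrightarrow> v \<in> borel_measurable M \<and> bounded (v ` space M)"

text \<open>
  Duality determines each \<open>K v\<close> only up to a null set of \<open>M\<close>; \<open>K\<close> below is any choice of bounded
  representatives.
\<close>

definition dual_operator ::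
  "'a measure \<Rightarrow> ('a \<Rightarrow> 'a) \<Rightarrow> (('a \<Rightarrow> real) \<Rightarrow> 'a \<Rightarrow> real) \<Rightarrow> bool" where
  "dual_operator M T K \<longleftrightarrow>
     (\<forall>v. bounded_measurable M v \<longrightarrow> bounded_measurable M (K v)) \<and>
     (\<forall>u v. bounded_measurable M u \<longrightarrow> bounded_measurable M v \<longrightarrow>
        (\<integral>z. u (T z) * v z \<partial>M) = (\<integral>z. u z * K v z \<partial>M))"

definition past_algebra :: "'b measure \<Rightarrow> 'a measure \<Rightarrow> (nat \<Rightarrow> 'b \<Rightarrow> 'a) \<Rightarrow> nat \<Rightarrow> 'b measure" where
  "past_algebra P M Y n =
     vimage_algebra (space P) (\<lambda>\<omega>. \<lambda>i\<in>{..n}. Y i \<omega>) (PiM {..n} (\<lambda>_. M))"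

definition markov_chain ::
  "'b measure \<Rightarrow> 'a measure \<Rightarrow> (('a \<Rightarrow> real) \<Rightarrow> 'a \<Rightarrow> real) \<Rightarrow> (nat \<Rightarrow> 'b \<Rightarrow> 'a) \<Rightarrow> bool" where
  "markov_chain P M K Y \<longleftrightarrow>
     prob_space P \<and>
     (\<forall>i. Y i \<in> measurable P M) \<and>
     (\<forall>n v. bounded_measurable M v \<longrightarrow>
        (AE \<omega> in P. real_cond_exp P (past_algebra P M Y n) (\<lambda>\<omega>. v (Y (Suc n) \<omega>)) \<omega> = K v (Y n \<omega>)))"

text \<open>
  The law of \<open>Y 0\<close> is \<open>M\<close>, which is stationary for \<open>K\<close> when \<open>T\<close> preserves \<open>M\<close>
  (take \<open>u = 1\<close> in the duality relation).
\<close>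

definition stationary_dual_chain ::
  "'b measure \<Rightarrow> 'a measure \<Rightarrow> ('a \<Rightarrow> 'a) \<Rightarrow> (nat \<Rightarrow> 'b \<Rightarrow> 'a) \<Rightarrow> bool" where
  "stationary_dual_chain P M T Y \<longleftrightarrow>
     (\<exists>K. dual_operator M T K \<and> markov_chain P M K Y) \<and> distr P M (Y 0) = M"

end

theory Submission
  imports Defs
begin

text \<open>
  One long excursion is responsible for a large sum. Let \<open>\<mu>\<close> be the measure of the basis. While an
  orbit climbs a column of height \<open>h\<close>, its sum of \<open>f\<close> grows by about \<open>h \<mu>\<close>. During \<open>n\<close> steps an
  excursion of length comparable to \<open>x\<close> has of order \<open>n\<close> opportunities to start, each of probability
  of order \<open>x powr -p\<close>. If the contributions before and after the excursion are nonnegative, the whole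
  sum exceeds \<open>x\<close>. As \<open>n / x powr p\<close> is small for \<open>x \<ge> \<kappa> n powr (1/p)\<close>, these events overlap
  little, and Bonferroni's inequality bounds the probability of their union from below by a multiple of
  \<open>n / x powr p\<close> (\<open>big_jump\<close>, \<open>power_tail_deviation\<close>). To make this precise, the past, the excursion
  and the future have to be decoupled, and the past and the future have to be nonnegative with a
  probability that is bounded below.

  The decoupling comes from the first return map to the basis, which has full branches of bounded
  distortion. Conditioned on the first letters of its itinerary, the future has a law with a density
  whose logarithm is uniformly Lipschitz (\<open>regular_cylinder\<close>). Hence past and future are independent
  up to a constant factor (\<open>past_future\<close>), and the conditioning is forgotten exponentially fast,
  because at every step a fixed fraction of the reference measure can be split off (\<open>regular_mixing\<close>).

  For the nonnegativity, \<open>x\<close> can be much smaller than \<open>sqrt n\<close>, so the fluctuations of the two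
  remaining sums cannot be absorbed into \<open>x\<close>. What saves the argument is that a centered variable \<open>S\<close>
  satisfies \<open>P(S \<ge> 0) \<ge> (E|S|)\<^sup>2 / (4 E S\<^sup>2)\<close>. For the centered sum of \<open>k\<close> return
  times the second moment is at most of order \<open>k\<close>, and the first absolute moment is at least of order
  \<open>sqrt k\<close>; both follow from its Doob martingale, which stays at bounded distance from the partial sums
  by the exponential mixing (\<open>martingale_second_moment\<close>, \<open>first_absolute_moment\<close>,
  \<open>sum_nonneg_probability\<close>). The assumption \<open>p > 2\<close> enters as finiteness of the second moment of the
  return time.

  By Kac's formula the mean return time is \<open>1 / \<mu>\<close>, and an orbit that starts in the basis makes at most
  \<open>k\<close> visits before time \<open>n\<close> if the sum of its first \<open>k\<close> return times is at least \<open>n\<close>. So a large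
  sum of return times forces few visits to the basis, that is, a large sum of \<open>f\<close>
  (\<open>dynamical_deviation\<close>). Finally, the dual chain run for \<open>n\<close> steps is the orbit read backwards, and
  the sum does not depend on the direction of reading (\<open>chain_reverses_orbit\<close>, \<open>visit_pattern_law\<close>).
\<close>

section \<open>Regular set functions and mixing\<close>

text \<open>
  The sets with this property are the subsets of the cylinders of length \<open>n\<close>. For \<open>n = 0\<close> these are
  all sets, so an estimate at \<open>n = 0\<close> compares arbitrary sets.
\<close>

definition same_itinerary :: "('a \<Rightarrow> 'a) \<Rightarrow> ('a \<Rightarrow> 'i) \<Rightarrow> nat \<Rightarrow> 'a set \<Rightarrow> bool" where
  "same_itinerary S letter n E \<longleftrightarrow>
     (\<forall>x\<in>E. \<forall>y\<in>E. \<forall>k<n. letter ((S ^^ k) x) = letter ((S ^^ k) y))"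

text \<open>
  The point \<open>r\<close> is a convex combination of \<open>2 r / (1 + \<beta>)\<close> and \<open>0\<close>. This is the reason why a multiple of
  the reference measure can be subtracted from a regular set function at the price of a factor
  \<open>2 / (1 + \<beta>)\<close> in the regularity, and this factor is less than \<open>1 / \<beta>\<close>.
\<close>

lemma exp_convex_split:
  fixes \<beta> r :: real
  assumes "0 < \<beta>" "\<beta> < 1"
  shows "exp r \<le> (1 + \<beta>) / 2 * exp (2 / (1 + \<beta>) * r) + (1 - \<beta>) / 2"
proof -
  have c: "convex_on UNIV (exp :: real \<Rightarrow> real)"
    by (rule exp_convex)
  have "exp ((1 - (1 - \<beta>) / 2) *\<^sub>R (2 / (1 + \<beta>) * r) + ((1 - \<beta>) / 2) *\<^sub>R 0)
     \<le> (1 - (1 - \<beta>) / 2) * exp (2 / (1 + \<beta>) * r) + ((1 - \<beta>) / 2) * exp 0"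
    by (rule convex_onD[OF c]) (use assms in auto)
  moreover have "(1 - (1 - \<beta>) / 2) *\<^sub>R (2 / (1 + \<beta>) * r) + ((1 - \<beta>) / 2) *\<^sub>R 0 = r"
    using assms by (simp add: field_simps)
  moreover have "1 - (1 - \<beta>) / 2 = (1 + \<beta>) / 2" by (simp add: field_simps)
  ultimately show ?thesis by simp
qed

text \<open>
  Bounded distortion in integrated form: on the branch of the letter \<open>a\<close>, the preimages of two sets
  inside a common cylinder of length \<open>n\<close> have measures in the same proportion as the sets themselves,
  up to the factor \<open>exp (C \<beta> ^ n)\<close>. For a Jacobian with a Lipschitz logarithm this results from
  integrating it over the two preimages. Taking \<open>E\<close> to be the whole space shows that every branch of
  positive measure is full up to null sets.
\<close>

locale gibbs_markov = prob_space N for N :: "'a measure" +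
  fixes S :: "'a \<Rightarrow> 'a" and letter :: "'a \<Rightarrow> 'i" and C \<beta> :: real
  assumes S_measurable [measurable]: "S \<in> measurable N N"
    and S_preserving: "distr N N S = N"
    and letter_sets [measurable]: "\<And>a. {x \<in> space N. letter x = a} \<in> sets N"
    and letter_countable: "countable (letter ` space N)"
    and C_nonneg: "0 \<le> C" and \<beta>_pos: "0 < \<beta>" and \<beta>_less_1: "\<beta> < 1"
    and distortion: "\<And>a n E F. E \<in> sets N \<Longrightarrow> F \<in> sets N \<Longrightarrow> same_itinerary S letter n (E \<union> F) \<Longrightarrow>
          prob {x \<in> space N. letter x = a \<and> S x \<in> E} * prob F
            \<le> exp (C * \<beta> ^ n) * (prob {x \<in> space N. letter x = a \<and> S x \<in> F} * prob E)"
begin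

text \<open>
  A set function behaving like a finite measure whose density with respect to \<open>N\<close> has a logarithm
  that oscillates by at most \<open>r \<beta> ^ n\<close> on each cylinder of length \<open>n\<close>. Real-valued set functions are
  used in place of measures because multiples of \<open>N\<close> are going to be subtracted, and ratios of masses
  in place of densities because the ratios pass to push-forwards by mere summation.
\<close>

definition regular :: "real \<Rightarrow> ('a set \<Rightarrow> real) \<Rightarrow> bool" where
  "regular r \<nu> \<longleftrightarrow>
     (\<forall>E\<in>sets N. 0 \<le> \<nu> E) \<and>
     (\<forall>F::nat \<Rightarrow> 'a set. range F \<subseteq> sets N \<longrightarrow> disjoint_family F \<longrightarrow> (\<lambda>i. \<nu> (F i)) sums \<nu> (\<Union>i. F i)) \<and>
     (\<forall>n. \<forall>E\<in>sets N. \<forall>F\<in>sets N. same_itinerary S letter n (E \<union> F) \<longrightarrow>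
        \<nu> E * prob F \<le> exp (r * \<beta> ^ n) * (\<nu> F * prob E))"

lemma regular_nonneg: "regular r \<nu> \<Longrightarrow> E \<in> sets N \<Longrightarrow> 0 \<le> \<nu> E"
  by (auto simp: regular_def)

lemma regular_sums:
  "regular r \<nu> \<Longrightarrow> range F \<subseteq> sets N \<Longrightarrow> disjoint_family F \<Longrightarrow> (\<lambda>i::nat. \<nu> (F i)) sums \<nu> (\<Union>i. F i)"
  by (auto simp: regular_def)

lemma regular_ratio:
  "regular r \<nu> \<Longrightarrow> E \<in> sets N \<Longrightarrow> F \<in> sets N \<Longrightarrow> same_itinerary S letter n (E \<union> F) \<Longrightarrow>
    \<nu> E * prob F \<le> exp (r * \<beta> ^ n) * (\<nu> F * prob E)"
  by (auto simp: regular_def)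

lemma regular_upper:
  assumes "regular r \<nu>" "E \<in> sets N"
  shows "\<nu> E \<le> exp r * (\<nu> (space N) * prob E)"
  using regular_ratio[OF assms, of "space N" 0] by (simp add: same_itinerary_def prob_space)

lemma regular_lower:
  assumes "regular r \<nu>" "E \<in> sets N"
  shows "\<nu> (space N) * prob E \<le> exp r * \<nu> E"
  using regular_ratio[OF assms(1) _ assms(2), of "space N" 0] by (simp add: same_itinerary_def prob_space)

lemma regular_cong:
  assumes \<nu>1: "regular r \<nu>1" and eq: "\<And>E. E \<in> sets N \<Longrightarrow> \<nu>1 E = \<nu>2 E"
  shows "regular r \<nu>2"
proof -
  have "\<nu>2 (\<Union>i. F i) = \<nu>1 (\<Union>i. F i)" if "range F \<subseteq> sets N" for F :: "nat \<Rightarrow> 'a set"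
    using that by (intro eq[symmetric] sets.countable_UN) auto
  then show ?thesis
    using \<nu>1 eq unfolding regular_def by (simp add: image_subset_iff)
qed

lemma regular_null:
  assumes "regular r \<nu>" "E \<in> sets N" "prob E = 0"
  shows "\<nu> E = 0"
  using regular_upper[OF assms(1,2)] regular_nonneg[OF assms(1,2)] assms(3) by simp

lemma regular_mono:
  assumes "regular r \<nu>" "r \<le> r'"
  shows "regular r' \<nu>"
proof -
  have "\<nu> E * prob F \<le> exp (r' * \<beta> ^ n) * (\<nu> F * prob E)"
    if "E \<in> sets N" "F \<in> sets N" "same_itinerary S letter n (E \<union> F)" for n E F
  proof -
    have "\<nu> E * prob F \<le> exp (r * \<beta> ^ n) * (\<nu> F * prob E)"
      by (rule regular_ratio) (use that assms in auto)
    also have "\<dots> \<le> exp (r' * \<beta> ^ n) * (\<nu> F * prob E)"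
      using assms(2) \<beta>_pos regular_nonneg[OF assms(1) that(2)]
      by (intro mult_right_mono) (auto intro!: mult_right_mono)
    finally show ?thesis .
  qed
  then show ?thesis using assms(1) unfolding regular_def by blast
qed

lemma regular_prob: "regular 0 prob"
  unfolding regular_def by (auto simp: finite_measure_UNION intro: finite_measure_UNION)

lemma branch_sets [measurable]:
  assumes "E \<in> sets N"
  shows "{x \<in> space N. letter x = a \<and> S x \<in> E} \<in> sets N"
proof -
  have "{x \<in> space N. letter x = a \<and> S x \<in> E} = {x \<in> space N. letter x = a} \<inter> (S -` E \<inter> space N)"
    by auto
  then show ?thesis using letter_sets assms by (metis S_measurable measurable_sets sets.Int)
qed

text \<open>
  Two points with \<open>n\<close> common letters have preimages on the same branch with \<open>n + 1\<close> common letters. This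
  gains a factor \<open>\<beta>\<close>, while the distortion of the branch costs the summand \<open>C\<close>. In the proof the two
  ratio inequalities are multiplied and the measures of the preimages cancel; if one of these measures
  vanishes, then so does the left-hand side.
\<close>

lemma regular_branch:
  assumes \<nu>: "regular r \<nu>"
  shows "regular (\<beta> * r + C) (\<lambda>E. \<nu> {x \<in> space N. letter x = a \<and> S x \<in> E})"
proof -
  let ?b = "\<lambda>E. {x \<in> space N. letter x = a \<and> S x \<in> E}"
  have sums: "(\<lambda>i. \<nu> (?b (F i))) sums \<nu> (?b (\<Union>i. F i))"
    if "range F \<subseteq> sets N" "disjoint_family F" for F :: "nat \<Rightarrow> 'a set"
  proof -
    have "(\<lambda>i. \<nu> (?b (F i))) sums \<nu> (\<Union>i. ?b (F i))"
      using that by (intro regular_sums[OF \<nu>]) (auto simp: disjoint_family_on_def)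
    also have "(\<Union>i. ?b (F i)) = ?b (\<Union>i. F i)" by auto
    finally show ?thesis .
  qed
  have ratio: "\<nu> (?b E) * prob F \<le> exp ((\<beta> * r + C) * \<beta> ^ n) * (\<nu> (?b F) * prob E)"
    if E: "E \<in> sets N" and F: "F \<in> sets N" and n: "same_itinerary S letter n (E \<union> F)" for n E F
  proof (cases "prob (?b E) = 0 \<or> prob F = 0")
    case True
    then have "\<nu> (?b E) * prob F = 0"
      using regular_null[OF \<nu>, of "?b E"] E by auto
    moreover have "0 \<le> exp ((\<beta> * r + C) * \<beta> ^ n) * (\<nu> (?b F) * prob E)"
      using regular_nonneg[OF \<nu> branch_sets[OF F]] by simp
    ultimately show ?thesis by linarith
  next
    case False
    have d: "prob (?b E) * prob F \<le> exp (C * \<beta> ^ n) * (prob (?b F) * prob E)"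
      by (rule distortion[OF E F n])
    have pos: "0 < prob (?b E)" "0 < prob F"
      using False by (auto simp: less_le)
    then have "0 < prob (?b E) * prob F" by simp
    with d have "0 < exp (C * \<beta> ^ n) * (prob (?b F) * prob E)" by linarith
    then have pos2: "0 < prob (?b F)" by (auto simp: zero_less_mult_iff)
    have "same_itinerary S letter (Suc n) (?b E \<union> ?b F)"
      unfolding same_itinerary_def
    proof (intro ballI allI impI)
      fix x y k assume *: "x \<in> ?b E \<union> ?b F" "y \<in> ?b E \<union> ?b F" "k < Suc n"
      then show "letter ((S ^^ k) x) = letter ((S ^^ k) y)"
        using n by (cases k) (auto simp: same_itinerary_def funpow_Suc_right simp del: funpow.simps)
    qed
    then have r: "\<nu> (?b E) * prob (?b F) \<le> exp (r * \<beta> ^ Suc n) * (\<nu> (?b F) * prob (?b E))"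
      using E F by (intro regular_ratio[OF \<nu>]) auto
    have "(\<nu> (?b E) * prob (?b F)) * (prob (?b E) * prob F)
       \<le> (exp (r * \<beta> ^ Suc n) * (\<nu> (?b F) * prob (?b E))) * (exp (C * \<beta> ^ n) * (prob (?b F) * prob E))"
      using r d by (rule mult_mono) (use regular_nonneg[OF \<nu>, of "?b F"] F in auto)
    also have "\<dots> = (prob (?b E) * prob (?b F)) * (exp (r * \<beta> ^ Suc n) * exp (C * \<beta> ^ n) * (\<nu> (?b F) * prob E))"
      by (simp add: ac_simps)
    finally have "(prob (?b E) * prob (?b F)) * (\<nu> (?b E) * prob F)
       \<le> (prob (?b E) * prob (?b F)) * (exp (r * \<beta> ^ Suc n) * exp (C * \<beta> ^ n) * (\<nu> (?b F) * prob E))"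
      by (simp add: ac_simps)
    then have "\<nu> (?b E) * prob F \<le> exp (r * \<beta> ^ Suc n) * exp (C * \<beta> ^ n) * (\<nu> (?b F) * prob E)"
      using pos pos2 by (subst (asm) mult_le_cancel_left_pos) auto
    also have "exp (r * \<beta> ^ Suc n) * exp (C * \<beta> ^ n) = exp ((\<beta> * r + C) * \<beta> ^ n)"
      by (simp add: exp_add[symmetric] algebra_simps)
    finally show ?thesis .
  qed
  show ?thesis
    unfolding regular_def using sums ratio regular_nonneg[OF \<nu>] by auto
qed

text \<open>
  Letters are enumerated by natural numbers so that countable additivity applies; indices that are
  not the code of a letter contribute the empty set.
\<close>

lemma regular_sum_letters:
  assumes \<nu>: "regular r \<nu>" and E: "E \<in> sets N"
  shows "(\<lambda>i. \<nu> {x \<in> space N. to_nat_on (letter ` space N) (letter x) = i \<and> x \<in> E}) sums \<nu> E"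
proof -
  let ?W = "letter ` space N"
  let ?B = "\<lambda>i. {x \<in> space N. to_nat_on ?W (letter x) = i \<and> x \<in> E}"
  have meas: "?B i \<in> sets N" for i
  proof (cases "\<exists>a\<in>?W. to_nat_on ?W a = i")
    case True
    then obtain a where a: "a \<in> ?W" "to_nat_on ?W a = i" by blast
    have "?B i = {x \<in> space N. letter x = a} \<inter> E"
      using a letter_countable sets.sets_into_space[OF E] by (auto dest: inj_onD[OF inj_on_to_nat_on])
    then show ?thesis using E by auto
  next
    case False
    then have "?B i = {}" by auto
    then show ?thesis by (simp only: sets.empty_sets)
  qed
  have "(\<lambda>i. \<nu> (?B i)) sums \<nu> (\<Union>i. ?B i)"
    using meas by (intro regular_sums[OF \<nu>]) (auto simp: disjoint_family_on_def)
  also have "(\<Union>i. ?B i) = E" using sets.sets_into_space[OF E] by auto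
  finally show ?thesis .
qed

lemma S_preimage_sets [measurable]: "E \<in> sets N \<Longrightarrow> {x \<in> space N. S x \<in> E} \<in> sets N"
  using measurable_sets[OF S_measurable] by (simp add: vimage_def Int_def conj_commute)

text \<open>
  The ratio inequality is linear in the set function, hence it survives summation over the branches.
\<close>

lemma regular_push:
  assumes \<nu>: "regular r \<nu>"
  shows "regular (\<beta> * r + C) (\<lambda>E. \<nu> {x \<in> space N. S x \<in> E})"
proof -
  let ?p = "\<lambda>E. {x \<in> space N. S x \<in> E}"
  let ?W = "letter ` space N"
  have sums: "(\<lambda>i. \<nu> (?p (F i))) sums \<nu> (?p (\<Union>i. F i))"
    if "range F \<subseteq> sets N" "disjoint_family F" for F :: "nat \<Rightarrow> 'a set"
  proof -
    have "(\<lambda>i. \<nu> (?p (F i))) sums \<nu> (\<Union>i. ?p (F i))"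
      using that by (intro regular_sums[OF \<nu>]) (auto simp: disjoint_family_on_def)
    also have "(\<Union>i. ?p (F i)) = ?p (\<Union>i. F i)" by auto
    finally show ?thesis .
  qed
  have ratio: "\<nu> (?p E) * prob F \<le> exp ((\<beta> * r + C) * \<beta> ^ n) * (\<nu> (?p F) * prob E)"
    if E: "E \<in> sets N" and F: "F \<in> sets N" and n: "same_itinerary S letter n (E \<union> F)" for n E F
  proof -
    let ?c = "\<lambda>E i. {x \<in> space N. to_nat_on ?W (letter x) = i \<and> x \<in> ?p E}"
    have s1: "(\<lambda>i. \<nu> (?c E i) * prob F) sums (\<nu> (?p E) * prob F)"
      using E by (intro sums_mult2 regular_sum_letters[OF \<nu>]) auto
    have s2: "(\<lambda>i. exp ((\<beta> * r + C) * \<beta> ^ n) * (\<nu> (?c F i) * prob E)) sums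
        (exp ((\<beta> * r + C) * \<beta> ^ n) * (\<nu> (?p F) * prob E))"
      using F by (intro sums_mult sums_mult2 regular_sum_letters[OF \<nu>]) auto
    have le: "\<nu> (?c E i) * prob F \<le> exp ((\<beta> * r + C) * \<beta> ^ n) * (\<nu> (?c F i) * prob E)" for i
    proof (cases "\<exists>a\<in>?W. to_nat_on ?W a = i")
      case True
      then obtain a where a: "a \<in> ?W" "to_nat_on ?W a = i" by blast
      have *: "?c E i = {x \<in> space N. letter x = a \<and> S x \<in> E}" for E
        using a letter_countable by (auto dest: inj_onD[OF inj_on_to_nat_on])
      show ?thesis
        unfolding * by (rule regular_ratio[OF regular_branch[OF \<nu>] E F n])
    next
      case False
      then have *: "?c E i = {}" for E by auto
      have "\<nu> {} = 0" by (rule regular_null[OF \<nu>]) auto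
      then show ?thesis unfolding * by simp
    qed
    show ?thesis by (rule sums_le[OF le s1 s2])
  qed
  show ?thesis
    unfolding regular_def using sums ratio regular_nonneg[OF \<nu>] by auto
qed

text \<open>
  Subtracting a constant from a density increases the oscillation of its logarithm, but by a factor
  close to \<open>1\<close> only if the density stays well above that constant. With the ratio \<open>2 / (1 - \<beta>)\<close>
  between the two the factor is \<open>2 / (1 + \<beta>)\<close>, by convexity of the exponential function.
\<close>

lemma regular_subtract:
  assumes \<nu>: "regular r \<nu>" and r: "0 \<le> r" and \<epsilon>: "0 \<le> \<epsilon>"
    and low: "\<And>E. E \<in> sets N \<Longrightarrow> 2 / (1 - \<beta>) * \<epsilon> * prob E \<le> \<nu> E"
  shows "regular (2 / (1 + \<beta>) * r) (\<lambda>E. \<nu> E - \<epsilon> * prob E)"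
proof -
  have K1: "1 \<le> 2 / (1 - \<beta>)"
    using \<beta>_pos \<beta>_less_1 by (simp add: field_simps)
  have nonneg: "0 \<le> \<nu> E - \<epsilon> * prob E" if "E \<in> sets N" for E
  proof -
    have "1 * (\<epsilon> * prob E) \<le> 2 / (1 - \<beta>) * (\<epsilon> * prob E)"
      using K1 \<epsilon> by (intro mult_right_mono) auto
    then show ?thesis using low[OF that] by simp
  qed
  have sums: "(\<lambda>i. \<nu> (F i) - \<epsilon> * prob (F i)) sums (\<nu> (\<Union>i. F i) - \<epsilon> * prob (\<Union>i. F i))"
    if "range F \<subseteq> sets N" "disjoint_family F" for F :: "nat \<Rightarrow> 'a set"
    by (intro sums_diff sums_mult regular_sums[OF \<nu> that] finite_measure_UNION that)
  have ratio: "(\<nu> E - \<epsilon> * prob E) * prob F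
      \<le> exp (2 / (1 + \<beta>) * r * \<beta> ^ n) * ((\<nu> F - \<epsilon> * prob F) * prob E)"
    if E: "E \<in> sets N" and F: "F \<in> sets N" and n: "same_itinerary S letter n (E \<union> F)" for n E F
  proof -
    let ?s = "r * \<beta> ^ n" and ?L = "exp (2 / (1 + \<beta>) * (r * \<beta> ^ n))"
    have s0: "0 \<le> ?s" using r \<beta>_pos by simp
    have "1 \<le> 2 / (1 + \<beta>)" using \<beta>_pos \<beta>_less_1 by (simp add: field_simps)
    then have Le: "exp ?s \<le> ?L"
      using mult_right_mono[OF _ s0, of 1 "2 / (1 + \<beta>)"] by simp
    have cv: "exp ?s \<le> (1 + \<beta>) / 2 * ?L + (1 - \<beta>) / 2"
      by (rule exp_convex_split[OF \<beta>_pos \<beta>_less_1])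
    have 1: "\<nu> E * prob F \<le> exp ?s * (\<nu> F * prob E)"
      by (rule regular_ratio[OF \<nu> E F n])
    have 2: "(?L - exp ?s) * (2 / (1 - \<beta>) * \<epsilon> * prob F) * prob E \<le> (?L - exp ?s) * \<nu> F * prob E"
      using Le low[OF F] by (intro mult_right_mono mult_left_mono) auto
    have "(1 - \<beta>) / 2 * (?L - 1) \<le> ?L - exp ?s"
      using cv by (simp add: field_simps)
    then have "?L - 1 \<le> (?L - exp ?s) * (2 / (1 - \<beta>))"
      using \<beta>_less_1 by (simp add: field_simps)
    then have 3: "(?L - 1) * (\<epsilon> * prob F * prob E) \<le> (?L - exp ?s) * (2 / (1 - \<beta>)) * (\<epsilon> * prob F * prob E)"
      using \<epsilon> by (intro mult_right_mono) auto
    have "(?L - 1) * (\<epsilon> * prob F * prob E) \<le> (?L - exp ?s) * \<nu> F * prob E"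
    proof -
      have "(?L - exp ?s) * (2 / (1 - \<beta>)) * (\<epsilon> * prob F * prob E)
          = (?L - exp ?s) * (2 / (1 - \<beta>) * \<epsilon> * prob F) * prob E"
        by (simp only: ac_simps)
      then show ?thesis using 2 3 by linarith
    qed
    then have "exp ?s * (\<nu> F * prob E) - \<epsilon> * prob E * prob F \<le> ?L * ((\<nu> F - \<epsilon> * prob F) * prob E)"
      by (simp add: algebra_simps)
    then show ?thesis using 1 by (simp add: algebra_simps)
  qed
  show ?thesis
    unfolding regular_def using nonneg sums ratio by auto
qed

text \<open>
  The oscillation \<open>r\<close> that is reproduced by a subtraction followed by a push-forward, that is, the
  fixed point of \<open>r \<mapsto> \<beta> (2 / (1 + \<beta>) r) + C\<close>.
\<close>

definition distortion_bound :: real where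
  "distortion_bound = C * (1 + \<beta>) / (1 - \<beta>)"

text \<open>
  The fraction of its mass that a set function of regularity \<open>distortion_bound\<close> can lose in the form of
  a multiple of \<open>N\<close>: its density is at least \<open>exp (- distortion_bound)\<close> times its mass, and the density
  has to exceed the subtracted constant by the factor \<open>2 / (1 - \<beta>)\<close>.
\<close>

definition gap :: real where
  "gap = exp (- distortion_bound) * (1 - \<beta>) / 2"

lemma distortion_bound_nonneg: "0 \<le> distortion_bound"
  using C_nonneg \<beta>_pos \<beta>_less_1 by (simp add: distortion_bound_def)

lemma gap_pos: "0 < gap" and gap_less_1: "gap < 1"
proof -
  show "0 < gap" using \<beta>_less_1 by (simp add: gap_def)
  have "exp (- distortion_bound) * (1 - \<beta>) \<le> 1 * 1"
    using distortion_bound_nonneg \<beta>_pos \<beta>_less_1 by (intro mult_mono) auto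
  then show "gap < 1" by (simp add: gap_def)
qed

lemma distortion_bound_absorbs: "\<beta> * (2 / (1 + \<beta>) * distortion_bound) + C = distortion_bound"
proof -
  have "(2 * \<beta> + (1 - \<beta>)) = 1 + \<beta>" by simp
  have "\<beta> * (2 / (1 + \<beta>) * distortion_bound) = 2 * \<beta> * C / (1 - \<beta>)"
    using \<beta>_pos \<beta>_less_1 unfolding distortion_bound_def by (simp add: divide_simps)
  moreover have "2 * \<beta> * C / (1 - \<beta>) + C = (2 * \<beta> * C + C * (1 - \<beta>)) / (1 - \<beta>)"
    using \<beta>_less_1 by (simp add: field_simps)
  ultimately show ?thesis by (simp add: distortion_bound_def algebra_simps)
qed

lemma distortion_bound_step: "\<beta> * distortion_bound + C \<le> distortion_bound"
proof -
  have "1 * distortion_bound \<le> 2 / (1 + \<beta>) * distortion_bound"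
    using distortion_bound_nonneg \<beta>_pos \<beta>_less_1 by (intro mult_right_mono) auto
  then have "\<beta> * distortion_bound \<le> \<beta> * (2 / (1 + \<beta>) * distortion_bound)"
    using \<beta>_pos by (intro mult_left_mono) auto
  then show ?thesis using distortion_bound_absorbs by linarith
qed

lemma prob_S_preimage: "E \<in> sets N \<Longrightarrow> prob {x \<in> space N. S x \<in> E} = prob E"
  using measure_distr[OF S_measurable, of E] S_preserving
  by (simp add: vimage_def Int_def conj_commute)

text \<open>
  Doeblin's argument: a push-forward consists of a fixed multiple of the invariant measure and of a
  remainder that is as regular as the original.
\<close>

lemma regular_contract:
  assumes \<nu>: "regular distortion_bound \<nu>"
  shows "regular distortion_bound (\<lambda>E. \<nu> {x \<in> space N. S x \<in> E} - gap * \<nu> (space N) * prob E)"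
proof -
  have m: "0 \<le> \<nu> (space N)" by (rule regular_nonneg[OF \<nu>]) simp
  have "2 / (1 - \<beta>) * (gap * \<nu> (space N)) * prob E \<le> \<nu> E" if E: "E \<in> sets N" for E
  proof -
    have "2 / (1 - \<beta>) * gap = exp (- distortion_bound)"
      using \<beta>_less_1 by (simp add: gap_def)
    then have "2 / (1 - \<beta>) * (gap * \<nu> (space N)) * prob E
        = exp (- distortion_bound) * (\<nu> (space N) * prob E)"
      by (metis mult.assoc)
    also have "\<dots> \<le> exp (- distortion_bound) * (exp distortion_bound * \<nu> E)"
      by (intro mult_left_mono regular_lower[OF \<nu> E]) auto
    also have "\<dots> = \<nu> E" by (simp add: exp_minus)
    finally show ?thesis .
  qed
  then have "regular (2 / (1 + \<beta>) * distortion_bound) (\<lambda>E. \<nu> E - (gap * \<nu> (space N)) * prob E)"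
    using m gap_pos distortion_bound_nonneg by (intro regular_subtract[OF \<nu>]) auto
  from regular_push[OF this] have
    "regular distortion_bound (\<lambda>E. \<nu> {x \<in> space N. S x \<in> E} -
       gap * \<nu> (space N) * prob {x \<in> space N. S x \<in> E})"
    unfolding distortion_bound_absorbs .
  then show ?thesis by (rule regular_cong) (simp add: prob_S_preimage)
qed

lemma S_pow_measurable [measurable]: "S ^^ j \<in> measurable N N"
  by (induction j) auto

lemma prob_S_pow_preimage: "E \<in> sets N \<Longrightarrow> prob {x \<in> space N. (S ^^ j) x \<in> E} = prob E"
proof (induction j)
  case 0
  then show ?case by (auto intro!: arg_cong[of _ _ prob] dest: sets.sets_into_space)
next
  case (Suc j)
  let ?E = "{x \<in> space N. (S ^^ j) x \<in> E}"
  have "{x \<in> space N. (S ^^ Suc j) x \<in> E} = {x \<in> space N. S x \<in> ?E}"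
    using measurable_space[OF S_measurable] by (auto simp: funpow_Suc_right simp del: funpow.simps)
  moreover have "?E \<in> sets N" using Suc by measurable
  ultimately show ?case using Suc prob_S_preimage[of ?E] by simp
qed

text \<open>
  After \<open>j\<close> splittings the remainder has mass \<open>(1 - gap) ^ j\<close>, and being regular it is at most
  \<open>exp distortion_bound\<close> times a multiple of \<open>N\<close>. So the error is small relative to the measure of \<open>E\<close>
  itself, and it can later be integrated against unbounded functions.
\<close>

lemma regular_mixing:
  assumes "regular distortion_bound \<nu>" and E: "E \<in> sets N"
  shows "\<bar>\<nu> {x \<in> space N. (S ^^ j) x \<in> E} - \<nu> (space N) * prob E\<bar>
     \<le> exp distortion_bound * (1 - gap) ^ j * (\<nu> (space N) * prob E)"
proof -
  let ?p = "\<lambda>j. {x \<in> space N. (S ^^ j) x \<in> E}"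
  have "\<exists>\<nu>'. regular distortion_bound \<nu>' \<and> \<nu>' (space N) = (1 - gap) ^ j * \<nu> (space N) \<and>
      (\<nu> (?p j) = (1 - (1 - gap) ^ j) * \<nu> (space N) * prob E + \<nu>' E)"
    using assms(1)
  proof (induction j arbitrary: \<nu>)
    case 0
    have "?p 0 = E" using sets.sets_into_space[OF E] by auto
    then show ?case using 0 by auto
  next
    case (Suc j)
    \<comment> \<open>The remainder of the first splitting; the multiple of N that is split off is invariant.\<close>
    define \<nu>1 where "\<nu>1 = (\<lambda>E. \<nu> {x \<in> space N. S x \<in> E} - gap * \<nu> (space N) * prob E)"
    have \<nu>1: "regular distortion_bound \<nu>1"
      unfolding \<nu>1_def by (rule regular_contract) fact
    have "{x \<in> space N. S x \<in> space N} = space N"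
      using measurable_space[OF S_measurable] by auto
    then have mass: "\<nu>1 (space N) = (1 - gap) * \<nu> (space N)"
      by (simp add: \<nu>1_def prob_space algebra_simps)
    from Suc.IH[OF \<nu>1] obtain \<nu>' where \<nu>': "regular distortion_bound \<nu>'"
      "\<nu>' (space N) = (1 - gap) ^ j * \<nu>1 (space N)"
      "\<nu>1 (?p j) = (1 - (1 - gap) ^ j) * \<nu>1 (space N) * prob E + \<nu>' E" by blast
    have "?p (Suc j) = {x \<in> space N. S x \<in> ?p j}"
      using measurable_space[OF S_measurable] by (auto simp: funpow_Suc_right simp del: funpow.simps)
    then have "\<nu> (?p (Suc j)) = \<nu>1 (?p j) + gap * \<nu> (space N) * prob E"
      by (simp add: \<nu>1_def prob_S_pow_preimage[OF E])
    also have "\<dots> = (1 - (1 - gap) ^ Suc j) * \<nu> (space N) * prob E + \<nu>' E"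
      unfolding \<nu>' mass by (simp add: algebra_simps)
    finally show ?case using \<nu>' mass by auto
  qed
  then obtain \<nu>' where \<nu>': "regular distortion_bound \<nu>'" "\<nu>' (space N) = (1 - gap) ^ j * \<nu> (space N)"
      "\<nu> (?p j) = (1 - (1 - gap) ^ j) * \<nu> (space N) * prob E + \<nu>' E" by blast
  have m: "0 \<le> \<nu> (space N) * prob E" using regular_nonneg[OF assms(1), of "space N"] by simp
  have u: "\<nu>' E \<le> exp distortion_bound * (1 - gap) ^ j * (\<nu> (space N) * prob E)"
    using regular_upper[OF \<nu>'(1) E] \<nu>'(2) by (simp add: ac_simps)
  have "1 * ((1 - gap) ^ j * (\<nu> (space N) * prob E))
      \<le> exp distortion_bound * ((1 - gap) ^ j * (\<nu> (space N) * prob E))"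
    using gap_less_1 m distortion_bound_nonneg by (intro mult_right_mono) auto
  moreover have "0 \<le> \<nu>' E" by (rule regular_nonneg[OF \<nu>'(1) E])
  moreover have "\<nu> (?p j) - \<nu> (space N) * prob E = \<nu>' E - (1 - gap) ^ j * (\<nu> (space N) * prob E)"
    unfolding \<nu>'(3) by (simp add: algebra_simps)
  moreover have "0 \<le> (1 - gap) ^ j * (\<nu> (space N) * prob E)"
    using gap_less_1 m by simp
  ultimately show ?thesis using u by (simp add: abs_le_iff mult.assoc)
qed

end

section \<open>Itineraries: past and future\<close>

lemma nn_integral_le_scale:
  assumes sets: "sets M1 = sets M2" and le: "\<And>E. E \<in> sets M2 \<Longrightarrow> emeasure M1 E \<le> c * emeasure M2 E"
    and g: "g \<in> borel_measurable M2"
  shows "(\<integral>\<^sup>+x. g x \<partial>M1) \<le> c * (\<integral>\<^sup>+x. g x \<partial>M2)"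
proof -
  have "M1 \<le> scale_measure c M2"
    using sets le by (subst le_measure) auto
  then have "(\<integral>\<^sup>+x. g x \<partial>M1) \<le> (\<integral>\<^sup>+x. g x \<partial>scale_measure c M2)"
    using sets by (intro nn_integral_mono_measure) auto
  also have "\<dots> = c * (\<integral>\<^sup>+x. g x \<partial>M2)"
    by (rule nn_integral_scale_measure) (use g in simp)
  finally show ?thesis .
qed

context gibbs_markov
begin

definition word :: "nat \<Rightarrow> 'a \<Rightarrow> 'i list" where
  "word i x = map (\<lambda>k. letter ((S ^^ k) x)) [0..<i]"

abbreviation cylinder :: "nat \<Rightarrow> 'i list \<Rightarrow> 'a set" where
  "cylinder i w \<equiv> {x \<in> space N. word i x = w}"

lemma word_0 [simp]: "word 0 x = []"
  and word_Suc: "word (Suc i) x = word i x @ [letter ((S ^^ i) x)]"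
  and length_word [simp]: "length (word i x) = i"
  by (simp_all add: word_def)

lemma nth_word: "j < i \<Longrightarrow> word i x ! j = letter ((S ^^ j) x)"
  by (simp add: word_def)

lemma countable_words: "countable (word i ` space N)"
proof (rule countable_subset)
  show "word i ` space N \<subseteq> lists (letter ` space N)"
    using measurable_space[OF S_pow_measurable] by (auto simp: word_def)
  show "countable (lists (letter ` space N))"
    using letter_countable by (rule countable_lists)
qed

lemma letter_pow_sets: "{x \<in> space N. letter ((S ^^ k) x) = a} \<in> sets N"
proof -
  have "{x \<in> space N. letter ((S ^^ k) x) = a} = (S ^^ k) -` {x \<in> space N. letter x = a} \<inter> space N"
    using measurable_space[OF S_pow_measurable] by auto
  then show ?thesis using letter_sets measurable_sets[OF S_pow_measurable] by metis
qed

lemma cylinder_sets [measurable]: "cylinder i w \<in> sets N"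
proof (cases "length w = i")
  case True
  then have "cylinder i w = {x \<in> space N. \<forall>k\<in>{..<i}. letter ((S ^^ k) x) = w ! k}"
    by (auto simp: list_eq_iff_nth_eq nth_word)
  also have "\<dots> \<in> sets N"
    by (intro sets.sets_Collect_finite_All letter_pow_sets) auto
  finally show ?thesis .
next
  case False
  then have "cylinder i w = {}" by auto
  then show ?thesis by (simp only: sets.empty_sets)
qed

lemma word_measurable [measurable]: "word i \<in> measurable N (count_space UNIV)"
proof (rule measurableI)
  fix X :: "'i list set"
  have "word i -` X \<inter> space N = (\<Union>w\<in>X \<inter> word i ` space N. cylinder i w)" by auto
  also have "\<dots> \<in> sets N"
    using countable_words by (intro sets.countable_UN'') auto
  finally show "word i -` X \<inter> space N \<in> sets N" .
qed auto

lemma word_compose_measurable: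
  "f \<in> UNIV \<rightarrow> space L \<Longrightarrow> (\<lambda>x. f (word i x)) \<in> measurable N L"
  by (rule measurable_compose[OF word_measurable]) simp

lemma letter_measurable [measurable]: "letter \<in> measurable N (count_space UNIV)"
proof -
  have "letter = (\<lambda>x. hd (word 1 x))" by (simp add: word_def fun_eq_iff)
  also have "\<dots> \<in> measurable N (count_space UNIV)"
    by (rule word_compose_measurable) simp
  finally show ?thesis .
qed

lemma past_sets [measurable]: "{x \<in> space N. Q (word i x)} \<in> sets N"
  using word_compose_measurable[of Q "count_space UNIV" i] by (intro predE) simp

lemma S_pow_preimage_sets [measurable]: "E \<in> sets N \<Longrightarrow> {x \<in> space N. (S ^^ j) x \<in> E} \<in> sets N"
  using measurable_sets[OF S_pow_measurable] by (simp add: vimage_def Int_def conj_commute)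

lemma past_future_sets [measurable]:
  "E \<in> sets N \<Longrightarrow> {x \<in> space N. Q (word i x) \<and> (S ^^ j) x \<in> E} \<in> sets N"
  by (intro sets.sets_Collect_conj past_sets S_pow_preimage_sets)

text \<open>
  The law of the future, given a past, is regular uniformly in the past: every further letter
  amounts to one branch, and \<open>distortion_bound\<close> is reproduced by \<open>regular_branch\<close>.
\<close>

lemma regular_cylinder:
  assumes "length w = i"
  shows "regular distortion_bound (\<lambda>E. prob {x \<in> space N. word i x = w \<and> (S ^^ i) x \<in> E})"
  using assms
proof (induction i arbitrary: w)
  case 0
  have *: "{x \<in> space N. word 0 x = w \<and> (S ^^ 0) x \<in> E} = E" if "E \<in> sets N" for E
    using 0 sets.sets_into_space[OF that] by auto
  have "regular distortion_bound prob"
    by (rule regular_mono[OF regular_prob distortion_bound_nonneg])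
  then show ?case
    by (rule regular_cong) (simp only: *)
next
  case (Suc i)
  obtain w' a where w: "w = w' @ [a]" using Suc.prems by (metis length_Suc_conv_rev)
  then have "length w' = i" using Suc.prems by simp
  from regular_mono[OF regular_branch[OF Suc.IH[OF this], of a] distortion_bound_step]
  have "regular distortion_bound (\<lambda>E. prob {x \<in> space N. word i x = w' \<and>
      (S ^^ i) x \<in> {x \<in> space N. letter x = a \<and> S x \<in> E}})" .
  moreover have "{x \<in> space N. word i x = w' \<and> (S ^^ i) x \<in> {x \<in> space N. letter x = a \<and> S x \<in> E}}
     = {x \<in> space N. word (Suc i) x = w \<and> (S ^^ Suc i) x \<in> E}" for E
    using measurable_space[OF S_pow_measurable] by (auto simp: w word_Suc)
  ultimately show ?case by simp
qed

lemma cylinder_mixing: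
  assumes E: "E \<in> sets N"
  shows "\<bar>prob {x \<in> space N. word i x = w \<and> (S ^^ (i + j)) x \<in> E} - prob (cylinder i w) * prob E\<bar>
     \<le> exp distortion_bound * (1 - gap) ^ j * (prob (cylinder i w) * prob E)"
proof (cases "length w = i")
  case True
  have eq: "{x \<in> space N. word i x = w \<and> (S ^^ i) x \<in> {x \<in> space N. (S ^^ j) x \<in> E}}
     = {x \<in> space N. word i x = w \<and> (S ^^ (i + j)) x \<in> E}"
    using measurable_space[OF S_pow_measurable] by (auto simp: funpow_add add.commute[of i j])
  have eq2: "{x \<in> space N. word i x = w \<and> (S ^^ i) x \<in> space N} = cylinder i w"
    using measurable_space[OF S_pow_measurable] by auto
  show ?thesis
    using regular_mixing[OF regular_cylinder[OF True] E, of j] unfolding eq eq2 .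
next
  case False
  then have "cylinder i w = {}" "{x \<in> space N. word i x = w \<and> (S ^^ (i + j)) x \<in> E} = {}" by auto
  then show ?thesis by (simp only: measure_empty)
qed

text \<open>
  The cylinders of a fixed length form a countable partition, and integrals over the first \<open>m\<close> of them
  converge to the integral by dominated convergence. The purpose is to check identities and
  inequalities for functions of past and future on one cylinder at a time, where the past is constant.
\<close>

lemma integral_nonneg_by_words:
  fixes f :: "'a \<Rightarrow> real"
  assumes f [measurable]: "integrable N f" and pos: "\<And>w. 0 \<le> (\<integral>x. indicator (cylinder i w) x * f x \<partial>N)"
  shows "0 \<le> (\<integral>x. f x \<partial>N)"
proof -
  let ?W = "word i ` space N"
  define code where "code x = to_nat_on ?W (word i x)" for x
  have [measurable]: "code \<in> measurable N (count_space UNIV)"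
    unfolding code_def by (rule word_compose_measurable) simp
  have lim: "(\<lambda>m. \<integral>x. indicator {x. code x < m} x * f x \<partial>N) \<longlonglongrightarrow> (\<integral>x. f x \<partial>N)"
  proof (rule integral_dominated_convergence[where w = "\<lambda>x. norm (f x)"])
    show "AE x in N. (\<lambda>m. indicator {x. code x < m} x * f x) \<longlonglongrightarrow> f x"
    proof (rule AE_I2)
      fix x
      have "\<forall>\<^sub>F m in sequentially. indicator {x. code x < m} x * f x = f x"
        using eventually_gt_at_top[of "code x"] by eventually_elim simp
      then show "(\<lambda>m. indicator {x. code x < m} x * f x) \<longlonglongrightarrow> f x"
        by (rule tendsto_eventually)
    qed
  qed (use f in \<open>auto split: split_indicator\<close>)
  have piece: "0 \<le> (\<integral>x. indicator {x. code x = n} x * f x \<partial>N)" for n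
  proof (cases "\<exists>w\<in>?W. to_nat_on ?W w = n")
    case True
    then obtain w where w: "w \<in> ?W" "to_nat_on ?W w = n" by blast
    have "x \<in> space N \<Longrightarrow> code x = n \<longleftrightarrow> word i x = w" for x
      using w countable_words[of i] by (auto simp: code_def dest: inj_onD[OF inj_on_to_nat_on])
    then have "(\<integral>x. indicator {x. code x = n} x * f x \<partial>N) = (\<integral>x. indicator (cylinder i w) x * f x \<partial>N)"
      by (intro Bochner_Integration.integral_cong) (auto split: split_indicator)
    then show ?thesis using pos by simp
  next
    case False
    then have "x \<in> space N \<Longrightarrow> code x \<noteq> n" for x by (auto simp: code_def)
    then have "(\<integral>x. indicator {x. code x = n} x * f x \<partial>N) = (\<integral>x. 0 \<partial>N)"
      by (intro Bochner_Integration.integral_cong) (auto split: split_indicator)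
    then show ?thesis by simp
  qed
  have int: "integrable N (\<lambda>x. indicator {x. code x = n} x * f x)" for n
    using f by (rule Bochner_Integration.integrable_bound) (auto split: split_indicator)
  have "0 \<le> (\<integral>x. indicator {x. code x < m} x * f x \<partial>N)" for m
  proof -
    have "(\<integral>x. indicator {x. code x < m} x * f x \<partial>N)
        = (\<integral>x. (\<Sum>n<m. indicator {x. code x = n} x * f x) \<partial>N)"
      by (intro Bochner_Integration.integral_cong)
        (auto simp: sum_distrib_right[symmetric] indicator_def sum.delta')
    also have "\<dots> = (\<Sum>n<m. \<integral>x. indicator {x. code x = n} x * f x \<partial>N)"
      using int by (intro Bochner_Integration.integral_sum)
    also have "\<dots> \<ge> 0" using piece by (intro sum_nonneg)
    finally show ?thesis .
  qed
  then show ?thesis by (intro LIMSEQ_le_const[OF lim]) auto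
qed

lemma integral_zero_by_words:
  fixes f :: "'a \<Rightarrow> real"
  assumes "integrable N f" "\<And>w. (\<integral>x. indicator (cylinder i w) x * f x \<partial>N) = 0"
  shows "(\<integral>x. f x \<partial>N) = 0"
  using integral_nonneg_by_words[of f i] integral_nonneg_by_words[of "\<lambda>x. - f x" i] assms by simp

text \<open>
  Independence of past and future up to a constant factor: on each cylinder it is regularity with
  \<open>n = 0\<close>, and the past is a union of cylinders.
\<close>

lemma past_future:
  fixes Q :: "'i list \<Rightarrow> bool"
  assumes E [measurable]: "E \<in> sets N"
  shows "prob {x \<in> space N. Q (word i x)} * prob E
      \<le> exp distortion_bound * prob {x \<in> space N. Q (word i x) \<and> (S ^^ i) x \<in> E}" (is "?lower")
    and "prob {x \<in> space N. Q (word i x) \<and> (S ^^ i) x \<in> E}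
      \<le> exp distortion_bound * (prob {x \<in> space N. Q (word i x)} * prob E)" (is "?upper")
proof -
  let ?P = "{x \<in> space N. Q (word i x)}" and ?F = "{x \<in> space N. Q (word i x) \<and> (S ^^ i) x \<in> E}"
  let ?D = "exp distortion_bound"
  have cyl: "(\<integral>x. indicator (cylinder i w) x * (a * indicator ?F x + c * indicator ?P x) \<partial>N)
      = (if Q w then a * prob {x \<in> space N. word i x = w \<and> (S ^^ i) x \<in> E} + c * prob (cylinder i w) else 0)"
    for a c :: real and w
  proof -
    have "(\<integral>x. indicator (cylinder i w) x * (a * indicator ?F x + c * indicator ?P x) \<partial>N)
      = (\<integral>x. (if Q w then a * indicator {x \<in> space N. word i x = w \<and> (S ^^ i) x \<in> E} x
            + c * indicator (cylinder i w) x else 0) \<partial>N)"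
      by (intro Bochner_Integration.integral_cong) (auto split: split_indicator)
    also have "\<dots> = (if Q w then a * prob {x \<in> space N. word i x = w \<and> (S ^^ i) x \<in> E} + c * prob (cylinder i w) else 0)"
    proof (cases "Q w")
      case True
      have "integrable N (\<lambda>x. a * indicator {x \<in> space N. word i x = w \<and> (S ^^ i) x \<in> E} x)"
        "integrable N (\<lambda>x. c * indicator (cylinder i w) x)"
        by (auto intro!: integrable_mult_right integrable_real_indicator simp: emeasure_eq_measure)
      then show ?thesis using True by simp
    qed simp
    finally show ?thesis .
  qed
  have reg: "prob (cylinder i w) * prob E \<le> ?D * prob {x \<in> space N. word i x = w \<and> (S ^^ i) x \<in> E}"
     "prob {x \<in> space N. word i x = w \<and> (S ^^ i) x \<in> E} \<le> ?D * (prob (cylinder i w) * prob E)" for w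
  proof -
    have eq2: "{x \<in> space N. word i x = w \<and> (S ^^ i) x \<in> space N} = cylinder i w"
      using measurable_space[OF S_pow_measurable] by auto
    have empty: "cylinder i w = {}" "{x \<in> space N. word i x = w \<and> (S ^^ i) x \<in> E} = {}"
      if "length w \<noteq> i" using that by auto
    show "prob (cylinder i w) * prob E \<le> ?D * prob {x \<in> space N. word i x = w \<and> (S ^^ i) x \<in> E}"
     "prob {x \<in> space N. word i x = w \<and> (S ^^ i) x \<in> E} \<le> ?D * (prob (cylinder i w) * prob E)"
      using regular_lower[OF regular_cylinder E, of w i] regular_upper[OF regular_cylinder E, of w i]
      unfolding eq2 by (cases "length w = i"; simp only: empty measure_empty; simp)+
  qed
  have int: "integrable N (\<lambda>x. a * indicator ?F x + c * indicator ?P x :: real)" for a c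
    by (auto intro!: Bochner_Integration.integrable_add integrable_mult_right integrable_real_indicator simp: emeasure_eq_measure)
  have val: "(\<integral>x. a * indicator ?F x + c * indicator ?P x \<partial>N) = a * prob ?F + c * prob ?P" for a c :: real
  proof -
    have "integrable N (\<lambda>x. a * indicator ?F x)" "integrable N (\<lambda>x. c * indicator ?P x)"
      by (auto intro!: integrable_mult_right integrable_real_indicator simp: emeasure_eq_measure)
    then show ?thesis by simp
  qed
  have "0 \<le> (\<integral>x. ?D * indicator ?F x + (- prob E) * indicator ?P x \<partial>N)"
    by (rule integral_nonneg_by_words[OF int, where i = i]) (use reg(1) in \<open>simp only: cyl, simp add: mult.commute\<close>)
  then show ?lower unfolding val by (simp add: mult.commute)
  have "0 \<le> (\<integral>x. (-1) * indicator ?F x + (?D * prob E) * indicator ?P x \<partial>N)"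
    by (rule integral_nonneg_by_words[OF int, where i = i]) (use reg(2) in \<open>simp only: cyl, simp add: ac_simps\<close>)
  then show ?upper unfolding val by (simp add: ac_simps)
qed

lemma integral_S_pow:
  fixes g :: "'a \<Rightarrow> real"
  assumes "g \<in> borel_measurable N"
  shows "(\<integral>x. g ((S ^^ j) x) \<partial>N) = (\<integral>x. g x \<partial>N)"
    and "integrable N (\<lambda>x. g ((S ^^ j) x)) \<longleftrightarrow> integrable N g"
proof -
  have d: "distr N N (S ^^ j) = N"
  proof (induction j)
    case 0
    show ?case by (simp add: distr_id2 id_def)
  next
    case (Suc j)
    have "distr N N (S ^^ Suc j) = distr (distr N N (S ^^ j)) N S"
      by (subst distr_distr) auto
    also have "\<dots> = N" unfolding Suc by (rule S_preserving)
    finally show ?case .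
  qed
  have 1: "integral\<^sup>L (distr N N (S ^^ j)) g = (\<integral>x. g ((S ^^ j) x) \<partial>N)"
    by (rule integral_distr) (use assms in auto)
  have 2: "integrable (distr N N (S ^^ j)) g \<longleftrightarrow> integrable N (\<lambda>x. g ((S ^^ j) x))"
    by (rule integrable_distr_eq) (use assms in auto)
  show "(\<integral>x. g ((S ^^ j) x) \<partial>N) = (\<integral>x. g x \<partial>N)" using 1 unfolding d by simp
  show "integrable N (\<lambda>x. g ((S ^^ j) x)) \<longleftrightarrow> integrable N g" using 2 unfolding d by simp
qed

text \<open>
  The two-sided mixing estimate for sets compares two measures up to factors \<open>1 + \<eta>\<close> and \<open>1 - \<eta>\<close>,
  and such comparisons carry over to integrals of nonnegative functions. The lower bound is trivial if
  \<open>\<eta> > 1\<close>.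
\<close>

lemma cylinder_integral_mixing:
  fixes g :: "'a \<Rightarrow> real"
  assumes g: "integrable N g" and pos: "\<And>x. 0 \<le> g x"
  shows "\<bar>(\<integral>x. indicator (cylinder i w) x * g ((S ^^ (i + j)) x) \<partial>N) - prob (cylinder i w) * (\<integral>x. g x \<partial>N)\<bar>
     \<le> exp distortion_bound * (1 - gap) ^ j * (prob (cylinder i w) * (\<integral>x. g x \<partial>N))"
proof -
  note [measurable] = borel_measurable_integrable[OF g]
  let ?c = "cylinder i w" and ?T = "S ^^ (i + j)"
  define \<eta> where "\<eta> = exp distortion_bound * (1 - gap) ^ j"
  define M1 where "M1 = distr (density N (indicator ?c)) N ?T"
  have sets1: "sets M1 = sets N" by (simp add: M1_def)
  have e1: "emeasure M1 E = ennreal (prob {x \<in> space N. word i x = w \<and> ?T x \<in> E})" if [measurable]: "E \<in> sets N" for E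
  proof -
    have "emeasure M1 E = (\<integral>\<^sup>+x. indicator ?c x * indicator (?T -` E \<inter> space N) x \<partial>N)"
      unfolding M1_def by (subst emeasure_distr) (auto simp: emeasure_density)
    also have "\<dots> = (\<integral>\<^sup>+x. indicator {x \<in> space N. word i x = w \<and> ?T x \<in> E} x \<partial>N)"
      by (intro nn_integral_cong) (auto split: split_indicator)
    also have "\<dots> = emeasure N {x \<in> space N. word i x = w \<and> ?T x \<in> E}"
      by (rule nn_integral_indicator) measurable
    finally show ?thesis by (simp add: emeasure_eq_measure)
  qed
  have eta: "0 \<le> \<eta>" using gap_less_1 by (simp add: \<eta>_def)
  have mix: "\<bar>prob {x \<in> space N. word i x = w \<and> ?T x \<in> E} - prob ?c * prob E\<bar> \<le> \<eta> * (prob ?c * prob E)"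
    if "E \<in> sets N" for E
    using cylinder_mixing[OF that] by (simp add: \<eta>_def)
  define I where "I = (\<integral>x. indicator ?c x * g (?T x) \<partial>N)"
  define G where "G = (\<integral>x. g x \<partial>N)"
  have G0: "0 \<le> G" using pos by (simp add: G_def)
  have gT: "integrable N (\<lambda>x. g (?T x))" using integral_S_pow(2)[of g "i + j"] g by simp
  have intI: "integrable N (\<lambda>x. indicator ?c x * g (?T x))"
    by (rule Bochner_Integration.integrable_bound[OF gT]) (auto split: split_indicator)
  have n1: "(\<integral>\<^sup>+x. ennreal (g x) \<partial>M1) = ennreal I"
  proof -
    have "(\<integral>\<^sup>+x. ennreal (g x) \<partial>M1) = (\<integral>\<^sup>+x. indicator ?c x * ennreal (g (?T x)) \<partial>N)"
      unfolding M1_def by (subst nn_integral_distr) (auto simp: nn_integral_density)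
    also have "\<dots> = (\<integral>\<^sup>+x. ennreal (indicator ?c x * g (?T x)) \<partial>N)"
      by (intro nn_integral_cong) (auto split: split_indicator)
    also have "\<dots> = ennreal I"
      unfolding I_def by (rule nn_integral_eq_integral[OF intI]) (use pos in auto)
    finally show ?thesis .
  qed
  have n2: "(\<integral>\<^sup>+x. ennreal (g x) \<partial>N) = ennreal G"
    unfolding G_def by (rule nn_integral_eq_integral[OF g]) (use pos in auto)
  have I0: "0 \<le> I" using pos by (simp add: I_def)
  have "ennreal I \<le> ennreal ((1 + \<eta>) * prob ?c) * ennreal G"
    unfolding n1[symmetric] n2[symmetric]
  proof (rule nn_integral_le_scale[OF sets1])
    fix E assume E: "E \<in> sets N"
    show "emeasure M1 E \<le> ennreal ((1 + \<eta>) * prob ?c) * emeasure N E"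
    proof -
      have "prob {x \<in> space N. word i x = w \<and> ?T x \<in> E} \<le> (1 + \<eta>) * prob ?c * prob E"
        using mix[OF E] by (simp add: algebra_simps abs_le_iff)
      then show ?thesis
        unfolding e1[OF E] emeasure_eq_measure using eta
        by (subst ennreal_mult[symmetric]) (auto intro!: ennreal_leI)
    qed
  qed simp
  then have up: "I \<le> (1 + \<eta>) * prob ?c * G"
    using eta G0 by (subst (asm) ennreal_mult[symmetric]) auto
  have lo: "(1 - \<eta>) * prob ?c * G \<le> I"
  proof (cases "\<eta> \<le> 1")
    case True
    have "ennreal ((1 - \<eta>) * prob ?c) * ennreal G \<le> 1 * ennreal I"
    proof -
      have "(\<integral>\<^sup>+x. ennreal (g x) \<partial>scale_measure (ennreal ((1 - \<eta>) * prob ?c)) N) \<le> 1 * (\<integral>\<^sup>+x. ennreal (g x) \<partial>M1)"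
      proof (rule nn_integral_le_scale)
        fix E assume "E \<in> sets M1"
        then have E: "E \<in> sets N" using sets1 by simp
        show "emeasure (scale_measure (ennreal ((1 - \<eta>) * prob ?c)) N) E \<le> 1 * emeasure M1 E"
        proof -
          have "(1 - \<eta>) * prob ?c * prob E \<le> prob {x \<in> space N. word i x = w \<and> ?T x \<in> E}"
            using mix[OF E] by (simp add: algebra_simps abs_le_iff)
          then show ?thesis
            unfolding e1[OF E] using True
            by (simp add: emeasure_eq_measure ennreal_mult[symmetric])
        qed
      qed (auto simp: M1_def)
      then show ?thesis by (simp add: nn_integral_scale_measure n1 n2)
    qed
    then show ?thesis
      using True G0 I0 by (subst (asm) ennreal_mult[symmetric]) auto
  next
    case False
    then have "(1 - \<eta>) * (prob ?c * G) \<le> 0"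
      using G0 by (intro mult_nonpos_nonneg) auto
    then show ?thesis using I0 by (simp add: mult.assoc)
  qed
  show ?thesis
    using up lo unfolding I_def[symmetric] G_def[symmetric] \<eta>_def[symmetric] by (simp add: algebra_simps abs_le_iff)
qed

end

section \<open>Centered sums are nonnegative with positive probability\<close>

definition clip :: "real \<Rightarrow> real \<Rightarrow> real" where
  "clip B s = max (- B) (min B s)"

text \<open>
  Twice the Huber loss: the function \<open>s\<^sup>2\<close> on \<open>[- B, B]\<close>, continued by its tangents. Its derivative is
  \<open>2 clip B\<close>.
\<close>

definition huber :: "real \<Rightarrow> real \<Rightarrow> real" where
  "huber B s = 2 * clip B s * s - (clip B s)\<^sup>2"

lemma huber_ge_affine:
  assumes "\<bar>l\<bar> \<le> B"
  shows "2 * l * s - l\<^sup>2 \<le> huber B s"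
proof -
  have "huber B s - (2 * l * s - l\<^sup>2) = (l - clip B s) * (l + clip B s - 2 * s)"
    by (simp add: huber_def power2_eq_square algebra_simps)
  moreover consider "s < - B" "clip B s = - B" | "\<bar>s\<bar> \<le> B" "clip B s = s" | "B < s" "clip B s = B"
    using assms by (auto simp: clip_def abs_le_iff) linarith
  then have "0 \<le> (l - clip B s) * (l + clip B s - 2 * s)"
    using assms by cases (auto intro!: mult_nonneg_nonneg mult_nonpos_nonpos simp: abs_le_iff)
  ultimately show ?thesis by linarith
qed

text \<open>
  Without the last summand on the left this is convexity. A step \<open>d \<ge> 1\<close> from a point with
  \<open>\<bar>s\<bar> + 1 \<le> B\<close> gains at least \<open>1\<close> over the tangent at \<open>s\<close>, as the tangent at \<open>s + 1\<close> already shows.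
\<close>

lemma huber_increment:
  assumes "0 \<le> B"
  shows "huber B s + 2 * clip B s * d + (if \<bar>s\<bar> + 1 \<le> B \<and> 1 \<le> d then 1 else 0) \<le> huber B (s + d)"
proof (cases "\<bar>s\<bar> + 1 \<le> B \<and> 1 \<le> d")
  case True
  then have "clip B s = s" by (auto simp: clip_def abs_le_iff)
  then have "huber B s + 2 * clip B s * d + 1 = s\<^sup>2 + 2 * s * d + 1"
    by (simp add: huber_def power2_eq_square)
  also have "\<dots> \<le> 2 * (s + 1) * (s + d) - (s + 1)\<^sup>2"
    using True by (simp add: power2_eq_square algebra_simps)
  also have "\<dots> \<le> huber B (s + d)"
    by (rule huber_ge_affine) (use True in auto)
  finally show ?thesis using True by simp
next
  case False
  have "huber B s + 2 * clip B s * d = 2 * clip B s * (s + d) - (clip B s)\<^sup>2"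
    by (simp add: huber_def algebra_simps)
  also have "\<dots> \<le> huber B (s + d)"
    by (rule huber_ge_affine) (use assms in \<open>auto simp: clip_def\<close>)
  finally show ?thesis unfolding if_not_P[OF False] by simp
qed

lemma abs_clip_le: "0 \<le> B \<Longrightarrow> \<bar>clip B s\<bar> \<le> B"
  by (auto simp: clip_def)

lemma huber_nonneg: "0 \<le> B \<Longrightarrow> 0 \<le> huber B s"
  using huber_ge_affine[of 0 B s] by simp

lemma huber_le: assumes "0 \<le> B" shows "huber B s \<le> 2 * B * \<bar>s\<bar>"
proof -
  have "clip B s * s \<le> \<bar>clip B s\<bar> * \<bar>s\<bar>" by (metis abs_ge_self abs_mult)
  also have "\<dots> \<le> B * \<bar>s\<bar>" by (intro mult_right_mono abs_clip_le assms) auto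
  finally have "clip B s * s \<le> B * \<bar>s\<bar>" .
  moreover have "0 \<le> (clip B s)\<^sup>2" by simp
  ultimately show ?thesis unfolding huber_def by linarith
qed

lemma clip_measurable [measurable]: "clip B \<in> borel_measurable borel"
  unfolding clip_def[abs_def] by measurable

lemma huber_measurable [measurable]: "huber B \<in> borel_measurable borel"
  unfolding huber_def[abs_def] by measurable

definition L2 :: "'a measure \<Rightarrow> ('a \<Rightarrow> real) \<Rightarrow> bool" where
  "L2 M f \<longleftrightarrow> f \<in> borel_measurable M \<and> integrable M (\<lambda>x. (f x)\<^sup>2)"

lemma L2_measurable: "L2 M f \<Longrightarrow> f \<in> borel_measurable M"
  by (simp add: L2_def)

lemma L2_mult:
  assumes "L2 M f" "L2 M g"
  shows "integrable M (\<lambda>x. f x * g x)"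
proof (rule Bochner_Integration.integrable_bound)
  show "integrable M (\<lambda>x. (f x)\<^sup>2 + (g x)\<^sup>2)" using assms by (simp add: L2_def)
  show "(\<lambda>x. f x * g x) \<in> borel_measurable M"
    using assms[THEN L2_measurable] by (rule borel_measurable_times)
  have "\<bar>a * b\<bar> \<le> a\<^sup>2 + b\<^sup>2" for a b :: real
    using sum_squares_bound[of "\<bar>a\<bar>" "\<bar>b\<bar>"] by (simp add: abs_mult)
      (metis (no_types) abs_ge_zero abs_mult le_add_same_cancel2 mult_2 mult.assoc order_trans)
  then show "AE x in M. norm (f x * g x) \<le> norm ((f x)\<^sup>2 + (g x)\<^sup>2)" by simp
qed

lemma L2_add:
  assumes "L2 M f" "L2 M g"
  shows "L2 M (\<lambda>x. f x + g x)"
proof -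
  have "integrable M (\<lambda>x. (f x)\<^sup>2 + (g x)\<^sup>2 + 2 * (f x * g x))"
    using assms L2_mult[OF assms] by (auto simp: L2_def)
  then show ?thesis
    using borel_measurable_add[OF assms[THEN L2_measurable]] by (simp add: L2_def power2_sum mult.assoc)
qed

lemma L2_uminus: "L2 M f \<Longrightarrow> L2 M (\<lambda>x. - f x)"
  by (simp add: L2_def)

lemma L2_diff: "L2 M f \<Longrightarrow> L2 M g \<Longrightarrow> L2 M (\<lambda>x. f x - g x)"
  using L2_add[OF _ L2_uminus, of M f g] by simp

context prob_space
begin

lemma L2_bounded:
  assumes "f \<in> borel_measurable M" "\<And>x. \<bar>f x\<bar> \<le> K"
  shows "L2 M f"
proof -
  have "norm ((f x)\<^sup>2) \<le> K\<^sup>2" for x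
    using assms(2)[of x] by (simp add: abs_le_square_iff power2_le_iff_abs_le order_trans[OF abs_ge_zero])
  then have "integrable M (\<lambda>x. (f x)\<^sup>2)"
    using assms(1) by (intro integrable_const_bound[where B = "K\<^sup>2"]) auto
  then show ?thesis using assms(1) by (simp add: L2_def)
qed

lemma L2_integrable: "L2 M f \<Longrightarrow> integrable M f"
  using square_integrable_imp_integrable by (auto simp: L2_def)

lemma L2_sum: "(\<And>j. j \<in> I \<Longrightarrow> L2 M (f j)) \<Longrightarrow> L2 M (\<lambda>x. \<Sum>j\<in>I. f j x)"
  by (induction I rule: infinite_finite_induct) (auto intro: L2_add L2_bounded[where K = 0])

end

text \<open>
  The observable is a function of the first letter, like the return time of a tower. That it takes
  large values with positive probability, whatever the past, is what keeps its sums from concentrating.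
\<close>

locale gibbs_markov_observable = gibbs_markov N S letter C \<beta>
  for N :: "'a measure" and S and letter :: "'a \<Rightarrow> 'i" and C \<beta> :: real +
  fixes H :: "'i \<Rightarrow> real"
  assumes H_nonneg: "\<And>a. 0 \<le> H a"
    and H_square: "integrable N (\<lambda>x. (H (letter x))\<^sup>2)"
    and H_unbounded: "\<And>t. 0 < prob {x \<in> space N. t \<le> H (letter x)}"
begin

definition mean :: real where
  "mean = (\<integral>x. H (letter x) \<partial>N)"

definition fluct :: "nat \<Rightarrow> 'a \<Rightarrow> real" where
  "fluct j x = H (letter ((S ^^ j) x)) - mean"

lemma H_measurable [measurable]: "(\<lambda>x. H (letter x)) \<in> borel_measurable N"
  by (rule measurable_compose[OF letter_measurable]) simp

lemma H_integrable: "integrable N (\<lambda>x. H (letter x))"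
  using H_square by (intro L2_integrable) (simp add: L2_def)

lemma mean_nonneg: "0 \<le> mean"
  unfolding mean_def using H_nonneg by simp

lemma fluct_measurable [measurable]: "fluct j \<in> borel_measurable N"
  unfolding fluct_def[abs_def] by measurable

lemma fluct_L2: "L2 N (fluct j)"
proof -
  have "integrable N (\<lambda>x. (H (letter ((S ^^ j) x)))\<^sup>2)"
    using integral_S_pow(2)[of "\<lambda>x. (H (letter x))\<^sup>2" j] H_square by simp
  then have "L2 N (\<lambda>x. H (letter ((S ^^ j) x)))"
    by (simp add: L2_def)
  then show ?thesis
    unfolding fluct_def[abs_def] by (intro L2_diff L2_bounded[where K = "\<bar>mean\<bar>" and f = "\<lambda>_. mean"]) auto
qed

lemma fluct_integral: "(\<integral>x. fluct j x \<partial>N) = 0"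
proof -
  have "(\<integral>x. fluct j x \<partial>N) = (\<integral>x. H (letter ((S ^^ j) x)) \<partial>N) - mean"
    unfolding fluct_def using integral_S_pow(2)[of "\<lambda>x. H (letter x)" j] H_integrable
    by (subst Bochner_Integration.integral_diff) (auto simp: prob_space)
  also have "\<dots> = 0"
    using integral_S_pow(1)[of "\<lambda>x. H (letter x)" j] by (simp add: mean_def)
  finally show ?thesis .
qed

definition tail_sum :: "nat \<Rightarrow> nat \<Rightarrow> 'a \<Rightarrow> real" where
  "tail_sum k i x = (\<Sum>j=i..<k. fluct j x)"

lemma tail_sum_L2: "L2 N (tail_sum k i)"
  unfolding tail_sum_def[abs_def] by (intro L2_sum fluct_L2)

text \<open>
  The conditional expectation of the fluctuations from \<open>i\<close> to \<open>k\<close>, given the first \<open>i\<close> letters. On null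
  cylinders division by zero makes it \<open>0\<close>; thus it is bounded everywhere and not only almost everywhere.
\<close>

definition correction :: "nat \<Rightarrow> nat \<Rightarrow> 'i list \<Rightarrow> real" where
  "correction k i w = (\<integral>x. indicator (cylinder i w) x * tail_sum k i x \<partial>N) / prob (cylinder i w)"

definition memory :: real where
  "memory = exp distortion_bound * mean / gap"

lemma memory_nonneg: "0 \<le> memory"
  using mean_nonneg gap_pos by (simp add: memory_def)

lemma indicator_times_integrable:
  "integrable N f \<Longrightarrow> B \<in> sets N \<Longrightarrow> integrable N (\<lambda>x. indicator B x * f x :: real)"
  by (rule Bochner_Integration.integrable_bound[of N f]) (auto split: split_indicator)

text \<open>
  By mixing, the conditional mean of the fluctuation at time \<open>j \<ge> i\<close> is at most a multiple of
  \<open>(1 - gap) ^ (j - i)\<close>; the constant \<open>memory\<close> is the sum of the geometric series.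
\<close>

lemma tail_sum_on_cylinder:
  "\<bar>\<integral>x. indicator (cylinder i w) x * tail_sum k i x \<partial>N\<bar> \<le> memory * prob (cylinder i w)"
proof -
  let ?c = "cylinder i w"
  let ?h = "\<lambda>x. H (letter x)"
  have intH: "integrable N (\<lambda>x. ?h ((S ^^ j) x))" for j
    using integral_S_pow(2)[of ?h j] H_integrable by simp
  have term_le: "\<bar>\<integral>x. indicator ?c x * fluct j x \<partial>N\<bar>
      \<le> (1 - gap) ^ (j - i) * (exp distortion_bound * mean * prob ?c)" if "i \<le> j" for j
  proof -
    have "(\<integral>x. indicator ?c x * fluct j x \<partial>N)
        = (\<integral>x. indicator ?c x * ?h ((S ^^ j) x) - mean * indicator ?c x \<partial>N)"
      by (intro Bochner_Integration.integral_cong) (auto simp: fluct_def split: split_indicator)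
    also have "\<dots> = (\<integral>x. indicator ?c x * ?h ((S ^^ j) x) \<partial>N) - (\<integral>x. mean * indicator ?c x \<partial>N)"
      by (intro Bochner_Integration.integral_diff indicator_times_integrable intH)
        (auto intro!: integrable_mult_right integrable_real_indicator simp: emeasure_eq_measure)
    also have "\<dots> = (\<integral>x. indicator ?c x * ?h ((S ^^ (i + (j - i))) x) \<partial>N) - prob ?c * (\<integral>x. ?h x \<partial>N)"
      using that by (simp add: mean_def)
    finally show ?thesis
      using cylinder_integral_mixing[OF H_integrable H_nonneg, of i w "j - i"]
      by (simp add: mean_def ac_simps)
  qed
  have "(\<integral>x. indicator ?c x * tail_sum k i x \<partial>N) = (\<Sum>j=i..<k. \<integral>x. indicator ?c x * fluct j x \<partial>N)"
    unfolding tail_sum_def sum_distrib_left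
    by (intro Bochner_Integration.integral_sum indicator_times_integrable L2_integrable fluct_L2) auto
  also have "\<bar>\<dots>\<bar> \<le> (\<Sum>j=i..<k. \<bar>\<integral>x. indicator ?c x * fluct j x \<partial>N\<bar>)"
    by (rule sum_abs)
  also have "\<dots> \<le> (\<Sum>j=i..<k. (1 - gap) ^ (j - i) * (exp distortion_bound * mean * prob ?c))"
    by (intro sum_mono term_le) auto
  also have "\<dots> = (\<Sum>j=i..<k. (1 - gap) ^ (j - i)) * (exp distortion_bound * mean * prob ?c)"
    by (simp add: sum_distrib_right)
  also have "(\<Sum>j=i..<k. (1 - gap) ^ (j - i)) = (\<Sum>l<k - i. (1 - gap) ^ l)"
    by (rule sum.reindex_bij_witness[of _ "\<lambda>l. l + i" "\<lambda>j. j - i"]) auto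
  also have "\<dots> \<le> 1 / gap"
    using gap_pos gap_less_1 by (simp add: sum_gp_strict divide_right_mono)
  finally show ?thesis
    using mean_nonneg by (simp add: memory_def mult_right_mono)
qed

lemma correction_bound: "\<bar>correction k i w\<bar> \<le> memory"
proof (cases "prob (cylinder i w) = 0")
  case True
  then show ?thesis using memory_nonneg by (simp add: correction_def)
next
  case False
  then have "0 < prob (cylinder i w)" by (simp add: less_le)
  then show ?thesis
    using tail_sum_on_cylinder[of i w k] by (simp add: correction_def abs_divide divide_le_eq)
qed

lemma correction_integral:
  "correction k i w * prob (cylinder i w) = (\<integral>x. indicator (cylinder i w) x * tail_sum k i x \<partial>N)"
proof (cases "prob (cylinder i w) = 0")
  case True
  then show ?thesis using tail_sum_on_cylinder[of i w k] by simp
qed (simp add: correction_def)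

lemma correction_measurable [measurable]: "(\<lambda>x. correction k i (word i x)) \<in> borel_measurable N"
  by (rule word_compose_measurable) simp

lemma correction_L2: "L2 N (\<lambda>x. correction k i (word i x))"
  by (rule L2_bounded[OF correction_measurable]) (rule correction_bound)

lemma residual_zero:
  "(\<integral>x. indicator (cylinder i w) x * (tail_sum k i x - correction k i (word i x)) \<partial>N) = 0"
proof -
  let ?c = "cylinder i w"
  have "(\<integral>x. indicator ?c x * (tail_sum k i x - correction k i (word i x)) \<partial>N)
      = (\<integral>x. indicator ?c x * tail_sum k i x - correction k i w * indicator ?c x \<partial>N)"
    by (intro Bochner_Integration.integral_cong) (auto split: split_indicator)
  also have "\<dots> = (\<integral>x. indicator ?c x * tail_sum k i x \<partial>N) - (\<integral>x. correction k i w * indicator ?c x \<partial>N)"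
    by (intro Bochner_Integration.integral_diff indicator_times_integrable L2_integrable[OF tail_sum_L2])
      (auto intro!: integrable_mult_right integrable_real_indicator simp: emeasure_eq_measure)
  also have "\<dots> = 0" using correction_integral[of k i w] by simp
  finally show ?thesis .
qed

text \<open>
  The tower property of conditional expectations: the residual at time \<open>i + 1\<close> has mean zero on each
  cylinder of length \<open>i + 1\<close>, and a cylinder of length \<open>i\<close> is a disjoint union of these.
\<close>

lemma residual_zero_coarse:
  "(\<integral>x. indicator (cylinder i w) x * (tail_sum k (Suc i) x - correction k (Suc i) (word (Suc i) x)) \<partial>N) = 0"
    (is "(\<integral>x. ?f x \<partial>N) = 0")
proof (rule integral_zero_by_words[where i = "Suc i"])
  show "integrable N ?f"
    by (intro indicator_times_integrable L2_integrable L2_diff tail_sum_L2 correction_L2) auto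
  fix w'
  let ?g = "\<lambda>x. tail_sum k (Suc i) x - correction k (Suc i) (word (Suc i) x)"
  have "(\<integral>x. indicator (cylinder (Suc i) w') x * ?f x \<partial>N)
     = (\<integral>x. of_bool (butlast w' = w) * (indicator (cylinder (Suc i) w') x * ?g x) \<partial>N)"
    by (intro Bochner_Integration.integral_cong) (auto simp: word_Suc split: split_indicator)
  then show "(\<integral>x. indicator (cylinder (Suc i) w') x * ?f x \<partial>N) = 0"
    using residual_zero[of "Suc i" w' k] by simp
qed

text \<open>
  Doob's martingale of the sum of the first \<open>k\<close> fluctuations with respect to the growing past. It
  differs from the partial sum by a bounded correction, vanishes at time \<open>0\<close> and is the full sum at
  time \<open>k\<close>.
\<close>

definition martingale :: "nat \<Rightarrow> nat \<Rightarrow> 'a \<Rightarrow> real" where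
  "martingale k i x = (\<Sum>j<i. fluct j x) + correction k i (word i x)"

definition increment :: "nat \<Rightarrow> nat \<Rightarrow> 'a \<Rightarrow> real" where
  "increment k i x = fluct i x + correction k (Suc i) (word (Suc i) x) - correction k i (word i x)"

lemma martingale_Suc: "martingale k (Suc i) x = martingale k i x + increment k i x"
  by (simp add: martingale_def increment_def)

lemma martingale_L2: "L2 N (martingale k i)"
  unfolding martingale_def[abs_def] by (intro L2_add L2_sum fluct_L2 correction_L2)

lemma increment_L2: "L2 N (increment k i)"
  unfolding increment_def[abs_def] by (intro L2_add L2_diff fluct_L2 correction_L2)

lemma martingale_0: "martingale k 0 x = 0"
proof -
  have "(\<integral>x. indicator (cylinder 0 []) x * tail_sum k 0 x \<partial>N) = (\<integral>x. tail_sum k 0 x \<partial>N)"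
    by (intro Bochner_Integration.integral_cong) auto
  also have "\<dots> = (\<Sum>j=0..<k. \<integral>x. fluct j x \<partial>N)"
    unfolding tail_sum_def by (intro Bochner_Integration.integral_sum L2_integrable fluct_L2)
  finally show ?thesis by (simp add: martingale_def correction_def fluct_integral)
qed

lemma martingale_end: "martingale k k x = (\<Sum>j<k. fluct j x)"
  by (simp add: martingale_def correction_def tail_sum_def)

lemma martingale_word: "\<exists>m. \<forall>x. martingale k i x = m (word i x)"
proof -
  have "martingale k i x = (\<lambda>w. (\<Sum>j<i. H (w ! j) - mean) + correction k i w) (word i x)" for x
    by (simp add: martingale_def fluct_def nth_word)
  then show ?thesis by (intro exI allI)
qed

lemma increment_cylinder:
  assumes "i < k"
  shows "(\<integral>x. indicator (cylinder i w) x * increment k i x \<partial>N) = 0"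
proof -
  let ?c = "cylinder i w"
  let ?f = "\<lambda>i x. indicator ?c x * (tail_sum k i x - correction k i (word i x))"
  have int: "integrable N (?f i)" for i
    by (intro indicator_times_integrable L2_integrable L2_diff tail_sum_L2 correction_L2) auto
  have "tail_sum k i x = fluct i x + tail_sum k (Suc i) x" for x
    using assms by (simp add: tail_sum_def sum.atLeast_Suc_lessThan)
  then have "(\<integral>x. indicator ?c x * increment k i x \<partial>N) = (\<integral>x. ?f i x - ?f (Suc i) x \<partial>N)"
    by (intro Bochner_Integration.integral_cong) (auto simp: increment_def split: split_indicator)
  also have "\<dots> = (\<integral>x. ?f i x \<partial>N) - (\<integral>x. ?f (Suc i) x \<partial>N)"
    by (intro Bochner_Integration.integral_diff int)
  finally show ?thesis using residual_zero[of i w k] residual_zero_coarse[of i w k] by simp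
qed

lemma increment_orthogonal:
  assumes "i < k" and int: "integrable N (\<lambda>x. g (word i x) * increment k i x)"
  shows "(\<integral>x. g (word i x) * increment k i x \<partial>N) = 0"
proof (rule integral_zero_by_words[where i = i, OF int])
  fix w
  have "(\<integral>x. indicator (cylinder i w) x * (g (word i x) * increment k i x) \<partial>N)
     = (\<integral>x. g w * (indicator (cylinder i w) x * increment k i x) \<partial>N)"
    by (intro Bochner_Integration.integral_cong) (auto split: split_indicator)
  then show "(\<integral>x. indicator (cylinder i w) x * (g (word i x) * increment k i x) \<partial>N) = 0"
    using increment_cylinder[OF assms(1)] by simp
qed

definition spread :: real where
  "spread = 2 * (\<integral>x. (fluct 0 x)\<^sup>2 \<partial>N) + 8 * memory\<^sup>2 + 1"

lemma spread_pos: "0 < spread"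
proof -
  have "0 \<le> (\<integral>x. (fluct 0 x)\<^sup>2 \<partial>N)" by simp
  then show ?thesis by (simp add: spread_def add_nonneg_pos)
qed

lemma increment_second_moment: "(\<integral>x. (increment k i x)\<^sup>2 \<partial>N) \<le> spread"
proof -
  have "(increment k i x)\<^sup>2 \<le> 2 * (fluct i x)\<^sup>2 + 8 * memory\<^sup>2" for x
  proof -
    let ?d = "correction k (Suc i) (word (Suc i) x) - correction k i (word i x)"
    have "\<bar>?d\<bar> \<le> 2 * memory"
      using correction_bound[of k i "word i x"] correction_bound[of k "Suc i" "word (Suc i) x"] by linarith
    then have "?d\<^sup>2 \<le> (2 * memory)\<^sup>2" using power_mono[of "\<bar>?d\<bar>" "2 * memory" 2] by simp
    moreover have "(fluct i x + ?d)\<^sup>2 \<le> 2 * (fluct i x)\<^sup>2 + 2 * ?d\<^sup>2"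
      using sum_squares_bound[of "fluct i x" ?d] by (simp add: power2_sum)
    ultimately show ?thesis by (simp add: increment_def power_mult_distrib add_diff_eq)
  qed
  then have "(\<integral>x. (increment k i x)\<^sup>2 \<partial>N) \<le> (\<integral>x. 2 * (fluct i x)\<^sup>2 + 8 * memory\<^sup>2 \<partial>N)"
    using increment_L2[of k i] fluct_L2[of i] by (intro integral_mono) (auto simp: L2_def)
  also have "\<dots> = 2 * (\<integral>x. (fluct i x)\<^sup>2 \<partial>N) + 8 * memory\<^sup>2"
    using fluct_L2[of i] by (simp add: L2_def prob_space)
  also have "(\<integral>x. (fluct i x)\<^sup>2 \<partial>N) = (\<integral>x. (fluct 0 x)\<^sup>2 \<partial>N)"
    using integral_S_pow(1)[of "\<lambda>x. (fluct 0 x)\<^sup>2" i] by (simp add: fluct_def)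
  finally show ?thesis by (simp add: spread_def)
qed

text \<open>
  Increments are orthogonal to functions of the past, so that second moments add up.
\<close>

lemma martingale_second_moment:
  assumes "i \<le> k"
  shows "(\<integral>x. (martingale k i x)\<^sup>2 \<partial>N) \<le> i * spread"
  using assms
proof (induction i)
  case 0
  then show ?case by (simp add: martingale_0)
next
  case (Suc i)
  obtain m where m: "\<And>x. martingale k i x = m (word i x)" using martingale_word by blast
  have int: "integrable N (\<lambda>x. martingale k i x * increment k i x)"
    by (rule L2_mult[OF martingale_L2 increment_L2])
  then have orth: "(\<integral>x. martingale k i x * increment k i x \<partial>N) = 0"
    using increment_orthogonal[of i k m] Suc.prems by (simp add: m)
  have "(\<integral>x. (martingale k (Suc i) x)\<^sup>2 \<partial>N)
      = (\<integral>x. (martingale k i x)\<^sup>2 + (increment k i x)\<^sup>2 + 2 * (martingale k i x * increment k i x) \<partial>N)"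
    by (simp add: martingale_Suc power2_sum mult.assoc)
  also have "\<dots> = (\<integral>x. (martingale k i x)\<^sup>2 \<partial>N) + (\<integral>x. (increment k i x)\<^sup>2 \<partial>N)"
    using int martingale_L2[of k i] increment_L2[of k i] by (simp add: L2_def orth)
  also have "\<dots> \<le> i * spread + spread"
    using Suc increment_second_moment[of k i] by auto
  finally show ?case by (simp add: algebra_simps)
qed

text \<open>
  The linear term of \<open>huber_increment\<close> integrates to zero. Whenever the next letter has a value above
  \<open>mean + 2 memory + 1\<close>, the increment is at least \<open>1\<close>, whatever the corrections are; given the past,
  this has a probability bounded below. Hence the expectation of the Huber function grows linearly in
  time as long as the martingale typically stays below \<open>B\<close>.
\<close>

lemma huber_growth:
  assumes "i < k" "0 \<le> B"
  shows "(\<integral>x. huber B (martingale k i x) \<partial>N)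
     + exp (- distortion_bound) * prob {x \<in> space N. mean + 2 * memory + 1 \<le> H (letter x)}
        * prob {x \<in> space N. \<bar>martingale k i x\<bar> + 1 \<le> B}
     \<le> (\<integral>x. huber B (martingale k (Suc i) x) \<partial>N)"
proof -
  let ?E = "{x \<in> space N. mean + 2 * memory + 1 \<le> H (letter x)}"
  obtain m where m: "\<And>x. martingale k i x = m (word i x)" using martingale_word by blast
  let ?F = "{x \<in> space N. \<bar>m (word i x)\<bar> + 1 \<le> B \<and> (S ^^ i) x \<in> ?E}"
  have E [measurable]: "?E \<in> sets N" by measurable
  have F: "?F \<in> sets N" by (rule past_future_sets[OF E])
  have hub: "integrable N (\<lambda>x. huber B (martingale k i x))" for i
  proof (rule Bochner_Integration.integrable_bound)
    show "integrable N (\<lambda>x. 2 * B * \<bar>martingale k i x\<bar>)"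
      using L2_integrable[OF martingale_L2] by auto
    show "AE x in N. norm (huber B (martingale k i x)) \<le> norm (2 * B * \<bar>martingale k i x\<bar>)"
      using huber_le[OF assms(2)] huber_nonneg[OF assms(2)] assms(2) by (auto simp: abs_mult)
    show "(\<lambda>x. huber B (martingale k i x)) \<in> borel_measurable N"
      by (rule measurable_compose[OF L2_measurable[OF martingale_L2]]) simp
  qed
  have clp: "integrable N (\<lambda>x. clip B (martingale k i x) * increment k i x)"
  proof (rule L2_mult[OF _ increment_L2], rule L2_bounded)
    show "(\<lambda>x. clip B (martingale k i x)) \<in> borel_measurable N"
      by (rule measurable_compose[OF L2_measurable[OF martingale_L2]]) simp
  qed (rule abs_clip_le[OF assms(2)])
  then have orth: "(\<integral>x. clip B (martingale k i x) * increment k i x \<partial>N) = 0"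
    using increment_orthogonal[of i k "\<lambda>w. clip B (m w)"] assms(1) by (simp add: m)
  have ind: "integrable N (indicator ?F :: 'a \<Rightarrow> real)"
    using F by (auto intro!: integrable_real_indicator simp: emeasure_eq_measure)
  have pt: "huber B (martingale k i x) + 2 * (clip B (martingale k i x) * increment k i x) + indicator ?F x
      \<le> huber B (martingale k (Suc i) x)" for x
  proof -
    have "1 \<le> increment k i x" if "x \<in> ?F"
    proof -
      have "mean + 2 * memory + 1 \<le> H (letter ((S ^^ i) x))" using that by simp
      then show ?thesis
        using correction_bound[of k i "word i x"] correction_bound[of k "Suc i" "word (Suc i) x"]
        by (simp add: increment_def fluct_def)
    qed
    then have "indicator ?F x \<le> (if \<bar>martingale k i x\<bar> + 1 \<le> B \<and> 1 \<le> increment k i x then 1 else 0 :: real)"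
      by (auto simp: m split: split_indicator)
    then show ?thesis
      using huber_increment[OF assms(2), of "martingale k i x" "increment k i x"]
      unfolding martingale_Suc by linarith
  qed
  have "(\<integral>x. huber B (martingale k i x) \<partial>N) + prob ?F
      = (\<integral>x. huber B (martingale k i x) + 2 * (clip B (martingale k i x) * increment k i x) + indicator ?F x \<partial>N)"
    using hub clp ind F by (simp add: orth)
  also have "\<dots> \<le> (\<integral>x. huber B (martingale k (Suc i) x) \<partial>N)"
    using hub clp ind by (intro integral_mono pt) auto
  finally have 1: "(\<integral>x. huber B (martingale k i x) \<partial>N) + prob ?F \<le> (\<integral>x. huber B (martingale k (Suc i) x) \<partial>N)" .
  have "prob {x \<in> space N. \<bar>m (word i x)\<bar> + 1 \<le> B} * prob ?E \<le> exp distortion_bound * prob ?F"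
    by (rule past_future(1)[OF E])
  then have "exp (- distortion_bound) * prob ?E * prob {x \<in> space N. \<bar>martingale k i x\<bar> + 1 \<le> B} \<le> prob ?F"
    by (simp add: m exp_minus field_simps)
  with 1 show ?thesis by linarith
qed

text \<open>
  Chebyshev's inequality; the factor \<open>2\<close> under the root makes the exceptional probability \<open>1 / 2\<close>.
\<close>

lemma martingale_typical:
  assumes "i \<le> k" "0 < k"
  shows "1 / 2 \<le> prob {x \<in> space N. \<bar>martingale k i x\<bar> + 1 \<le> 1 + sqrt (2 * spread * k)}"
proof -
  let ?a = "sqrt (2 * spread * k)"
  note [measurable] = L2_measurable[OF martingale_L2[of k i]]
  have a: "0 < ?a" using spread_pos assms by simp
  have "prob {x \<in> space N. (?a)\<^sup>2 \<le> (martingale k i x)\<^sup>2} \<le> (\<integral>x. (martingale k i x)\<^sup>2 \<partial>N) / (?a)\<^sup>2"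
    using a martingale_L2[of k i]
    by (intro integral_Markov_inequality_measure[where A = "{}"]) (auto simp: L2_def)
  also have "\<dots> \<le> (k * spread) / (?a)\<^sup>2"
  proof (rule divide_right_mono)
    show "(\<integral>x. (martingale k i x)\<^sup>2 \<partial>N) \<le> k * spread"
      using martingale_second_moment[OF assms(1)] assms(1) spread_pos
      by (meson less_imp_le mult_right_mono of_nat_mono order_trans)
  qed simp
  also have "\<dots> = 1 / 2" using spread_pos assms by simp
  finally have le: "prob {x \<in> space N. (?a)\<^sup>2 \<le> (martingale k i x)\<^sup>2} \<le> 1 / 2" .
  have "1 = prob (space N)" by (simp add: prob_space)
  also have "\<dots> \<le> prob ({x \<in> space N. \<bar>martingale k i x\<bar> + 1 \<le> 1 + ?a} \<union> {x \<in> space N. (?a)\<^sup>2 \<le> (martingale k i x)\<^sup>2})"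
  proof (rule finite_measure_mono)
    have "\<bar>m\<bar> + 1 \<le> 1 + ?a \<or> (?a)\<^sup>2 \<le> m\<^sup>2" for m
      using a abs_le_square_iff[of ?a m] by linarith
    then show "space N \<subseteq> {x \<in> space N. \<bar>martingale k i x\<bar> + 1 \<le> 1 + ?a}
        \<union> {x \<in> space N. (?a)\<^sup>2 \<le> (martingale k i x)\<^sup>2}" by blast
  qed measurable
  also have "\<dots> \<le> prob {x \<in> space N. \<bar>martingale k i x\<bar> + 1 \<le> 1 + ?a} + prob {x \<in> space N. (?a)\<^sup>2 \<le> (martingale k i x)\<^sup>2}"
    by (rule measure_Un_le) measurable
  finally show ?thesis using le by linarith
qed

definition rate :: real where
  "rate = exp (- distortion_bound) * prob {x \<in> space N. mean + 2 * memory + 1 \<le> H (letter x)}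
     / (4 * (1 + sqrt (2 * spread)))"

lemma rate_pos: "0 < rate"
  using H_unbounded spread_pos by (auto simp: rate_def intro!: divide_pos_pos mult_pos_pos add_pos_nonneg)

text \<open>
  With \<open>B\<close> of order \<open>sqrt k\<close>, the Huber function has an expectation of order \<open>k\<close> at time \<open>k\<close>, and it is at
  most \<open>2 B\<close> times the absolute value. This replaces a central limit theorem, and the unboundedness of
  \<open>H\<close> takes the place of a nondegeneracy condition on the variance.
\<close>

lemma first_absolute_moment:
  assumes "0 < k"
  shows "rate * sqrt k \<le> (\<integral>x. \<bar>\<Sum>j<k. fluct j x\<bar> \<partial>N)"
proof -
  let ?B = "1 + sqrt (2 * spread * k)"
  let ?v = "exp (- distortion_bound) * prob {x \<in> space N. mean + 2 * memory + 1 \<le> H (letter x)}"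
  let ?A = "\<integral>x. \<bar>\<Sum>j<k. fluct j x\<bar> \<partial>N"
  have v: "0 \<le> ?v" by simp
  have B: "0 \<le> ?B" using spread_pos by simp
  have "i * (?v / 2) \<le> (\<integral>x. huber ?B (martingale k i x) \<partial>N)" if "i \<le> k" for i
    using that
  proof (induction i)
    case 0
    then show ?case using huber_nonneg[OF B] by simp
  next
    case (Suc i)
    have "?v * (1 / 2) \<le> ?v * prob {x \<in> space N. \<bar>martingale k i x\<bar> + 1 \<le> ?B}"
      using Suc.prems assms by (intro mult_left_mono martingale_typical v) auto
    moreover have "(\<integral>x. huber ?B (martingale k i x) \<partial>N)
        + ?v * prob {x \<in> space N. \<bar>martingale k i x\<bar> + 1 \<le> ?B}
        \<le> (\<integral>x. huber ?B (martingale k (Suc i) x) \<partial>N)"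
      using Suc.prems by (intro huber_growth B) auto
    moreover have "i * (?v / 2) \<le> (\<integral>x. huber ?B (martingale k i x) \<partial>N)"
      using Suc by simp
    moreover have "Suc i * (?v / 2) = i * (?v / 2) + ?v * (1 / 2)"
      by (simp add: algebra_simps)
    ultimately show ?case by linarith
  qed
  from this[of k] have "k * (?v / 2) \<le> (\<integral>x. huber ?B (\<Sum>j<k. fluct j x) \<partial>N)"
    by (simp add: martingale_end)
  also have "\<dots> \<le> (\<integral>x. 2 * ?B * \<bar>\<Sum>j<k. fluct j x\<bar> \<partial>N)"
  proof (rule integral_mono')
    show "integrable N (\<lambda>x. 2 * ?B * \<bar>\<Sum>j<k. fluct j x\<bar>)"
      by (intro integrable_mult_right integrable_abs L2_integrable L2_sum fluct_L2)
    show "0 \<le> 2 * ?B * \<bar>\<Sum>j<k. fluct j x\<bar>" for x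
      using B by (intro mult_nonneg_nonneg) auto
  qed (rule huber_le[OF B])
  also have "\<dots> = 2 * ?B * ?A" by simp
  finally have 1: "k * (?v / 2) \<le> 2 * ?B * ?A" .
  have sk: "1 \<le> sqrt k" using assms by simp
  have "?B \<le> (1 + sqrt (2 * spread)) * sqrt k"
    using sk by (simp add: real_sqrt_mult algebra_simps)
  then have "2 * ?B * ?A \<le> 2 * ((1 + sqrt (2 * spread)) * sqrt k) * ?A"
    by (intro mult_right_mono mult_left_mono) auto
  moreover have "sqrt k * (sqrt k * (?v / 2)) = k * (?v / 2)"
    by (simp only: mult.assoc[symmetric] real_sqrt_mult_self abs_of_nat)
  moreover have "2 * ((1 + sqrt (2 * spread)) * sqrt k) * ?A = sqrt k * (2 * (1 + sqrt (2 * spread)) * ?A)"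
    by (simp only: ac_simps)
  ultimately have "sqrt k * (sqrt k * (?v / 2)) \<le> sqrt k * (2 * (1 + sqrt (2 * spread)) * ?A)"
    using 1 by linarith
  then have 2: "sqrt k * (?v / 2) \<le> 2 * (1 + sqrt (2 * spread)) * ?A"
    using sk by (subst (asm) mult_le_cancel_left_pos) auto
  have pos: "0 < 4 * (1 + sqrt (2 * spread))" using spread_pos by (simp add: add_pos_nonneg)
  have "rate * sqrt k = ?v * sqrt k / (4 * (1 + sqrt (2 * spread)))"
    by (simp add: rate_def)
  also have "\<dots> \<le> ?A"
    using 2 pos by (subst pos_divide_le_eq) (auto simp: field_simps)
  finally show ?thesis .
qed

text \<open>
  For a centered \<open>S\<close> one has \<open>E \<bar>S\<bar> = 2 E (max S 0)\<close>, and \<open>2 max S 0 \<le> S\<^sup>2 / t + t\<close> where \<open>S \<ge> 0\<close>. If \<open>t\<close> is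
  a large multiple of \<open>sqrt k\<close>, the first summand takes at most half of the lower bound for \<open>E \<bar>S\<bar>\<close>, so
  the event \<open>S \<ge> 0\<close> has to account for the other half.
\<close>

lemma sum_nonneg_probability:
  shows "\<exists>\<delta>>0. \<forall>k. \<delta> \<le> prob {x \<in> space N. 0 \<le> (\<Sum>j<k. fluct j x)}"
proof -
  let ?d = "rate\<^sup>2 / (4 * spread)"
  have d: "0 < ?d" using rate_pos spread_pos by simp
  have "?d \<le> prob {x \<in> space N. 0 \<le> (\<Sum>j<k. fluct j x)}" if k: "0 < k" for k
  proof -
    let ?S = "\<lambda>x. \<Sum>j<k. fluct j x"
    let ?P = "{x \<in> space N. 0 \<le> ?S x}"
    let ?t = "2 * spread / rate * sqrt k"
    have t: "0 < ?t" using spread_pos rate_pos k by simp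
    have L: "L2 N ?S" by (intro L2_sum fluct_L2)
    note [measurable] = L2_measurable[OF L]
    have P: "?P \<in> sets N" by measurable
    have pt: "\<bar>?S x\<bar> \<le> (?S x)\<^sup>2 / ?t + ?t * indicator ?P x - ?S x" if "x \<in> space N" for x
    proof (cases "0 \<le> ?S x")
      case True
      have "2 * ?S x * ?t \<le> (?S x)\<^sup>2 + ?t * ?t"
        using sum_squares_bound[of "?S x" ?t] by (simp add: power2_eq_square)
      then have "2 * ?S x \<le> ((?S x)\<^sup>2 + ?t * ?t) / ?t"
        using t by (subst pos_le_divide_eq) auto
      also have "\<dots> = (?S x)\<^sup>2 / ?t + ?t" using t by (simp only: add_divide_distrib) simp
      finally show ?thesis using True that by simp
    next
      case False
      then have "\<bar>?S x\<bar> = - ?S x" "indicator ?P x = (0 :: real)" by auto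
      moreover have "0 \<le> (?S x)\<^sup>2 / ?t" using t by (intro divide_nonneg_pos) auto
      ultimately show ?thesis by (simp only: mult_zero_right)
    qed
    have mean0: "(\<integral>x. ?S x \<partial>N) = 0"
      by (subst Bochner_Integration.integral_sum)
        (auto intro: L2_integrable fluct_L2 simp: fluct_integral)
    have sq: "(\<integral>x. (?S x)\<^sup>2 \<partial>N) \<le> k * spread"
      using martingale_second_moment[of k k] by (simp add: martingale_end)
    have i1: "integrable N ?S" by (rule L2_integrable[OF L])
    have i2: "integrable N (\<lambda>x. (?S x)\<^sup>2)" using L by (simp add: L2_def)
    have i3: "integrable N (indicator ?P :: 'a \<Rightarrow> real)"
      using P by (auto intro!: integrable_real_indicator simp: emeasure_eq_measure)
    have "rate * sqrt k \<le> (\<integral>x. \<bar>?S x\<bar> \<partial>N)" by (rule first_absolute_moment[OF k])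
    also have "\<dots> \<le> (\<integral>x. (?S x)\<^sup>2 / ?t + ?t * indicator ?P x - ?S x \<partial>N)"
      using i1 i2 i3 pt by (intro integral_mono) auto
    also have "\<dots> = (\<integral>x. (?S x)\<^sup>2 \<partial>N) / ?t + ?t * prob ?P"
      using i1 i2 i3 P by (simp add: mean0 Int_absorb2 sets.sets_into_space)
    also have "\<dots> \<le> (k * spread) / ?t + ?t * prob ?P"
      using sq t by (intro add_right_mono divide_right_mono) auto
    also have "(k * spread) / ?t = rate / 2 * sqrt k"
    proof -
      have "real k = sqrt k * sqrt k" by simp
      then show ?thesis using spread_pos rate_pos k
        by (simp add: field_simps)
    qed
    finally have "rate * sqrt k \<le> rate / 2 * sqrt k + ?t * prob ?P" .
    moreover have "?t * prob ?P = (2 * spread / rate * prob ?P) * sqrt k" by simp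
    moreover have "rate * sqrt k = rate / 2 * sqrt k + rate / 2 * sqrt k"
      by (simp only: distrib_right[symmetric] field_sum_of_halves)
    ultimately have "rate / 2 * sqrt k \<le> (2 * spread / rate * prob ?P) * sqrt k"
      by (simp only: add_le_cancel_left)
    then have "rate / 2 \<le> 2 * spread / rate * prob ?P"
      using k by (subst (asm) mult_le_cancel_right_pos) auto
    then have "rate / (4 * spread) * (rate / 2 * 2) \<le> rate / (4 * spread) * (2 * spread / rate * prob ?P * 2)"
      using rate_pos spread_pos by (intro mult_left_mono mult_right_mono) auto
    also have "\<dots> = prob ?P" using rate_pos spread_pos by simp
    finally show ?thesis by (simp add: power2_eq_square)
  qed
  then have "min 1 ?d \<le> prob {x \<in> space N. 0 \<le> (\<Sum>j<k. fluct j x)}" for k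
    by (cases "k = 0") (auto simp: prob_space min_le_iff_disj)
  then show ?thesis using d by (intro exI[of _ "min 1 ?d"]) auto
qed

end

section \<open>The big jump\<close>

text \<open>
  Each new event overlaps the union of the \<open>j\<close> earlier ones by at most \<open>j c\<close>.
\<close>

lemma (in prob_space) bonferroni_lower:
  assumes F: "\<And>j. j < m \<Longrightarrow> F j \<in> events" and single: "\<And>j. j < m \<Longrightarrow> a \<le> prob (F j)"
    and pair: "\<And>i j. i < j \<Longrightarrow> j < m \<Longrightarrow> prob (F i \<inter> F j) \<le> c" and c: "0 \<le> c"
  shows "real m * a - real m * real m * c \<le> prob (\<Union>j<m. F j)"
  using F single pair
proof (induction m)
  case 0
  then show ?case by simp
next
  case (Suc m)
  let ?U = "\<Union>j<m. F j"
  have U: "?U \<in> events" using Suc.prems(1) by (intro sets.finite_UN) auto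
  have "prob (?U \<inter> F m) = prob (\<Union>i<m. F i \<inter> F m)"
    by (rule arg_cong[of _ _ prob]) auto
  also have "\<dots> \<le> (\<Sum>i<m. prob (F i \<inter> F m))"
    using Suc.prems(1) by (intro measure_UNION_le) auto
  also have "\<dots> \<le> (\<Sum>i<m. c)"
    using Suc.prems(3) by (intro sum_mono) auto
  finally have ov: "prob (?U \<inter> F m) \<le> m * c" by simp
  have "prob (\<Union>j<Suc m. F j) = prob (?U \<union> F m)"
    by (rule arg_cong[of _ _ prob]) (auto simp: less_Suc_eq)
  also have "\<dots> = prob ?U + prob (F m) - prob (?U \<inter> F m)"
    using U Suc.prems(1)[of m] by (simp add: measure_Un3 fmeasurable_eq_sets)
  finally have "prob ?U + a - m * c \<le> prob (\<Union>j<Suc m. F j)"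
    using ov Suc.prems(2)[of m] by simp
  moreover have "m * a - m * m * c \<le> prob ?U"
    using Suc by simp
  moreover have "0 \<le> m * c" using c by simp
  moreover have "real (Suc m) * a = m * a + a" "real (Suc m) * real (Suc m) * c = m * m * c + m * c + m * c + c"
    by (simp_all add: algebra_simps)
  ultimately show ?case using c by linarith
qed

context gibbs_markov_observable
begin

lemma fluct_shift: "fluct l ((S ^^ i) x) = fluct (l + i) x"
  by (simp add: fluct_def funpow_add)

text \<open>
  The event \<open>F j\<close> says that the fluctuations before time \<open>j\<close> have a nonnegative sum, that the letter at
  time \<open>j\<close> is a jump, and that the fluctuations after \<open>j\<close> have a nonnegative sum. Two applications of
  \<open>past_future\<close> bound its probability from below, and one bounds the probability of two jumps
  from above.
\<close>

lemma big_jump: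
  assumes \<delta>: "0 \<le> \<delta>" "\<And>k. \<delta> \<le> prob {x \<in> space N. 0 \<le> (\<Sum>j<k. fluct j x)}"
    and jump: "\<And>a. G a \<Longrightarrow> mean + y \<le> H a"
    and q: "q = prob {x \<in> space N. G (letter x)}"
  shows "real k * q * (exp (- 2 * distortion_bound) * \<delta>\<^sup>2 - exp distortion_bound * (real k * q))
     \<le> prob {x \<in> space N. y \<le> (\<Sum>j<k. fluct j x)}"
proof -
  let ?D = "distortion_bound"
  let ?pos = "\<lambda>k. {x \<in> space N. 0 \<le> (\<Sum>j<k. fluct j x)}"
  define jump_then where "jump_then E = {x \<in> space N. G (letter x) \<and> S x \<in> E}" for E
  have pos_sets: "?pos k \<in> sets N" for k by measurable
  have Gw: "{x \<in> space N. G (hd (word 1 x))} = {x \<in> space N. G (letter x)}"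
    by (simp add: word_def)
  have jt: "jump_then E = {x \<in> space N. G (hd (word 1 x)) \<and> (S ^^ 1) x \<in> E}" for E
    by (simp add: jump_then_def word_def)
  have jt_sets: "jump_then E \<in> sets N" if "E \<in> sets N" for E
    unfolding jt by (rule past_future_sets[OF that])
  have q0: "0 \<le> q" by (simp add: q)
  \<comment> \<open>The sum over the past is written in terms of the word, so that it is visibly a function of the first j letters.\<close>
  define F where "F j = {x \<in> space N. 0 \<le> (\<Sum>l<j. H (word j x ! l) - mean) \<and>
      (S ^^ j) x \<in> jump_then (?pos (k - Suc j))}" for j
  have F_sets: "F j \<in> sets N" for j
    unfolding F_def by (intro past_future_sets jt_sets pos_sets)
  have F_lower: "exp (- 2 * ?D) * \<delta>\<^sup>2 * q \<le> prob (F j)" for j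
  proof -
    let ?E = "?pos (k - Suc j)"
    have "q * \<delta> \<le> q * prob ?E" by (intro mult_left_mono \<delta>(2) q0)
    also have "\<dots> \<le> exp ?D * prob (jump_then ?E)"
      using past_future(1)[OF pos_sets, of "\<lambda>w. G (hd w)" 1] unfolding Gw jt q .
    finally have 1: "q * \<delta> \<le> exp ?D * prob (jump_then ?E)" .
    have "{x \<in> space N. 0 \<le> (\<Sum>l<j. H (word j x ! l) - mean)} = ?pos j"
      by (auto simp: nth_word fluct_def)
    then have "\<delta> * prob (jump_then ?E) \<le>
        prob {x \<in> space N. 0 \<le> (\<Sum>l<j. H (word j x ! l) - mean)} * prob (jump_then ?E)"
      using \<delta>(2) by (intro mult_right_mono) auto
    also have "\<dots> \<le> exp ?D * prob (F j)"
      unfolding F_def by (rule past_future(1)[OF jt_sets[OF pos_sets]])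
    finally have 2: "\<delta> * prob (jump_then ?E) \<le> exp ?D * prob (F j)" .
    have "\<delta> * (q * \<delta>) \<le> \<delta> * (exp ?D * prob (jump_then ?E))"
      by (intro mult_left_mono 1 \<delta>(1))
    also have "\<dots> = exp ?D * (\<delta> * prob (jump_then ?E))" by simp
    also have "\<dots> \<le> exp ?D * (exp ?D * prob (F j))"
      by (intro mult_left_mono 2) auto
    also have "\<dots> = exp (2 * ?D) * prob (F j)"
      by (simp only: mult.assoc[symmetric] exp_add[symmetric] mult_2)
    finally have "exp (- 2 * ?D) * (\<delta> * (q * \<delta>)) \<le> exp (- 2 * ?D) * (exp (2 * ?D) * prob (F j))"
      by (intro mult_left_mono) auto
    also have "\<dots> = prob (F j)"
      by (simp only: mult.assoc[symmetric] exp_add[symmetric]) simp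
    also have "exp (- 2 * ?D) * (\<delta> * (q * \<delta>)) = exp (- 2 * ?D) * \<delta>\<^sup>2 * q"
      by (simp only: power2_eq_square ac_simps)
    finally show ?thesis .
  qed
  have F_pair: "prob (F i \<inter> F j) \<le> exp ?D * q\<^sup>2" if "i < j" for i j
  proof -
    let ?J = "{x \<in> space N. G (letter x)}"
    let ?E = "{x \<in> space N. (S ^^ (j - Suc i)) x \<in> ?J}"
    have J: "?J \<in> sets N" unfolding Gw[symmetric] by (rule past_sets)
    have E: "?E \<in> sets N" by (rule S_pow_preimage_sets[OF J])
    have "F i \<inter> F j \<subseteq> {x \<in> space N. (S ^^ i) x \<in> jump_then ?E}"
    proof
      fix x assume x: "x \<in> F i \<inter> F j"
      have "(S ^^ (j - Suc i)) (S ((S ^^ i) x)) = (S ^^ (j - Suc i + Suc i)) x"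
        by (simp only: funpow_add funpow.simps comp_def)
      also have "j - Suc i + Suc i = j" using that by simp
      finally show "x \<in> {x \<in> space N. (S ^^ i) x \<in> jump_then ?E}"
        using x measurable_space[OF S_pow_measurable, of x] measurable_space[OF S_measurable]
        by (auto simp: F_def jump_then_def)
    qed
    then have "prob (F i \<inter> F j) \<le> prob {x \<in> space N. (S ^^ i) x \<in> jump_then ?E}"
      by (intro finite_measure_mono S_pow_preimage_sets jt_sets E)
    also have "\<dots> = prob (jump_then ?E)"
      by (rule prob_S_pow_preimage[OF jt_sets[OF E]])
    also have "\<dots> \<le> exp ?D * (q * prob ?E)"
      using past_future(2)[OF E, of "\<lambda>w. G (hd w)" 1] unfolding Gw jt q .
    also have "prob ?E = q" unfolding q by (rule prob_S_pow_preimage[OF J])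
    finally show ?thesis by (simp add: power2_eq_square)
  qed
  have "real k * (exp (- 2 * ?D) * \<delta>\<^sup>2 * q) - real k * real k * (exp ?D * q\<^sup>2) \<le> prob (\<Union>j<k. F j)"
    by (rule bonferroni_lower) (use F_sets F_lower F_pair in auto)
  also have "\<dots> \<le> prob {x \<in> space N. y \<le> (\<Sum>j<k. fluct j x)}"
  proof (rule finite_measure_mono)
    show "(\<Union>j<k. F j) \<subseteq> {x \<in> space N. y \<le> (\<Sum>j<k. fluct j x)}"
    proof
      fix x assume "x \<in> (\<Union>j<k. F j)"
      then obtain j where j: "j < k" and x: "x \<in> F j" by blast
      have past: "0 \<le> (\<Sum>l<j. fluct l x)"
        using x by (simp add: F_def nth_word fluct_def)
      have now: "y \<le> fluct j x"
        using x jump[of "letter ((S ^^ j) x)"] by (simp add: F_def jump_then_def fluct_def)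
      have "0 \<le> (\<Sum>l<k - Suc j. fluct l ((S ^^ Suc j) x))"
        using x by (simp add: F_def jump_then_def)
      also have "\<dots> = (\<Sum>l=Suc j..<k. fluct l x)"
        unfolding fluct_shift
        by (rule sum.reindex_bij_witness[of _ "\<lambda>l. l - Suc j" "\<lambda>l. l + Suc j"]) (use j in auto)
      finally have fut: "0 \<le> (\<Sum>l=Suc j..<k. fluct l x)" .
      have "(\<Sum>l<k. fluct l x) = (\<Sum>l<j. fluct l x) + (\<Sum>l=j..<k. fluct l x)"
        using j by (metis atLeast0LessThan le0 less_imp_le sum.atLeastLessThan_concat)
      also have "(\<Sum>l=j..<k. fluct l x) = fluct j x + (\<Sum>l=Suc j..<k. fluct l x)"
        using j by (rule sum.atLeast_Suc_lessThan)
      finally show "x \<in> {x \<in> space N. y \<le> (\<Sum>j<k. fluct j x)}"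
        using x past now fut by (auto simp: F_def)
    qed
  qed measurable
  finally show ?thesis by (simp add: algebra_simps power2_eq_square)
qed

text \<open>
  When the jumps have probability of order \<open>y powr - p\<close>, the expected number of jumps is of order
  \<open>k / y powr p\<close>. The constant \<open>K\<close> makes it so small that the overlap in \<open>big_jump\<close> takes at most
  half of the main term.
\<close>

theorem power_tail_deviation:
  assumes p: "0 < p" and c: "0 < c1" "0 < c2" and y0: "1 \<le> y0"
    and G: "\<And>y a. y0 \<le> y \<Longrightarrow> G y a \<Longrightarrow> mean + y \<le> H a"
    and low: "\<And>y. y0 \<le> y \<Longrightarrow> c1 / y powr p \<le> prob {x \<in> space N. G y (letter x)}"
    and up: "\<And>y. y0 \<le> y \<Longrightarrow> prob {x \<in> space N. G y (letter x)} \<le> c2 / y powr p"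
  shows "\<exists>K\<ge>1. \<exists>c>0. \<forall>k\<ge>1. \<forall>y. K * real k powr (1 / p) \<le> y \<longrightarrow>
     c * (real k / y powr p) \<le> prob {x \<in> space N. y \<le> (\<Sum>j<k. fluct j x)}"
proof -
  obtain \<delta> where \<delta>: "0 < \<delta>" "\<And>k. \<delta> \<le> prob {x \<in> space N. 0 \<le> (\<Sum>j<k. fluct j x)}"
    using sum_nonneg_probability by blast
  define e where "e = exp (- 2 * distortion_bound) * \<delta>\<^sup>2"
  have e: "0 < e" using \<delta>(1) by (simp add: e_def)
  define K0 where "K0 = (2 * exp distortion_bound * c2 / e) powr (1 / p)"
  define K where "K = max y0 K0"
  have K0: "0 < 2 * exp distortion_bound * c2 / e" using e c by simp
  have K1: "1 \<le> K" "y0 \<le> K" using y0 by (auto simp: K_def)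
  have "c1 * (e / 2) * (real k / y powr p) \<le> prob {x \<in> space N. y \<le> (\<Sum>j<k. fluct j x)}"
    if k: "1 \<le> k" and y: "K * real k powr (1 / p) \<le> y" for k :: nat and y
  proof -
    let ?q = "prob {x \<in> space N. G y (letter x)}"
    have "1 \<le> real k powr (1 / p)" using k p by (intro ge_one_powr_ge_zero) auto
    then have "K * 1 \<le> K * real k powr (1 / p)" using K1 by (intro mult_left_mono) auto
    then have Ky: "K \<le> y" using y by simp
    then have y1: "y0 \<le> y" "0 < y" using K1 by auto
    have "K0 * real k powr (1 / p) \<le> K * real k powr (1 / p)"
      by (intro mult_right_mono) (auto simp: K_def)
    also note y
    finally have "(K0 * real k powr (1 / p)) powr p \<le> y powr p"
      using p by (intro powr_mono2) (auto simp: K0_def)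
    moreover have "(K0 * real k powr (1 / p)) powr p = 2 * exp distortion_bound * c2 / e * real k"
      using p e c k by (simp add: K0_def powr_mult powr_powr)
    ultimately have "2 * exp distortion_bound * c2 / e * real k \<le> y powr p" by simp
    then have small: "exp distortion_bound * (real k * (c2 / y powr p)) \<le> e / 2"
      using e y1 by (simp add: field_simps)
    have "exp distortion_bound * (real k * ?q) \<le> exp distortion_bound * (real k * (c2 / y powr p))"
      by (intro mult_left_mono up[OF y1(1)]) auto
    with small have half: "e / 2 \<le> e - exp distortion_bound * (real k * ?q)" by linarith
    have "c1 * (e / 2) * (real k / y powr p) = real k * (c1 / y powr p) * (e / 2)" by (simp add: ac_simps)
    also have "\<dots> \<le> real k * ?q * (e - exp distortion_bound * (real k * ?q))"
      using half e by (intro mult_mono mult_left_mono low[OF y1(1)]) auto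
    also have "\<dots> \<le> prob {x \<in> space N. y \<le> (\<Sum>j<k. fluct j x)}"
      unfolding e_def by (rule big_jump[OF less_imp_le[OF \<delta>(1)] \<delta>(2) G[OF y1(1)] refl])
    finally show ?thesis .
  qed
  then show ?thesis
    using K1 c e by (intro exI[of _ K] conjI exI[of _ "c1 * (e / 2)"]) auto
qed

end

section \<open>The induced map of a tower\<close>

context young_tower
begin

abbreviation basis :: "'a set" where "basis \<equiv> tower_basis A \<Delta>"
abbreviation first_return :: "'a \<Rightarrow> 'a" where "first_return \<equiv> induced_map T A h \<Delta>"
abbreviation base_measure :: "'a measure" where "base_measure \<equiv> normalized_restriction M basis"

definition branch :: "'a \<Rightarrow> 'i" where
  "branch x = (THE \<alpha>. \<alpha> \<in> A \<and> x \<in> \<Delta> \<alpha> 0)"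

lemma height_positive: "\<alpha> \<in> A \<Longrightarrow> 0 < h \<alpha>"
  using height_pos by force

lemma branch_eq: "\<alpha> \<in> A \<Longrightarrow> x \<in> \<Delta> \<alpha> 0 \<Longrightarrow> branch x = \<alpha>"
  unfolding branch_def using cell_unique height_positive by (intro the_equality) blast+

lemma return_time_branch: "return_time A h \<Delta> x = h (branch x)"
  by (simp add: return_time_def branch_def)

lemma basis_cases: "x \<in> basis \<Longrightarrow> branch x \<in> A \<and> x \<in> \<Delta> (branch x) 0"
  by (auto simp: tower_basis_def branch_eq)

lemma basis_sets [measurable]: "basis \<in> sets M"
  unfolding tower_basis_def
  by (rule sets.countable_UN''[OF countable_index]) (use cells_measurable height_positive in blast)

lemma basis_subset: "basis \<subseteq> space M"
  using basis_sets by (rule sets.sets_into_space)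

lemma basis_pos: "0 < prob basis"
proof -
  obtain \<alpha> where \<alpha>: "\<alpha> \<in> A"
    using not_empty cells_cover by fastforce
  have "0 < prob (\<Delta> \<alpha> 0)" by (rule cells_pos[OF \<alpha> height_positive[OF \<alpha>]])
  also have "\<dots> \<le> prob basis"
    by (rule finite_measure_mono[OF _ basis_sets]) (use \<alpha> in \<open>auto simp: tower_basis_def\<close>)
  finally show ?thesis .
qed

lemma space_base [simp]: "space base_measure = basis"
  using basis_subset by (simp add: normalized_restriction_def space_scale_measure space_restrict_space Int_absorb1 Int_absorb2)

lemma sets_base: "E \<in> sets base_measure \<longleftrightarrow> E \<in> sets M \<and> E \<subseteq> basis"
  using basis_subset by (auto simp: normalized_restriction_def sets_restrict_space_iff Int_absorb2 basis_sets)

lemma emeasure_base: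
  assumes "E \<in> sets M" "E \<subseteq> basis"
  shows "emeasure base_measure E = ennreal (prob E / prob basis)"
proof -
  have "emeasure base_measure E = 1 / emeasure M basis * emeasure M E"
    using assms basis_subset
    by (simp add: normalized_restriction_def emeasure_restrict_space Int_absorb2 basis_sets)
  also have "\<dots> = ennreal (1 / prob basis) * ennreal (prob E)"
    using basis_pos by (simp add: emeasure_eq_measure divide_ennreal flip: ennreal_1)
  also have "\<dots> = ennreal (prob E / prob basis)"
    by (simp flip: ennreal_mult)
  finally show ?thesis .
qed

lemma measure_base:
  "E \<in> sets M \<Longrightarrow> E \<subseteq> basis \<Longrightarrow> measure base_measure E = prob E / prob basis"
  using emeasure_base[of E] by (simp add: measure_def)

lemma prob_space_base: "prob_space base_measure"
proof
  show "emeasure base_measure (space base_measure) = 1"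
    using emeasure_base[of basis] basis_pos by simp
qed

lemma branch_sets_eq: "{x \<in> basis. branch x = a} = (if a \<in> A then \<Delta> a 0 else {})"
  using basis_cases branch_eq by (auto simp: tower_basis_def)

lemma branch_iff: "a \<in> A \<Longrightarrow> x \<in> basis \<and> branch x = a \<longleftrightarrow> x \<in> \<Delta> a 0"
  using basis_cases branch_eq unfolding tower_basis_def by blast

lemma cell0_sets: "a \<in> A \<Longrightarrow> \<Delta> a 0 \<in> sets base_measure"
  unfolding sets_base using cells_measurable height_positive by (auto simp: tower_basis_def)

lemma first_return_measurable [measurable]: "first_return \<in> measurable base_measure base_measure"
  using induced_preserving by (simp add: measure_preserving_map_def)

lemma bij_first_return:
  assumes "\<alpha> \<in> A"
  shows "bij_betw first_return (\<Delta> \<alpha> 0) basis"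
proof -
  have 1: "bij_betw (T ^^ (h \<alpha> - 1)) (\<Delta> \<alpha> 0) (\<Delta> \<alpha> (h \<alpha> - 1))"
    using height_positive[OF assms] by (intro bij_climb[OF assms]) auto
  have 2: "bij_betw T (\<Delta> \<alpha> (h \<alpha> - 1)) basis"
    using return[OF assms] by (simp add: bimeasurable_bij_def)
  have "bij_betw (T \<circ> T ^^ (h \<alpha> - 1)) (\<Delta> \<alpha> 0) basis"
    by (rule bij_betw_trans[OF 1 2])
  moreover have "T \<circ> T ^^ (h \<alpha> - 1) = T ^^ h \<alpha>"
    using height_positive[OF assms] by (metis Suc_diff_1 funpow.simps(2))
  moreover have "first_return x = (T ^^ h \<alpha>) x" if "x \<in> \<Delta> \<alpha> 0" for x
    by (simp add: induced_map_def return_time_branch branch_eq[OF assms that])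
  ultimately show ?thesis
    using bij_betw_cong[of "\<Delta> \<alpha> 0" first_return "T ^^ h \<alpha>" basis] by simp
qed

lemma first_return_pow_basis: "x \<in> basis \<Longrightarrow> (first_return ^^ k) x \<in> basis"
  using measurable_space[OF first_return_measurable] by (induction k) auto

text \<open>
  For distinct points of the basis the separation time is at least the length of their common itinerary.
\<close>

lemma tower_dist_le:
  assumes x: "x \<in> basis" and y: "y \<in> basis"
    and same: "\<And>k. k < n \<Longrightarrow> branch ((first_return ^^ k) x) = branch ((first_return ^^ k) y)"
  shows "tower_dist T A h \<Delta> \<beta> x y \<le> \<beta> ^ n"
proof (cases "x = y")
  case True
  then show ?thesis using beta by (simp add: tower_dist_def)
next
  case False
  obtain k where "separated_at T A h \<Delta> x y k" using separation_finite[OF x y False] by blast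
  then have L: "separated_at T A h \<Delta> x y (LEAST k. separated_at T A h \<Delta> x y k)" (is "separated_at T A h \<Delta> x y ?l")
    by (rule LeastI)
  have "n \<le> ?l"
  proof (rule ccontr)
    assume "\<not> n \<le> ?l"
    then have "branch ((first_return ^^ ?l) x) = branch ((first_return ^^ ?l) y)" by (intro same) simp
    moreover note basis_cases[OF first_return_pow_basis[OF x, of ?l]] basis_cases[OF first_return_pow_basis[OF y, of ?l]]
    ultimately show False using L by (auto simp: separated_at_def)
  qed
  then have "\<beta> ^ ?l \<le> \<beta> ^ n" using beta by (intro power_decreasing) auto
  then show ?thesis using x y False by (simp add: tower_dist_def separation_time_def)
qed

text \<open>
  The measure of a set \<open>F\<close> in the basis is the integral of the Jacobian over the part of its preimage
  in the column \<open>a\<close>. There the Jacobian at \<open>z\<close> is at most \<open>exp (\<bar>C\<bar> \<beta> ^ n)\<close> times the Jacobian at any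
  \<open>x\<close> in the corresponding preimage of \<open>E\<close>; integrating over \<open>z\<close> and then over \<open>x\<close> gives the claim. The
  absolute value covers a negative constant in the tower axiom.
\<close>

lemma base_distortion:
  "\<exists>C\<ge>0. \<forall>a n. \<forall>E\<in>sets base_measure. \<forall>F\<in>sets base_measure.
      same_itinerary first_return branch n (E \<union> F) \<longrightarrow>
      measure base_measure {x \<in> space base_measure. branch x = a \<and> first_return x \<in> E} * measure base_measure F
       \<le> exp (C * \<beta> ^ n) *
          (measure base_measure {x \<in> space base_measure. branch x = a \<and> first_return x \<in> F} * measure base_measure E)"
proof -
  interpret N: prob_space base_measure by (rule prob_space_base)
  obtain J C where JC: "\<And>\<alpha>. \<alpha> \<in> A \<Longrightarrow> jacobian_on base_measure first_return (\<Delta> \<alpha> 0) J"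
    "\<And>\<alpha> x y. \<alpha> \<in> A \<Longrightarrow> x \<in> \<Delta> \<alpha> 0 \<Longrightarrow> y \<in> \<Delta> \<alpha> 0 \<Longrightarrow> \<bar>ln (J x) - ln (J y)\<bar>
       \<le> C * tower_dist T A h \<Delta> \<beta> (first_return x) (first_return y)"
    using bounded_distortion by blast
  let ?b = "\<lambda>a E. {x \<in> space base_measure. branch x = a \<and> first_return x \<in> E}"
  have main: "measure base_measure (?b a E) * measure base_measure F
      \<le> exp (\<bar>C\<bar> * \<beta> ^ n) * (measure base_measure (?b a F) * measure base_measure E)"
    if E: "E \<in> sets base_measure" and F: "F \<in> sets base_measure"
      and same: "same_itinerary first_return branch n (E \<union> F)" for a n E F
  proof (cases "a \<in> A")
    case False
    then have "?b a E = {}" using basis_cases by auto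
    then show ?thesis by (simp only: measure_empty) simp
  next
    case a: True
    let ?r = "exp (\<bar>C\<bar> * \<beta> ^ n)"
    have sub: "E \<subseteq> basis" "F \<subseteq> basis" using E F by (auto simp: sets_base)
    have b_eq: "?b a E = {x \<in> \<Delta> a 0. first_return x \<in> E}" for E
      by (simp only: space_base conj_assoc[symmetric] branch_iff[OF a])
    have img: "first_return ` ?b a E = E" if "E \<subseteq> basis" for E
    proof -
      have "first_return ` {x \<in> \<Delta> a 0. first_return x \<in> E} = first_return ` \<Delta> a 0 \<inter> E" by blast
      then show ?thesis
        unfolding b_eq using bij_first_return[OF a] that by (simp add: bij_betw_def Int_absorb1)
    qed
    have b_sets: "?b a E \<in> sets base_measure" if "E \<in> sets base_measure" for E
    proof -
      have "?b a E = \<Delta> a 0 \<inter> (first_return -` E \<inter> space base_measure)"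
        using b_eq[of E] cell0_sets[OF a] by (auto simp: sets_base)
      then show ?thesis
        using cell0_sets[OF a] measurable_sets[OF first_return_measurable that] by simp
    qed
    have Jpos: "0 < J x" if "x \<in> \<Delta> a 0" for x
      using JC(1)[OF a] that by (simp add: jacobian_on_def)
    have jac: "emeasure base_measure E = (\<integral>\<^sup>+x\<in>?b a E. ennreal (J x) \<partial>base_measure)"
      if "E \<in> sets base_measure" for E
    proof -
      have "?b a E \<subseteq> \<Delta> a 0" unfolding b_eq by blast
      then have "emeasure base_measure (first_return ` ?b a E) = (\<integral>\<^sup>+x\<in>?b a E. ennreal (J x) \<partial>base_measure)"
        using JC(1)[OF a] b_sets[OF that] unfolding jacobian_on_def by blast
      moreover have "E \<subseteq> basis" using that by (simp add: sets_base)
      ultimately show ?thesis by (simp only: img)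
    qed
    have ratio: "J z \<le> ?r * J x" if z: "z \<in> ?b a F" and x: "x \<in> ?b a E" for z x
    proof -
      have zx: "z \<in> \<Delta> a 0" "x \<in> \<Delta> a 0" using z x b_eq by auto
      have "tower_dist T A h \<Delta> \<beta> (first_return z) (first_return x) \<le> \<beta> ^ n"
      proof (rule tower_dist_le)
        show "first_return z \<in> basis" "first_return x \<in> basis" using z x sub by auto
        show "branch ((first_return ^^ k) (first_return z)) = branch ((first_return ^^ k) (first_return x))"
          if "k < n" for k
          using same z x that by (simp add: same_itinerary_def)
      qed
      then have "\<bar>C\<bar> * tower_dist T A h \<Delta> \<beta> (first_return z) (first_return x) \<le> \<bar>C\<bar> * \<beta> ^ n"
        by (intro mult_left_mono) auto
      moreover have "C * tower_dist T A h \<Delta> \<beta> (first_return z) (first_return x)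
          \<le> \<bar>C\<bar> * tower_dist T A h \<Delta> \<beta> (first_return z) (first_return x)"
        using beta by (intro mult_right_mono) (auto simp: tower_dist_def)
      ultimately have "ln (J z) \<le> \<bar>C\<bar> * \<beta> ^ n + ln (J x)"
        using JC(2)[OF a zx] by linarith
      then have "exp (ln (J z)) \<le> exp (\<bar>C\<bar> * \<beta> ^ n + ln (J x))" by simp
      then show ?thesis using Jpos zx by (simp add: exp_add)
    qed
    have Jm: "(\<lambda>x. ennreal (J x) * indicator (?b a E) x) \<in> borel_measurable base_measure"
    proof -
      have "(\<lambda>x. ennreal (J x)) \<in> borel_measurable (restrict_space base_measure (\<Delta> a 0))"
        using JC(1)[OF a] by (auto simp: jacobian_on_def)
      then have "(\<lambda>x. ennreal (J x) * indicator (\<Delta> a 0) x) \<in> borel_measurable base_measure"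
        by (rule borel_measurable_restrict_space_iff_ennreal[OF sets.Int[OF cell0_sets[OF a] sets.top], THEN iffD1])
      then have "(\<lambda>x. ennreal (J x) * indicator (\<Delta> a 0) x * indicator (?b a E) x) \<in> borel_measurable base_measure"
        by (rule borel_measurable_times_ennreal[OF _ borel_measurable_indicator[OF b_sets[OF E]]])
      then show ?thesis
        by (rule measurable_cong[THEN iffD1, rotated]) (use b_eq[of E] in \<open>auto split: split_indicator\<close>)
    qed
    have pt: "emeasure base_measure F * indicator (?b a E) x
        \<le> (ennreal ?r * emeasure base_measure (?b a F)) * (ennreal (J x) * indicator (?b a E) x)" for x
    proof (cases "x \<in> ?b a E")
      case True
      have "emeasure base_measure F = (\<integral>\<^sup>+z\<in>?b a F. ennreal (J z) \<partial>base_measure)"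
        by (rule jac[OF F])
      also have "\<dots> \<le> (\<integral>\<^sup>+z\<in>?b a F. ennreal (?r * J x) \<partial>base_measure)"
        using ratio[OF _ True] by (intro nn_integral_mono) (auto split: split_indicator intro!: ennreal_leI)
      also have "\<dots> = ennreal (?r * J x) * emeasure base_measure (?b a F)"
        using b_sets[OF F] by (rule nn_integral_cmult_indicator)
      also have "\<dots> = (ennreal ?r * emeasure base_measure (?b a F)) * ennreal (J x)"
      proof -
        have "x \<in> \<Delta> a 0" using True unfolding b_eq by blast
        then have "ennreal (?r * J x) = ennreal ?r * ennreal (J x)"
          using Jpos[of x] by (intro ennreal_mult) auto
        then show ?thesis by (simp only: ac_simps)
      qed
      finally show ?thesis using True by simp
    qed simp
    have "emeasure base_measure F * emeasure base_measure (?b a E)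
        = (\<integral>\<^sup>+x. emeasure base_measure F * indicator (?b a E) x \<partial>base_measure)"
      using b_sets[OF E] by (simp add: nn_integral_cmult_indicator)
    also have "\<dots> \<le> (\<integral>\<^sup>+x. (ennreal ?r * emeasure base_measure (?b a F)) * (ennreal (J x) * indicator (?b a E) x) \<partial>base_measure)"
      by (intro nn_integral_mono pt)
    also have "\<dots> = (ennreal ?r * emeasure base_measure (?b a F)) * emeasure base_measure E"
      unfolding jac[OF E] by (rule nn_integral_cmult[OF Jm])
    finally have "ennreal (measure base_measure F * measure base_measure (?b a E))
        \<le> ennreal (?r * measure base_measure (?b a F) * measure base_measure E)"
      by (simp add: N.emeasure_eq_measure ennreal_mult)
    then show ?thesis by (subst (asm) ennreal_le_iff) (auto simp: ac_simps)
  qed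
  show ?thesis by (intro exI[of _ "\<bar>C\<bar>"] conjI allI ballI impI main) auto
qed

lemma ex_gibbs_markov: "\<exists>C. gibbs_markov base_measure first_return branch C \<beta>"
proof -
  interpret N: prob_space base_measure by (rule prob_space_base)
  obtain C where C: "0 \<le> C" "\<forall>a n. \<forall>E\<in>sets base_measure. \<forall>F\<in>sets base_measure.
      same_itinerary first_return branch n (E \<union> F) \<longrightarrow>
      measure base_measure {x \<in> space base_measure. branch x = a \<and> first_return x \<in> E} * measure base_measure F
       \<le> exp (C * \<beta> ^ n) *
          (measure base_measure {x \<in> space base_measure. branch x = a \<and> first_return x \<in> F} * measure base_measure E)"
    using base_distortion by blast
  have "gibbs_markov base_measure first_return branch C \<beta>"
  proof
    show "distr base_measure base_measure first_return = base_measure"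
      using induced_preserving by (simp add: measure_preserving_map_def)
    show "{x \<in> space base_measure. branch x = a} \<in> sets base_measure" for a
      using branch_sets_eq[of a] cell0_sets[of a] by (auto split: if_splits)
    show "countable (branch ` space base_measure)"
      by (rule countable_subset[OF _ countable_index]) (use basis_cases in auto)
  qed (use beta C in auto)
  then show ?thesis by blast
qed

text \<open>
  A point that \<open>T\<close> maps into a level above the ground comes from the level directly below it, because
  all tops of columns are mapped to the basis. So the measure is constant along a column.
\<close>

lemma cell_level_measure:
  assumes "\<alpha> \<in> A"
  shows "l < h \<alpha> \<Longrightarrow> prob (\<Delta> \<alpha> l) = prob (\<Delta> \<alpha> 0)"
proof (induction l)
  case (Suc l)
  have T: "T \<in> measurable M M" "distr M M T = M"
    using preserving by (auto simp: measure_preserving_map_def)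
  have bij: "bij_betw T (\<Delta> \<alpha> l) (\<Delta> \<alpha> (Suc l))"
    using climb[OF assms, of l] Suc.prems by (simp add: bimeasurable_bij_def)
  have meas: "\<Delta> \<alpha> l \<in> sets M" "\<Delta> \<alpha> (Suc l) \<in> sets M"
    using cells_measurable[OF assms] Suc.prems by auto
  have "T -` \<Delta> \<alpha> (Suc l) \<inter> space M = \<Delta> \<alpha> l"
  proof (intro equalityI subsetI)
    fix x assume x: "x \<in> T -` \<Delta> \<alpha> (Suc l) \<inter> space M"
    then have "x \<in> (\<Union>\<alpha>\<in>A. \<Union>l<h \<alpha>. \<Delta> \<alpha> l)" unfolding cells_cover by simp
    then obtain \<alpha>' l' where al: "\<alpha>' \<in> A" "l' < h \<alpha>'" "x \<in> \<Delta> \<alpha>' l'" by blast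
    show "x \<in> \<Delta> \<alpha> l"
    proof (cases "l' + 1 < h \<alpha>'")
      case True
      then have "T x \<in> \<Delta> \<alpha>' (l' + 1)"
        using climb[OF al(1) True] al(3) by (auto simp: bimeasurable_bij_def bij_betw_def)
      then have "\<alpha>' = \<alpha> \<and> l' + 1 = Suc l"
        using cell_unique[OF al(1) True _ assms Suc.prems] x by auto
      then show ?thesis using al by auto
    next
      case False
      then have "l' = h \<alpha>' - 1" using al(2) by simp
      then have "T x \<in> basis"
        using return[OF al(1)] al(3) by (auto simp: bimeasurable_bij_def bij_betw_def)
      then obtain \<alpha>2 where "\<alpha>2 \<in> A" "T x \<in> \<Delta> \<alpha>2 0" by (auto simp: tower_basis_def)
      then have False
        using cell_unique[of \<alpha>2 0 "T x" \<alpha> "Suc l"] height_positive assms Suc.prems x by auto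
      then show ?thesis ..
    qed
  next
    fix x assume "x \<in> \<Delta> \<alpha> l"
    then show "x \<in> T -` \<Delta> \<alpha> (Suc l) \<inter> space M"
      using bij sets.sets_into_space[OF meas(1)] by (auto simp: bij_betw_def)
  qed
  then have "prob (\<Delta> \<alpha> (Suc l)) = prob (\<Delta> \<alpha> l)"
    using measure_distr[OF T(1) meas(2)] T(2) by simp
  then show ?case using Suc by simp
qed simp

text \<open>
  Kac's formula: the column over \<open>\<Delta> \<alpha> 0\<close> has total measure \<open>h \<alpha>\<close> times that of its base, and the columns
  fill the space.
\<close>

lemma kac: "(\<integral>\<^sup>+x. ennreal (h (branch x)) \<partial>base_measure) = ennreal (1 / prob basis)"
proof -
  have e0: "emeasure base_measure (\<Delta> \<alpha> 0) = ennreal (prob (\<Delta> \<alpha> 0) / prob basis)" if "\<alpha> \<in> A" for \<alpha>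
    using cell0_sets[OF that] by (intro emeasure_base) (auto simp: sets_base)
  have "(\<integral>\<^sup>+x. ennreal (h (branch x)) \<partial>base_measure)
      = (\<integral>\<^sup>+x. (\<integral>\<^sup>+\<alpha>. ennreal (h \<alpha>) * indicator (\<Delta> \<alpha> 0) x \<partial>count_space A) \<partial>base_measure)"
  proof (rule nn_integral_cong)
    fix x assume "x \<in> space base_measure"
    then have x: "branch x \<in> A" "x \<in> \<Delta> (branch x) 0" using basis_cases by auto
    have "(\<integral>\<^sup>+\<alpha>. ennreal (h \<alpha>) * indicator (\<Delta> \<alpha> 0) x \<partial>count_space A)
        = (\<integral>\<^sup>+\<alpha>. ennreal (h (branch x)) * indicator {branch x} \<alpha> \<partial>count_space A)"
    proof (rule nn_integral_cong)
      fix \<alpha> assume "\<alpha> \<in> space (count_space A)"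
      then have "x \<in> \<Delta> \<alpha> 0 \<longleftrightarrow> \<alpha> = branch x" using x(2) branch_eq[of \<alpha> x] by auto
      then show "ennreal (h \<alpha>) * indicator (\<Delta> \<alpha> 0) x
          = ennreal (h (branch x)) * indicator {branch x} \<alpha>" by (simp add: indicator_def)
    qed
    also have "\<dots> = ennreal (h (branch x))"
      using x by (subst nn_integral_cmult_indicator) auto
    finally show "ennreal (h (branch x)) = (\<integral>\<^sup>+\<alpha>. ennreal (h \<alpha>) * indicator (\<Delta> \<alpha> 0) x \<partial>count_space A)" ..
  qed
  also have "\<dots> = (\<integral>\<^sup>+\<alpha>. (\<integral>\<^sup>+x. ennreal (h \<alpha>) * indicator (\<Delta> \<alpha> 0) x \<partial>base_measure) \<partial>count_space A)"
    using countable_index cell0_sets by (intro nn_integral_count_space_nn_integral) auto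
  also have "\<dots> = (\<integral>\<^sup>+\<alpha>. ennreal (1 / prob basis) * (\<integral>\<^sup>+l. emeasure M (\<Delta> \<alpha> l) \<partial>count_space {..<h \<alpha>}) \<partial>count_space A)"
  proof (rule nn_integral_cong)
    fix \<alpha> assume "\<alpha> \<in> space (count_space A)"
    then have \<alpha>: "\<alpha> \<in> A" by simp
    have "(\<integral>\<^sup>+x. ennreal (h \<alpha>) * indicator (\<Delta> \<alpha> 0) x \<partial>base_measure)
        = ennreal (h \<alpha>) * emeasure base_measure (\<Delta> \<alpha> 0)"
      by (rule nn_integral_cmult_indicator[OF cell0_sets[OF \<alpha>]])
    also have "\<dots> = ennreal (1 / prob basis * (h \<alpha> * prob (\<Delta> \<alpha> 0)))"
      unfolding e0[OF \<alpha>] by (subst ennreal_mult[symmetric]) auto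
    also have "\<dots> = ennreal (1 / prob basis) * ennreal (h \<alpha> * prob (\<Delta> \<alpha> 0))"
      by (rule ennreal_mult) auto
    also have "h \<alpha> * prob (\<Delta> \<alpha> 0) = (\<Sum>l<h \<alpha>. prob (\<Delta> \<alpha> l))"
    proof -
      have "(\<Sum>l<h \<alpha>. prob (\<Delta> \<alpha> l)) = (\<Sum>l<h \<alpha>. prob (\<Delta> \<alpha> 0))"
        by (intro sum.cong refl cell_level_measure[OF \<alpha>]) simp
      then show ?thesis by simp
    qed
    also have "ennreal (\<Sum>l<h \<alpha>. prob (\<Delta> \<alpha> l)) = (\<integral>\<^sup>+l. emeasure M (\<Delta> \<alpha> l) \<partial>count_space {..<h \<alpha>})"
      by (simp add: nn_integral_count_space_finite emeasure_eq_measure)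
    finally show "(\<integral>\<^sup>+x. ennreal (h \<alpha>) * indicator (\<Delta> \<alpha> 0) x \<partial>base_measure)
      = ennreal (1 / prob basis) * (\<integral>\<^sup>+l. emeasure M (\<Delta> \<alpha> l) \<partial>count_space {..<h \<alpha>})" .
  qed
  also have "\<dots> = ennreal (1 / prob basis) * (\<integral>\<^sup>+\<alpha>. (\<integral>\<^sup>+l. emeasure M (\<Delta> \<alpha> l) \<partial>count_space {..<h \<alpha>}) \<partial>count_space A)"
    by (rule nn_integral_cmult) auto
  also have "(\<integral>\<^sup>+\<alpha>. (\<integral>\<^sup>+l. emeasure M (\<Delta> \<alpha> l) \<partial>count_space {..<h \<alpha>}) \<partial>count_space A) = 1"
  proof -
    have col: "emeasure M (\<Union>l<h \<alpha>. \<Delta> \<alpha> l) = (\<integral>\<^sup>+l. emeasure M (\<Delta> \<alpha> l) \<partial>count_space {..<h \<alpha>})" if "\<alpha> \<in> A" for \<alpha>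
    proof (rule emeasure_UN_countable)
      show "disjoint_family_on (\<Delta> \<alpha>) {..<h \<alpha>}"
        using cell_unique[OF that _ _ that] unfolding disjoint_family_on_def by fastforce
    qed (use cells_measurable[OF that] in auto)
    have "(\<integral>\<^sup>+\<alpha>. (\<integral>\<^sup>+l. emeasure M (\<Delta> \<alpha> l) \<partial>count_space {..<h \<alpha>}) \<partial>count_space A)
        = (\<integral>\<^sup>+\<alpha>. emeasure M (\<Union>l<h \<alpha>. \<Delta> \<alpha> l) \<partial>count_space A)"
      using col by (intro nn_integral_cong) simp
    also have "\<dots> = emeasure M (\<Union>\<alpha>\<in>A. \<Union>l<h \<alpha>. \<Delta> \<alpha> l)"
    proof (rule emeasure_UN_countable[symmetric])
      show "disjoint_family_on (\<lambda>\<alpha>. \<Union>l<h \<alpha>. \<Delta> \<alpha> l) A"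
        using cell_unique unfolding disjoint_family_on_def by fastforce
    qed (use countable_index cells_measurable in auto)
    also have "\<dots> = 1" unfolding cells_cover by (rule emeasure_space_1)
    finally show ?thesis .
  qed
  finally show ?thesis by simp
qed

definition entry_time :: "nat \<Rightarrow> 'a \<Rightarrow> nat" where
  "entry_time k z = (\<Sum>j<k. h (branch ((first_return ^^ j) z)))"

lemma inside_column:
  assumes z: "z \<in> basis" and i: "0 < i" "i < h (branch z)"
  shows "(T ^^ i) z \<notin> basis"
proof
  assume "(T ^^ i) z \<in> basis"
  then obtain \<alpha> where \<alpha>: "\<alpha> \<in> A" "(T ^^ i) z \<in> \<Delta> \<alpha> 0" by (auto simp: tower_basis_def)
  have "(T ^^ i) z \<in> \<Delta> (branch z) i"
    using bij_climb[OF _ i(2)] basis_cases[OF z] by (auto simp: bij_betw_def)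
  then show False
    using cell_unique[of \<alpha> 0 "(T ^^ i) z" "branch z" i] \<alpha> basis_cases[OF z] height_positive i by auto
qed

text \<open>
  Until its first return an orbit that starts in the basis visits the basis only at time \<open>0\<close>, and after the return
  the count continues for the induced map.
\<close>

lemma visits_before_entry:
  "z \<in> basis \<Longrightarrow> card {i. i < entry_time k z \<and> (T ^^ i) z \<in> basis} \<le> k"
proof (induction k arbitrary: z)
  case 0
  then show ?case by (simp add: entry_time_def)
next
  case (Suc k)
  let ?t = "h (branch z)" and ?z = "first_return z"
  have z': "?z \<in> basis" using first_return_pow_basis[OF Suc.prems, of 1] by simp
  have ret: "?z = (T ^^ ?t) z" by (simp add: induced_map_def return_time_branch)
  have t: "entry_time (Suc k) z = ?t + entry_time k ?z"
    unfolding entry_time_def sum.lessThan_Suc_shift by (simp add: funpow_Suc_right del: funpow.simps)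
  have "{i. i < entry_time (Suc k) z \<and> (T ^^ i) z \<in> basis}
      \<subseteq> insert 0 ((\<lambda>i. i + ?t) ` {i. i < entry_time k ?z \<and> (T ^^ i) ?z \<in> basis})" (is "_ \<subseteq> insert 0 ?I")
  proof
    fix i assume i: "i \<in> {i. i < entry_time (Suc k) z \<and> (T ^^ i) z \<in> basis}"
    show "i \<in> insert 0 ?I"
    proof (cases "i < ?t")
      case True
      then have "i = 0" using inside_column[OF Suc.prems, of i] i by auto
      then show ?thesis by simp
    next
      case False
      then have "i = (i - ?t) + ?t" by simp
      moreover have "(T ^^ (i - ?t)) ?z = (T ^^ i) z"
        unfolding ret using False by (metis comp_apply funpow_add le_add_diff_inverse2 not_less)
      moreover have "i - ?t < entry_time k ?z" using i False t by auto
      ultimately show ?thesis using i by (intro insertI2 image_eqI[of _ _ "i - ?t"]) auto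
    qed
  qed
  then have "card {i. i < entry_time (Suc k) z \<and> (T ^^ i) z \<in> basis} \<le> card (insert 0 ?I)"
    by (intro card_mono) auto
  also have "\<dots> \<le> Suc (card ?I)" by (rule card_insert_le_m1) auto
  also have "card ?I \<le> card {i. i < entry_time k ?z \<and> (T ^^ i) ?z \<in> basis}"
    by (rule card_image_le) auto
  finally show ?case using Suc.IH[OF z'] by simp
qed

lemma visits_le:
  assumes "z \<in> basis" "n \<le> entry_time k z"
  shows "card {i. i < n \<and> (T ^^ i) z \<in> basis} \<le> k"
proof -
  have "card {i. i < n \<and> (T ^^ i) z \<in> basis} \<le> card {i. i < entry_time k z \<and> (T ^^ i) z \<in> basis}"
    using assms(2) by (intro card_mono) auto
  also have "\<dots> \<le> k" by (rule visits_before_entry[OF assms(1)])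
  finally show ?thesis .
qed

end

section \<open>Few visits to the basis\<close>

text \<open>
  Jumps are confined to a window \<open>[L, 2 L]\<close>. Its probability has the order \<open>L powr - p\<close> of the full tail,
  and bounds in both directions follow from the individual terms of a finite sum.
\<close>

lemma window_bounds:
  fixes w :: "nat \<Rightarrow> real"
  assumes p: "0 < p" and c: "0 < c1" "0 < c2" and L: "1 \<le> L"
    and w: "\<And>n. L \<le> n \<Longrightarrow> c1 / real n powr (p + 1) \<le> w n" "\<And>n. L \<le> n \<Longrightarrow> w n \<le> c2 / real n powr (p + 1)"
  shows "c1 / 2 powr (p + 1) / real L powr p \<le> (\<Sum>n=L..2*L. w n)"
    and "(\<Sum>n=L..2*L. w n) \<le> 2 * c2 / real L powr p"
proof -
  have Lp: "real L powr (p + 1) = real L * real L powr p" "0 < real L powr p" "0 < real L"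
    using L by (auto simp: powr_add)
  have card: "card {L..2*L} = Suc L" by simp
  have "c1 / 2 powr (p + 1) / real L powr p = real L * (c1 / (2 * real L) powr (p + 1))"
    using Lp by (simp add: powr_mult)
  also have "\<dots> \<le> real (Suc L) * (c1 / (2 * real L) powr (p + 1))"
    using c by (intro mult_right_mono) auto
  also have "\<dots> = (\<Sum>n=L..2*L. c1 / (2 * real L) powr (p + 1))" by (simp add: card)
  also have "\<dots> \<le> (\<Sum>n=L..2*L. w n)"
  proof (rule sum_mono)
    fix n assume n: "n \<in> {L..2*L}"
    have "c1 / (2 * real L) powr (p + 1) \<le> c1 / real n powr (p + 1)"
      using n L p c by (intro divide_left_mono powr_mono2 mult_pos_pos) auto
    also have "\<dots> \<le> w n" using n by (intro w) auto
    finally show "c1 / (2 * real L) powr (p + 1) \<le> w n" .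
  qed
  finally show "c1 / 2 powr (p + 1) / real L powr p \<le> (\<Sum>n=L..2*L. w n)" .
  have "(\<Sum>n=L..2*L. w n) \<le> (\<Sum>n=L..2*L. c2 / real L powr (p + 1))"
  proof (rule sum_mono)
    fix n assume n: "n \<in> {L..2*L}"
    have "w n \<le> c2 / real n powr (p + 1)" using n by (intro w) auto
    also have "\<dots> \<le> c2 / real L powr (p + 1)"
      using n L p c by (intro divide_left_mono powr_mono2 mult_pos_pos) auto
    finally show "w n \<le> c2 / real L powr (p + 1)" .
  qed
  also have "\<dots> = real (Suc L) * (c2 / real L powr (p + 1))" by (simp add: card)
  also have "\<dots> \<le> (2 * real L) * (c2 / real L powr (p + 1))"
    using c L by (intro mult_right_mono) auto
  also have "\<dots> = 2 * c2 / real L powr p" using Lp by simp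
  finally show "(\<Sum>n=L..2*L. w n) \<le> 2 * c2 / real L powr p" .
qed

lemma asymp_equiv_two_sided:
  fixes f g :: "nat \<Rightarrow> real"
  assumes "f \<sim>[at_top] g" and pos: "\<forall>\<^sub>F n in at_top. 0 < g n"
  shows "\<forall>\<^sub>F n in at_top. g n / 2 \<le> f n \<and> f n \<le> 2 * g n"
proof -
  have lim: "((\<lambda>n. if f n = 0 \<and> g n = 0 then 1 else f n / g n) \<longlongrightarrow> 1) at_top"
    using assms(1) by (simp add: asymp_equiv_def)
  have "\<forall>\<^sub>F n in at_top. 1 / 2 < (if f n = 0 \<and> g n = 0 then 1 else f n / g n)"
    by (rule order_tendstoD(1)[OF lim]) simp
  moreover have "\<forall>\<^sub>F n in at_top. (if f n = 0 \<and> g n = 0 then 1 else f n / g n) < 2"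
    by (rule order_tendstoD(2)[OF lim]) simp
  ultimately show ?thesis
    using pos by eventually_elim (auto simp: field_simps)
qed

lemma centered_visit_sum:
  fixes g :: "nat \<Rightarrow> 'a" and m :: real
  shows "(\<Sum>i<n. m - indicator B (g i)) = real n * m - real (card {i. i < n \<and> g i \<in> B})"
proof -
  have "(\<Sum>i<n. indicator B (g i) :: real) = (\<Sum>i<n. if g i \<in> B then 1 else 0)"
    by (intro sum.cong refl) (auto simp: indicator_def)
  also have "\<dots> = card ({..<n} \<inter> {i. g i \<in> B})"
    by (simp add: sum.If_cases)
  also have "{..<n} \<inter> {i. g i \<in> B} = {i. i < n \<and> g i \<in> B}" by auto
  finally show ?thesis by (simp add: sum_subtractf)
qed

context young_tower
begin

abbreviation return_prob :: "nat \<Rightarrow> real" where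
  "return_prob n \<equiv> measure M {z \<in> basis. return_time A h \<Delta> z = n}"

lemma branch_pred_sets: "{x \<in> basis. Q (branch x)} \<in> sets base_measure"
proof -
  obtain C where "gibbs_markov base_measure first_return branch C \<beta>" using ex_gibbs_markov by blast
  then interpret G: gibbs_markov base_measure first_return branch C \<beta> .
  have "branch -` {a. Q a} \<inter> space base_measure \<in> sets base_measure"
    by (rule measurable_sets[OF G.letter_measurable]) simp
  moreover have "branch -` {a. Q a} \<inter> space base_measure = {x \<in> basis. Q (branch x)}" by auto
  ultimately show ?thesis by simp
qed

lemma measure_base_height: "measure base_measure {x \<in> basis. h (branch x) = n} = return_prob n / prob basis"
  using branch_pred_sets[of "\<lambda>a. h a = n"] by (simp add: measure_base sets_base return_time_branch)

lemma measure_base_window: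
  "measure base_measure {x \<in> basis. L \<le> h (branch x) \<and> h (branch x) \<le> U} = (\<Sum>n=L..U. return_prob n / prob basis)"
proof -
  interpret N: prob_space base_measure by (rule prob_space_base)
  have "{x \<in> basis. L \<le> h (branch x) \<and> h (branch x) \<le> U} = (\<Union>n\<in>{L..U}. {x \<in> basis. h (branch x) = n})" by auto
  also have "measure base_measure \<dots> = (\<Sum>n=L..U. measure base_measure {x \<in> basis. h (branch x) = n})"
    by (rule N.finite_measure_finite_Union)
      (use branch_pred_sets[of "\<lambda>a. h a = n" for n] in \<open>auto simp: disjoint_family_on_def\<close>)
  finally show ?thesis by (simp add: measure_base_height)
qed

text \<open>
  The second moment is the sum of \<open>n\<^sup>2\<close> times the probability of the return time \<open>n\<close>.
\<close>

lemma height_square_integrable: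
  assumes "summable (\<lambda>n. (real n)\<^sup>2 * return_prob n)"
  shows "integrable base_measure (\<lambda>x. (real (h (branch x)))\<^sup>2)"
proof -
  interpret N: prob_space base_measure by (rule prob_space_base)
  obtain C where "gibbs_markov base_measure first_return branch C \<beta>" using ex_gibbs_markov by blast
  then interpret G: gibbs_markov base_measure first_return branch C \<beta> .
  let ?E = "\<lambda>n. {x \<in> basis. h (branch x) = n}"
  have E: "?E n \<in> sets base_measure" for n by (rule branch_pred_sets)
  have meas: "(\<lambda>x. (real (h (branch x)))\<^sup>2) \<in> borel_measurable base_measure"
    by (rule measurable_compose[OF G.letter_measurable]) simp
  have "(\<integral>\<^sup>+x. ennreal ((real (h (branch x)))\<^sup>2) \<partial>base_measure)
      = (\<integral>\<^sup>+x. (\<integral>\<^sup>+n. ennreal ((real n)\<^sup>2) * indicator (?E n) x \<partial>count_space UNIV) \<partial>base_measure)"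
  proof (rule nn_integral_cong)
    fix x assume x: "x \<in> space base_measure"
    have "(\<integral>\<^sup>+n. ennreal ((real n)\<^sup>2) * indicator (?E n) x \<partial>count_space UNIV)
        = (\<integral>\<^sup>+n. ennreal ((real (h (branch x)))\<^sup>2) * indicator {h (branch x)} n \<partial>count_space UNIV)"
      using x by (intro nn_integral_cong) (auto simp: indicator_def)
    also have "\<dots> = ennreal ((real (h (branch x)))\<^sup>2)"
      by (subst nn_integral_cmult_indicator) auto
    finally show "ennreal ((real (h (branch x)))\<^sup>2)
        = (\<integral>\<^sup>+n. ennreal ((real n)\<^sup>2) * indicator (?E n) x \<partial>count_space UNIV)" ..
  qed
  also have "\<dots> = (\<integral>\<^sup>+n. (\<integral>\<^sup>+x. ennreal ((real n)\<^sup>2) * indicator (?E n) x \<partial>base_measure) \<partial>count_space UNIV)"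
    by (rule nn_integral_count_space_nn_integral) (use E in auto)
  also have "\<dots> = (\<integral>\<^sup>+n. ennreal ((real n)\<^sup>2 * return_prob n / prob basis) \<partial>count_space UNIV)"
  proof (rule nn_integral_cong)
    fix n
    have "(\<integral>\<^sup>+x. ennreal ((real n)\<^sup>2) * indicator (?E n) x \<partial>base_measure)
        = ennreal ((real n)\<^sup>2) * ennreal (return_prob n / prob basis)"
      using nn_integral_cmult_indicator[OF E] measure_base_height[of n]
      by (simp add: N.emeasure_eq_measure)
    also have "\<dots> = ennreal ((real n)\<^sup>2 * (return_prob n / prob basis))"
      by (rule ennreal_mult[symmetric]) auto
    finally show "(\<integral>\<^sup>+x. ennreal ((real n)\<^sup>2) * indicator (?E n) x \<partial>base_measure)
        = ennreal ((real n)\<^sup>2 * return_prob n / prob basis)" by simp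
  qed
  also have "\<dots> = (\<Sum>n. ennreal ((real n)\<^sup>2 * return_prob n / prob basis))"
    by (rule nn_integral_count_space_nat)
  also have "\<dots> = ennreal (\<Sum>n. (real n)\<^sup>2 * return_prob n / prob basis)"
    using assms by (intro suminf_ennreal2 summable_divide) auto
  finally have fin: "(\<integral>\<^sup>+x. ennreal ((real (h (branch x)))\<^sup>2) \<partial>base_measure) < \<infinity>" by simp
  show ?thesis
    by (rule integrableI_nonneg[OF meas _ fin]) simp
qed

text \<open>
  An instance of \<open>power_tail_deviation\<close> with \<open>H\<close> the height. A letter counts as a jump of size \<open>y\<close> if its
  height lies in the window starting at \<open>L y\<close>, the least integer not below \<open>mean + y\<close>, which is
  comparable to \<open>y\<close>.
\<close>

lemma entry_time_deviation:
  assumes p: "2 < p" and c: "0 < c" and tail: "return_prob \<sim>[at_top] (\<lambda>n. c / real n powr (p + 1))"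
  shows "\<exists>K\<ge>1. \<exists>c0>0. \<forall>k\<ge>1. \<forall>y. K * real k powr (1 / p) \<le> y \<longrightarrow>
    c0 * (real k / y powr p) \<le> measure base_measure {x \<in> basis. real k / prob basis + y \<le> entry_time k x}"
proof -
  obtain C where "gibbs_markov base_measure first_return branch C \<beta>" using ex_gibbs_markov by blast
  then interpret G: gibbs_markov base_measure first_return branch C \<beta> .
  let ?\<mu> = "prob basis"
  have "\<forall>\<^sub>F n in at_top. 0 < c / real n powr (p + 1)"
    using eventually_gt_at_top[of 0] by eventually_elim (use c in auto)
  from asymp_equiv_two_sided[OF tail this] obtain n0 where
    n0: "\<And>n. n0 \<le> n \<Longrightarrow> c / real n powr (p + 1) / 2 \<le> return_prob n \<and> return_prob n \<le> 2 * (c / real n powr (p + 1))"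
    by (auto simp: eventually_at_top_linorder)
  have w1: "c / 2 / real n powr (p + 1) \<le> return_prob n" if "n0 \<le> n" for n
    using n0[OF that] by (simp add: mult.commute)
  have w2: "return_prob n \<le> 2 * c / real n powr (p + 1)" if "n0 \<le> n" for n
    using n0[OF that] by simp
  have summ: "summable (\<lambda>n. (real n)\<^sup>2 * return_prob n)"
  proof (rule summable_comparison_test_ev)
    show "summable (\<lambda>n. 2 * c * real n powr (1 - p))"
      using p by (intro summable_mult) (simp add: summable_real_powr_iff)
    have "norm ((real n)\<^sup>2 * return_prob n) \<le> 2 * c * real n powr (1 - p)" if n: "max 1 n0 \<le> n" for n
    proof -
      have "(real n)\<^sup>2 * return_prob n \<le> (real n)\<^sup>2 * (2 * (c / real n powr (p + 1)))"
        using n0[of n] n by (intro mult_left_mono) auto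
      also have "\<dots> = 2 * c * (real n powr 2 / real n powr (p + 1))"
        using n by simp
      also have "real n powr 2 / real n powr (p + 1) = real n powr (1 - p)"
        by (simp add: powr_diff[symmetric] del: powr_numeral)
      finally show ?thesis by simp
    qed
    then show "\<forall>\<^sub>F n in sequentially. norm ((real n)\<^sup>2 * return_prob n) \<le> 2 * c * real n powr (1 - p)"
      unfolding eventually_sequentially by blast
  qed
  have unb: "0 < G.prob {x \<in> space base_measure. t \<le> real (h (branch x))}" for t :: real
  proof -
    define n where "n = max (max 1 n0) (nat \<lceil>t\<rceil>)"
    have n: "n0 \<le> n" "1 \<le> n" "t \<le> real n" by (auto simp: n_def) linarith
    have "0 < c / real n powr (p + 1) / 2 / ?\<mu>" using c n basis_pos by simp
    also have "\<dots> \<le> return_prob n / ?\<mu>" using n0[OF n(1)] basis_pos by (intro divide_right_mono) auto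
    also have "\<dots> = G.prob {x \<in> basis. h (branch x) = n}" by (rule measure_base_height[symmetric])
    also have "\<dots> \<le> G.prob {x \<in> basis. t \<le> real (h (branch x))}"
      using n by (intro G.finite_measure_mono branch_pred_sets) auto
    finally show ?thesis by simp
  qed
  interpret O: gibbs_markov_observable base_measure first_return branch C \<beta> "\<lambda>a. real (h a)"
    by unfold_locales (use height_square_integrable[OF summ] unb in auto)
  have mean: "O.mean = 1 / ?\<mu>"
  proof -
    have "ennreal O.mean = (\<integral>\<^sup>+x. ennreal (h (branch x)) \<partial>base_measure)"
      unfolding O.mean_def by (rule nn_integral_eq_integral[OF O.H_integrable, symmetric]) simp
    then show ?thesis
      unfolding kac using O.mean_nonneg by (subst (asm) ennreal_inj) auto
  qed
  have fl: "(\<Sum>j<k. O.fluct j x) = entry_time k x - real k / ?\<mu>" for k x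
    by (simp add: O.fluct_def entry_time_def sum_subtractf mean)
  define L where "L y = nat \<lceil>O.mean + y\<rceil>" for y :: real
  define y0 where "y0 = max 1 (real n0)"
  define b where "b = O.mean + 2"
  have b: "0 < b" using O.mean_nonneg by (simp add: b_def)
  have L: "1 \<le> L y" "n0 \<le> L y" "O.mean + y \<le> L y" "y \<le> L y" "L y \<le> b * y" if y: "y0 \<le> y" for y :: real
  proof -
    have y1: "1 \<le> y" "real n0 \<le> y" using y by (auto simp: y0_def)
    have m: "0 \<le> O.mean" by (rule O.mean_nonneg)
    show 1: "O.mean + y \<le> L y" unfolding L_def by linarith
    show 2: "y \<le> L y" using 1 m by linarith
    show "1 \<le> L y" "n0 \<le> L y" using 2 y1 by linarith+
    have "L y \<le> O.mean + y + 1" unfolding L_def using m y1 by linarith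
    also have "\<dots> \<le> O.mean * y + y + y" using m y1 mult_left_mono[of 1 y O.mean] by simp
    finally show "L y \<le> b * y" by (simp add: b_def algebra_simps)
  qed
  define G where "G y a \<longleftrightarrow> L y \<le> h a \<and> h a \<le> 2 * L y" for y :: real and a
  have GP: "G.prob {x \<in> space base_measure. G y (branch x)} = (\<Sum>n=L y..2 * L y. return_prob n) / ?\<mu>" for y
    using measure_base_window[of "L y" "2 * L y"] by (simp add: G_def sum_divide_distrib)
  define c1 where "c1 = c / 2 / 2 powr (p + 1) / b powr p / ?\<mu>"
  define c2 where "c2 = 2 * (2 * c) / ?\<mu>"
  have c12: "0 < c1" "0 < c2" using c b basis_pos by (simp_all add: c1_def c2_def)
  have lower: "c1 / y powr p \<le> G.prob {x \<in> space base_measure. G y (branch x)}" if y: "y0 \<le> y" for y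
  proof -
    have yp: "0 < y" using y by (simp add: y0_def)
    have "c1 / y powr p = c / 2 / 2 powr (p + 1) / (b * y) powr p / ?\<mu>"
      using b yp by (simp add: c1_def powr_mult)
    also have "\<dots> \<le> c / 2 / 2 powr (p + 1) / (L y) powr p / ?\<mu>"
      using L[OF y] p c b yp basis_pos
      by (intro divide_right_mono divide_left_mono powr_mono2 mult_pos_pos) auto
    also have "\<dots> \<le> (\<Sum>n=L y..2 * L y. return_prob n) / ?\<mu>"
      by (intro divide_right_mono window_bounds(1)[OF _ _ _ L(1)[OF y]
            w1[OF order_trans[OF L(2)[OF y]]] w2[OF order_trans[OF L(2)[OF y]]]]) (use p c in auto)
    finally show ?thesis unfolding GP .
  qed
  have upper: "G.prob {x \<in> space base_measure. G y (branch x)} \<le> c2 / y powr p" if y: "y0 \<le> y" for y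
  proof -
    have yp: "0 < y" using y by (simp add: y0_def)
    have "(\<Sum>n=L y..2 * L y. return_prob n) / ?\<mu> \<le> 2 * (2 * c) / (L y) powr p / ?\<mu>"
      by (intro divide_right_mono window_bounds(2)[OF _ _ _ L(1)[OF y]
            w1[OF order_trans[OF L(2)[OF y]]] w2[OF order_trans[OF L(2)[OF y]]]]) (use p c in auto)
    also have "\<dots> \<le> 2 * (2 * c) / y powr p / ?\<mu>"
      using L[OF y] p c yp basis_pos
      by (intro divide_right_mono divide_left_mono powr_mono2 mult_pos_pos) auto
    finally show ?thesis unfolding GP by (simp add: c2_def mult.commute)
  qed
  have "\<exists>K\<ge>1. \<exists>c>0. \<forall>k\<ge>1. \<forall>y. K * real k powr (1 / p) \<le> y \<longrightarrow>
     c * (real k / y powr p) \<le> G.prob {x \<in> space base_measure. y \<le> (\<Sum>j<k. O.fluct j x)}"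
  proof (rule O.power_tail_deviation[OF _ c12, where G = G and ?y0.0 = y0])
    show "O.mean + y \<le> real (h a)" if "y0 \<le> y" "G y a" for y a
      using L(3)[OF that(1)] that(2) by (simp add: G_def)
  qed (use p lower upper in \<open>auto simp: y0_def\<close>)
  moreover have "(y \<le> (\<Sum>j<k. O.fluct j x)) \<longleftrightarrow> real k / ?\<mu> + y \<le> entry_time k x" for k x y
    unfolding fl by linarith
  ultimately show ?thesis by simp
qed

text \<open>
  The sum is at least \<open>x\<close> if and only if there are at most \<open>n \<mu> - x\<close> visits. Let \<open>k\<close> be the integer
  part of this number. On the basis, at most \<open>k\<close> visits occur if the sum of the first \<open>k\<close> return times,
  whose mean is \<open>k / \<mu>\<close>, reaches \<open>n\<close>. The excess that this requires is \<open>n - k / \<mu>\<close>, which is at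
  most \<open>(x + 1) / \<mu>\<close> and hence at most \<open>2 x / \<mu>\<close>.
\<close>

theorem dynamical_deviation:
  assumes p: "2 < p" and c: "0 < c" and tail: "return_prob \<sim>[at_top] (\<lambda>n. c / real n powr (p + 1))"
  shows "\<exists>\<kappa>>0. \<forall>n::nat. \<forall>x::real. n \<ge> 1 \<longrightarrow> \<kappa> * real n powr (1 / p) \<le> x \<longrightarrow> x \<le> inverse \<kappa> * real n \<longrightarrow>
     inverse \<kappa> * (real n / x powr p)
       \<le> prob {z \<in> space M. x \<le> (\<Sum>i<n. prob basis - indicator basis ((T ^^ i) z))}"
proof -
  let ?\<mu> = "prob basis"
  have \<mu>: "0 < ?\<mu>" "?\<mu> \<le> 1" using basis_pos by auto
  obtain K c0 where K: "1 \<le> K" and c0: "0 < c0" and dev: "\<And>k y. 1 \<le> k \<Longrightarrow> K * real k powr (1 / p) \<le> y \<Longrightarrow>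
    c0 * (real k / y powr p) \<le> measure base_measure {x \<in> basis. real k / ?\<mu> + y \<le> entry_time k x}"
    using entry_time_deviation[OF p c tail] by blast
  define c3 where "c3 = ?\<mu> * (c0 * (?\<mu> / 4) / (2 / ?\<mu>) powr p)"
  have c3: "0 < c3" using \<mu> c0 by (simp add: c3_def)
  \<comment> \<open>The three terms provide the range of validity of the deviation bound, k at least n \<mu> / 4,
    and the constant in the conclusion.\<close>
  define \<kappa> where "\<kappa> = max (max K (2 / ?\<mu>)) (1 / c3)"
  have \<kappa>: "K \<le> \<kappa>" "2 / ?\<mu> \<le> \<kappa>" "1 / c3 \<le> \<kappa>" "1 \<le> \<kappa>" using K by (auto simp: \<kappa>_def)
  have inv: "inverse \<kappa> \<le> c3" "inverse \<kappa> \<le> ?\<mu> / 2"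
  proof -
    have "1 \<le> \<kappa> * c3" "2 \<le> \<kappa> * ?\<mu>"
      using \<kappa> c3 \<mu> by (simp_all add: pos_divide_le_eq)
    then show "inverse \<kappa> \<le> c3" "inverse \<kappa> \<le> ?\<mu> / 2"
      using \<kappa>(4) by (simp_all add: inverse_eq_divide pos_divide_le_eq mult.commute)
  qed
  have "inverse \<kappa> * (real n / x powr p)
       \<le> prob {z \<in> space M. x \<le> (\<Sum>i<n. ?\<mu> - indicator basis ((T ^^ i) z))}"
    if n: "1 \<le> n" and lo: "\<kappa> * real n powr (1 / p) \<le> x" and hi: "x \<le> inverse \<kappa> * real n" for n :: nat and x :: real
  proof -
    define k where "k = nat \<lfloor>n * ?\<mu> - x\<rfloor>"
    have np: "1 \<le> real n powr (1 / p)" using n p by (intro ge_one_powr_ge_zero) auto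
    have "\<kappa> * 1 \<le> \<kappa> * real n powr (1 / p)" using np \<kappa> by (intro mult_left_mono) auto
    then have x\<kappa>: "\<kappa> \<le> x" using lo by simp
    then have x1: "1 \<le> x" using \<kappa> by simp
    have "x \<le> ?\<mu> / 2 * n"
      using hi inv(2) by (meson mult_right_mono of_nat_0_le_iff order_trans)
    then have xn: "x \<le> n * ?\<mu> / 2" by (simp add: mult.commute)
    have "2 / ?\<mu> \<le> n * ?\<mu> / 2" using xn x\<kappa> \<kappa> by linarith
    moreover have "2 \<le> 2 / ?\<mu>" using \<mu> by (simp add: pos_le_divide_eq)
    ultimately have n4: "4 \<le> n * ?\<mu>" by linarith
    have kl: "n * ?\<mu> - x - 1 \<le> k" unfolding k_def by linarith
    have "real_of_int \<lfloor>n * ?\<mu> - x\<rfloor> \<le> n * ?\<mu> - x" by (rule of_int_floor_le)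
    then have ku: "k \<le> n * ?\<mu> - x" unfolding k_def using xn n4 by simp
    have k4: "n * ?\<mu> / 4 \<le> k" using kl xn n4 by linarith
    then have k1: "1 \<le> k" using n4 by linarith
    have "real n * ?\<mu> \<le> real n * 1" using \<mu> by (intro mult_left_mono) auto
    then have kn: "k \<le> n" using ku x1 by linarith
    let ?y = "2 / ?\<mu> * x"
    have "K * real k powr (1 / p) \<le> \<kappa> * real n powr (1 / p)"
      using \<kappa> kn p K by (intro mult_mono powr_mono2) auto
    also have "\<dots> \<le> 1 * x" using lo by simp
    also have "1 * x \<le> ?y"
    proof (rule mult_right_mono)
      show "1 \<le> 2 / ?\<mu>" unfolding pos_le_divide_eq[OF \<mu>(1)] using \<mu>(2) by linarith
    qed (use x1 in simp)
    finally have y: "K * real k powr (1 / p) \<le> ?y" .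
    let ?B = "{z \<in> basis. real k / ?\<mu> + ?y \<le> entry_time k z}"
    let ?V = "{z \<in> space M. x \<le> (\<Sum>i<n. ?\<mu> - indicator basis ((T ^^ i) z))}"
    have "T \<in> measurable M M" using preserving by (simp add: measure_preserving_map_def)
    then have Tm [measurable]: "T ^^ i \<in> measurable M M" for i
      by (induction i) (auto intro: measurable_comp)
    have V: "?V \<in> sets M" by measurable
    have sub: "?B \<subseteq> ?V"
    proof
      fix z assume z: "z \<in> ?B"
      have "real n = (n * ?\<mu> - x - 1 + (x + 1)) / ?\<mu>" using \<mu> by simp
      also have "\<dots> \<le> (k + 2 * x) / ?\<mu>" using kl x1 \<mu> by (intro divide_right_mono) auto
      also have "\<dots> = real k / ?\<mu> + ?y" by (simp add: add_divide_distrib)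
      also have "\<dots> \<le> entry_time k z" using z by simp
      finally have "n \<le> entry_time k z" by simp
      then have "card {i. i < n \<and> (T ^^ i) z \<in> basis} \<le> k"
        using z by (intro visits_le) auto
      then show "z \<in> ?V"
        using z basis_subset ku by (auto simp: centered_visit_sum)
    qed
    have "real n / x powr p * c3 = ?\<mu> * (c0 * ((n * ?\<mu> / 4) / ?y powr p))"
    proof -
      have "?y powr p = (2 / ?\<mu>) powr p * x powr p"
        using \<mu> x1 by (intro powr_mult)
      then show ?thesis by (simp add: c3_def ac_simps)
    qed
    also have "\<dots> \<le> ?\<mu> * (c0 * (k / ?y powr p))"
      using k4 \<mu> c0 by (intro mult_left_mono divide_right_mono) auto
    also have "\<dots> \<le> ?\<mu> * measure base_measure ?B"
      by (rule mult_left_mono[OF dev[OF k1 y]]) (rule less_imp_le[OF \<mu>(1)])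
    also have "\<dots> \<le> prob ?V"
    proof (cases "?B \<in> sets base_measure")
      case True
      then have "?B \<in> sets M" by (simp add: sets_base)
      then have "measure base_measure ?B = prob ?B / ?\<mu>"
        by (rule measure_base) blast
      then have "?\<mu> * measure base_measure ?B = prob ?B"
        using \<mu>(1) by simp
      also have "\<dots> \<le> prob ?V" by (rule finite_measure_mono[OF sub V])
      finally show ?thesis .
    next
      case False
      then have null: "measure base_measure ?B = 0" by (rule measure_notin_sets)
      show ?thesis unfolding null mult_zero_right by (rule measure_nonneg)
    qed
    finally have "real n / x powr p * c3 \<le> prob ?V" .
    moreover have "inverse \<kappa> * (real n / x powr p) \<le> c3 * (real n / x powr p)"
      using inv(1) by (intro mult_right_mono) auto
    ultimately show ?thesis by (simp add: mult.commute)
  qed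
  then show ?thesis using \<kappa>(4) by (intro exI[of _ \<kappa>]) auto
qed

end

section \<open>The dual chain as a reversed orbit\<close>

lemma bounded_measurable_alt:
  "bounded_measurable M v \<longleftrightarrow> v \<in> borel_measurable M \<and> (\<exists>B. \<forall>x\<in>space M. \<bar>v x\<bar> \<le> B)"
  by (auto simp: bounded_measurable_def bounded_iff)

lemma bounded_measurable_mult:
  assumes "bounded_measurable M v" "bounded_measurable M w"
  shows "bounded_measurable M (\<lambda>x. v x * w x)"
proof -
  obtain B1 B2 where B: "\<And>x. x \<in> space M \<Longrightarrow> \<bar>v x\<bar> \<le> B1" "\<And>x. x \<in> space M \<Longrightarrow> \<bar>w x\<bar> \<le> B2"
    and m: "v \<in> borel_measurable M" "w \<in> borel_measurable M"
    using assms unfolding bounded_measurable_alt by blast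
  have "\<bar>v x * w x\<bar> \<le> B1 * B2" if "x \<in> space M" for x
    unfolding abs_mult using B[OF that] by (intro mult_mono) auto
  then show ?thesis
    using borel_measurable_times[OF m] unfolding bounded_measurable_alt by blast
qed

lemma bounded_measurable_prod:
  assumes "finite I" "\<And>i. i \<in> I \<Longrightarrow> bounded_measurable M (v i)"
  shows "bounded_measurable M (\<lambda>x. \<Prod>i\<in>I. v i x)"
  using assms
proof (induction I rule: finite_induct)
  case empty
  then show ?case by (auto simp: bounded_measurable_alt)
next
  case (insert i I)
  then show ?case by (simp add: bounded_measurable_mult)
qed

lemma bounded_measurable_compose:
  assumes g: "g \<in> measurable L M" and v: "bounded_measurable M v"
  shows "bounded_measurable L (\<lambda>x. v (g x))"
  using v measurable_compose[OF g, of v borel] measurable_space[OF g]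
  unfolding bounded_measurable_alt by blast

lemma bounded_measurable_integrable:
  assumes "prob_space M" "bounded_measurable M v"
  shows "integrable M v"
proof -
  interpret prob_space M by fact
  obtain B where "\<And>x. x \<in> space M \<Longrightarrow> \<bar>v x\<bar> \<le> B" "v \<in> borel_measurable M"
    using assms(2) unfolding bounded_measurable_alt by blast
  then show ?thesis by (intro integrable_const_bound[where B = B]) auto
qed

lemma past_algebra_props:
  assumes Y: "\<And>i. Y i \<in> measurable P M"
  shows "subalgebra P (past_algebra P M Y n)"
    and "i \<le> n \<Longrightarrow> Y i \<in> measurable (past_algebra P M Y n) M"
proof -
  let ?\<phi> = "\<lambda>\<omega>. \<lambda>i\<in>{..n}. Y i \<omega>"
  have m: "?\<phi> \<in> measurable P (PiM {..n} (\<lambda>_. M))"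
    using Y by (intro measurable_restrict)
  have sp: "?\<phi> \<in> space P \<rightarrow> space (PiM {..n} (\<lambda>_. M))"
    using measurable_space[OF m] by blast
  show "subalgebra P (past_algebra P M Y n)"
    unfolding subalgebra_def past_algebra_def using sets_image_in_sets[OF refl m] by simp
  assume i: "i \<le> n"
  have "(\<lambda>\<omega>. ?\<phi> \<omega> i) \<in> measurable (past_algebra P M Y n) M"
    unfolding past_algebra_def
    by (rule measurable_compose[OF measurable_vimage_algebra1[OF sp] measurable_component_singleton]) (use i in simp)
  then show "Y i \<in> measurable (past_algebra P M Y n) M" using i by simp
qed

text \<open>
  Conditioning on the past turns the last factor \<open>w\<close> into \<open>K w\<close>, evaluated at the preceding time, where
  it is merged with the factor already present; duality then moves the orbit one step further and
  restores \<open>w\<close>.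
\<close>

lemma chain_reverses_orbit:
  assumes T: "T \<in> measurable M M" and K: "dual_operator M T K"
    and chain: "markov_chain P M K Y" and start: "distr P M (Y 0) = M"
    and v: "\<And>i. bounded_measurable M (v i)"
  shows "(\<integral>\<omega>. (\<Prod>i\<le>n. v i (Y i \<omega>)) \<partial>P) = (\<integral>z. (\<Prod>i\<le>n. v i ((T ^^ (n - i)) z)) \<partial>M)"
  using v
proof (induction n arbitrary: v)
  case 0
  have Y0: "Y 0 \<in> measurable P M" using chain by (simp add: markov_chain_def)
  have "v 0 \<in> borel_measurable M" using 0 by (simp add: bounded_measurable_def)
  then have "integral\<^sup>L (distr P M (Y 0)) (v 0) = (\<integral>\<omega>. v 0 (Y 0 \<omega>) \<partial>P)"
    by (intro integral_distr[OF Y0])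
  then show ?case unfolding start by simp
next
  case (Suc n)
  let ?F = "past_algebra P M Y n"
  have P: "prob_space P" and Y: "\<And>i. Y i \<in> measurable P M"
    and cond: "bounded_measurable M w \<Longrightarrow>
        AE \<omega> in P. real_cond_exp P ?F (\<lambda>\<omega>. w (Y (Suc n) \<omega>)) \<omega> = K w (Y n \<omega>)" for w
    using chain unfolding markov_chain_def by auto
  have Kb: "bounded_measurable M (K w)" if "bounded_measurable M w" for w
    using K that by (simp add: dual_operator_def)
  have dual: "(\<integral>z. u (T z) * w z \<partial>M) = (\<integral>z. u z * K w z \<partial>M)"
    if "bounded_measurable M u" "bounded_measurable M w" for u w
    using K that by (simp add: dual_operator_def)
  have Tn: "T ^^ j \<in> measurable M M" for j
    using T by (induction j) (auto intro: measurable_comp)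
  interpret P: prob_space P by (rule P)
  interpret finite_measure_subalgebra P ?F
    by unfold_locales (rule past_algebra_props(1)[OF Y])
  let ?w = "v (Suc n)"
  let ?g = "\<lambda>\<omega>. \<Prod>i\<le>n. v i (Y i \<omega>)"
  have gF: "?g \<in> borel_measurable ?F"
  proof (rule borel_measurable_prod)
    fix i assume "i \<in> {..n}"
    then have Yi: "Y i \<in> measurable ?F M" by (intro past_algebra_props(2)[OF Y]) simp
    have "v i \<in> borel_measurable M" using Suc.prems[of i] by (simp add: bounded_measurable_def)
    then show "(\<lambda>\<omega>. v i (Y i \<omega>)) \<in> borel_measurable ?F" by (rule measurable_compose[OF Yi])
  qed
  have gb: "bounded_measurable P ?g"
    using bounded_measurable_compose[OF Y Suc.prems] by (intro bounded_measurable_prod) auto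
  have wb: "bounded_measurable P (\<lambda>\<omega>. ?w (Y (Suc n) \<omega>))"
    by (rule bounded_measurable_compose[OF Y Suc.prems])
  have Kwb: "bounded_measurable P (\<lambda>\<omega>. K ?w (Y n \<omega>))"
    by (rule bounded_measurable_compose[OF Y Kb[OF Suc.prems]])
  have "(\<integral>\<omega>. (\<Prod>i\<le>Suc n. v i (Y i \<omega>)) \<partial>P) = (\<integral>\<omega>. ?g \<omega> * ?w (Y (Suc n) \<omega>) \<partial>P)" by simp
  also have "\<dots> = (\<integral>\<omega>. ?g \<omega> * real_cond_exp P ?F (\<lambda>\<omega>. ?w (Y (Suc n) \<omega>)) \<omega> \<partial>P)"
    using bounded_measurable_integrable[OF P bounded_measurable_mult[OF gb wb]] wb
    by (intro real_cond_exp_intg(2)[symmetric] gF) (auto simp: bounded_measurable_def)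
  also have "\<dots> = (\<integral>\<omega>. ?g \<omega> * K ?w (Y n \<omega>) \<partial>P)"
  proof (rule integral_cong_AE)
    show "AE \<omega> in P. ?g \<omega> * real_cond_exp P ?F (\<lambda>\<omega>. ?w (Y (Suc n) \<omega>)) \<omega> = ?g \<omega> * K ?w (Y n \<omega>)"
      using cond[OF Suc.prems[of "Suc n"]] by eventually_elim simp
    show "(\<lambda>\<omega>. ?g \<omega> * real_cond_exp P ?F (\<lambda>\<omega>. ?w (Y (Suc n) \<omega>)) \<omega>) \<in> borel_measurable P"
      using gb by (intro borel_measurable_times borel_measurable_cond_exp2) (simp add: bounded_measurable_def)
    show "(\<lambda>\<omega>. ?g \<omega> * K ?w (Y n \<omega>)) \<in> borel_measurable P"
      using bounded_measurable_mult[OF gb Kwb] by (simp add: bounded_measurable_def)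
  qed
  also have "\<dots> = (\<integral>\<omega>. (\<Prod>i\<le>n. (v(n := \<lambda>z. v n z * K ?w z)) i (Y i \<omega>)) \<partial>P)"
  proof (rule Bochner_Integration.integral_cong[OF refl])
    fix \<omega>
    have "{..n} = insert n {..<n}" by auto
    then show "?g \<omega> * K ?w (Y n \<omega>) = (\<Prod>i\<le>n. (v(n := \<lambda>z. v n z * K ?w z)) i (Y i \<omega>))"
      by (simp add: mult.commute mult.left_commute)
  qed
  also have "\<dots> = (\<integral>z. (\<Prod>i\<le>n. (v(n := \<lambda>z. v n z * K ?w z)) i ((T ^^ (n - i)) z)) \<partial>M)"
    by (rule Suc.IH) (use Suc.prems bounded_measurable_mult[OF Suc.prems Kb[OF Suc.prems]] in auto)
  also have "\<dots> = (\<integral>z. (\<Prod>i\<le>n. v i ((T ^^ (n - i)) z)) * K ?w z \<partial>M)"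
  proof (rule Bochner_Integration.integral_cong[OF refl])
    fix z
    have "{..n} = insert n {..<n}" by auto
    then show "(\<Prod>i\<le>n. (v(n := \<lambda>z. v n z * K ?w z)) i ((T ^^ (n - i)) z))
        = (\<Prod>i\<le>n. v i ((T ^^ (n - i)) z)) * K ?w z"
      by (simp add: mult.commute mult.left_commute)
  qed
  also have "\<dots> = (\<integral>z. (\<Prod>i\<le>n. v i ((T ^^ (n - i)) (T z))) * ?w z \<partial>M)"
    by (rule dual[symmetric, OF bounded_measurable_prod Suc.prems])
      (auto intro!: bounded_measurable_compose[OF Tn Suc.prems])
  also have "\<dots> = (\<integral>z. (\<Prod>i\<le>Suc n. v i ((T ^^ (Suc n - i)) z)) \<partial>M)"
  proof (rule Bochner_Integration.integral_cong[OF refl])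
    fix z
    have "(T ^^ (n - i)) (T z) = (T ^^ (Suc n - i)) z" if "i \<le> n" for i
      using that by (simp add: Suc_diff_le funpow_swap1)
    then show "(\<Prod>i\<le>n. v i ((T ^^ (n - i)) (T z))) * ?w z = (\<Prod>i\<le>Suc n. v i ((T ^^ (Suc n - i)) z))"
      by simp
  qed
  finally show ?case .
qed

text \<open>
  The event depends on the finitely many possible patterns of visits to \<open>B\<close> only, and the
  probability of one pattern is the integral of a product of indicators.
\<close>

lemma visit_pattern_law:
  assumes M: "prob_space M" and T: "T \<in> measurable M M" and chain: "stationary_dual_chain P M T Y"
    and B: "B \<in> sets M" and n: "1 \<le> n"
  shows "measure P {\<omega> \<in> space P. \<Phi> {i. i < n \<and> Y i \<omega> \<in> B}}
    = measure M {z \<in> space M. \<Phi> {i. i < n \<and> (T ^^ (n - 1 - i)) z \<in> B}}"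
proof -
  obtain K where K: "dual_operator M T K" "markov_chain P M K Y" "distr P M (Y 0) = M"
    using chain by (auto simp: stationary_dual_chain_def)
  have P: "prob_space P" and Y: "\<And>i. Y i \<in> measurable P M"
    using K(2) by (auto simp: markov_chain_def)
  have Tn: "T ^^ j \<in> measurable M M" for j
    using T by (induction j) (auto intro: measurable_comp)
  obtain m where m: "n = Suc m" using n by (cases n) auto
  have pattern: "measure L {x \<in> space L. \<Phi> {i. i < n \<and> X i x \<in> B}}
      = (\<Sum>s\<in>{s. s \<subseteq> {..m} \<and> \<Phi> s}. \<integral>x. (\<Prod>i\<le>m. indicator (if i \<in> s then B else space M - B) (X i x)) \<partial>L)"
    if L: "prob_space L" and X: "\<And>i. X i \<in> measurable L M" for L :: "'c measure" and X
  proof -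
    interpret L: prob_space L by fact
    let ?E = "\<lambda>s. {x \<in> space L. \<forall>i\<in>{..m}. X i x \<in> (if i \<in> s then B else space M - B)}"
    have mem: "X i x \<in> space M" if "x \<in> space L" for i x using measurable_space[OF X that] .
    have E_sets: "?E s \<in> sets L" for s
    proof (intro sets.sets_Collect_finite_All)
      fix i
      have "(if i \<in> s then B else space M - B) \<in> sets M" using B by auto
      from measurable_sets[OF X this]
      show "{x \<in> space L. X i x \<in> (if i \<in> s then B else space M - B)} \<in> sets L"
        by (simp add: vimage_def Int_def conj_commute)
    qed simp
    have "{x \<in> space L. \<Phi> {i. i < n \<and> X i x \<in> B}} = (\<Union>s\<in>{s. s \<subseteq> {..m} \<and> \<Phi> s}. ?E s)"
    proof (intro equalityI subsetI)
      fix x assume x: "x \<in> {x \<in> space L. \<Phi> {i. i < n \<and> X i x \<in> B}}"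
      let ?s = "{i. i < n \<and> X i x \<in> B}"
      have "?s \<subseteq> {..m}" "\<Phi> ?s" "x \<in> ?E ?s" using x mem by (auto simp: m)
      then show "x \<in> (\<Union>s\<in>{s. s \<subseteq> {..m} \<and> \<Phi> s}. ?E s)" by blast
    next
      fix x assume "x \<in> (\<Union>s\<in>{s. s \<subseteq> {..m} \<and> \<Phi> s}. ?E s)"
      then obtain s where s: "s \<subseteq> {..m}" "\<Phi> s" "x \<in> ?E s" by blast
      then have "{i. i < n \<and> X i x \<in> B} = s" by (auto simp: m less_Suc_eq_le split: if_splits)
      then show "x \<in> {x \<in> space L. \<Phi> {i. i < n \<and> X i x \<in> B}}" using s by auto
    qed
    also have "measure L \<dots> = (\<Sum>s\<in>{s. s \<subseteq> {..m} \<and> \<Phi> s}. measure L (?E s))"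
    proof (rule L.finite_measure_finite_Union)
      show "finite {s. s \<subseteq> {..m} \<and> \<Phi> s}" by (rule finite_subset[of _ "Pow {..m}"]) auto
      show "disjoint_family_on ?E {s. s \<subseteq> {..m} \<and> \<Phi> s}"
        unfolding disjoint_family_on_def
      proof (intro ballI impI)
        fix s t assume st: "s \<in> {s. s \<subseteq> {..m} \<and> \<Phi> s}" "t \<in> {s. s \<subseteq> {..m} \<and> \<Phi> s}" "s \<noteq> t"
        then obtain i where i: "i \<le> m" "i \<in> s \<longleftrightarrow> i \<notin> t" by auto
        then show "?E s \<inter> ?E t = {}" by (cases "i \<in> s") force+
      qed
      show "?E ` {s. s \<subseteq> {..m} \<and> \<Phi> s} \<subseteq> sets L" using E_sets by blast
    qed
    also have "\<dots> = (\<Sum>s\<in>{s. s \<subseteq> {..m} \<and> \<Phi> s}.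
        \<integral>x. (\<Prod>i\<le>m. indicator (if i \<in> s then B else space M - B) (X i x)) \<partial>L)"
    proof (rule sum.cong[OF refl])
      fix s
      have "measure L (?E s) = (\<integral>x. indicator (?E s) x \<partial>L)"
        using E_sets[of s] by (simp add: Int_absorb2 sets.sets_into_space)
      also have "\<dots> = (\<integral>x. (\<Prod>i\<le>m. indicator (if i \<in> s then B else space M - B) (X i x)) \<partial>L)"
      proof (rule Bochner_Integration.integral_cong[OF refl])
        fix x assume x: "x \<in> space L"
        let ?D = "\<lambda>i. if i \<in> s then B else space M - B"
        show "indicator (?E s) x = (\<Prod>i\<le>m. indicator (?D i) (X i x) :: real)"
        proof (cases "\<forall>i\<in>{..m}. X i x \<in> ?D i")
          case True
          then have "(\<Prod>i\<le>m. indicator (?D i) (X i x) :: real) = 1"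
            by (intro prod.neutral ballI indicator_simps(1)) blast
          moreover have "x \<in> ?E s" using True x by blast
          then have "indicator (?E s) x = (1 :: real)" by (intro indicator_simps(1))
          ultimately show ?thesis by simp
        next
          case False
          then obtain i where i: "i \<in> {..m}" "X i x \<notin> ?D i" by blast
          then have "indicator (?D i) (X i x) = (0 :: real)" by (intro indicator_simps(2))
          then have "(\<Prod>i\<le>m. indicator (?D i) (X i x) :: real) = 0"
            using i(1) by (intro prod_zero) blast+
          moreover have "x \<notin> ?E s" using i by blast
          then have "indicator (?E s) x = (0 :: real)" by (intro indicator_simps(2))
          ultimately show ?thesis by simp
        qed
      qed
      finally show "measure L (?E s) = \<dots>" .
    qed
    finally show ?thesis .
  qed
  have ind: "bounded_measurable M (indicator (if i \<in> s then B else space M - B))" for i :: nat and s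
    using B by (auto simp: bounded_measurable_alt indicator_def intro!: exI[of _ 1] borel_measurable_indicator)
  show ?thesis
    unfolding pattern[OF P Y] pattern[OF M Tn]
    using chain_reverses_orbit[OF T K, of "\<lambda>i. indicator (if i \<in> s then B else space M - B)" m for s] ind
    by (intro sum.cong refl) (simp add: m)
qed

theorem proposition4p3:
  fixes M :: "'a measure" and T :: "'a \<Rightarrow> 'a"
    and A :: "'i set" and h :: "'i \<Rightarrow> nat" and \<Delta> :: "'i \<Rightarrow> nat \<Rightarrow> 'a set" and \<beta> :: real
    and c p :: real
    and f :: "'a \<Rightarrow> real"
    and P :: "'b measure" and Y :: "nat \<Rightarrow> 'b \<Rightarrow> 'a"
  assumes tower: "young_tower M T A h \<Delta> \<beta>"
    and c: "c > 0" and p: "p > 2"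
    and tail: "(\<lambda>n. measure M {z \<in> tower_basis A \<Delta>. return_time A h \<Delta> z = n})
                 \<sim>[at_top] (\<lambda>n. c / real n powr (p + 1))"
    and f: "f = (\<lambda>z. measure M (tower_basis A \<Delta>) - indicator (tower_basis A \<Delta>) z)"
    and chain: "stationary_dual_chain P M T Y"
  shows "\<exists>\<kappa>>0. \<forall>n::nat. \<forall>x::real.
           n \<ge> 1 \<longrightarrow> \<kappa> * real n powr (1 / p) \<le> x \<longrightarrow> x \<le> inverse \<kappa> * real n \<longrightarrow>
           measure P {\<omega> \<in> space P. (\<Sum>i<n. f (Y i \<omega>)) \<ge> x} \<ge> inverse \<kappa> * (real n / x powr p)"
proof -
  interpret young_tower M T A h \<Delta> \<beta> by (rule tower)
  let ?\<mu> = "measure M basis"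
  have T: "T \<in> measurable M M" using preserving by (simp add: measure_preserving_map_def)
  have law: "measure P {\<omega> \<in> space P. (\<Sum>i<n. f (Y i \<omega>)) \<ge> x}
      = measure M {z \<in> space M. x \<le> (\<Sum>i<n. ?\<mu> - indicator basis ((T ^^ i) z))}"
    if n: "1 \<le> n" for n :: nat and x :: real
  proof -
    let ?\<Phi> = "\<lambda>s. x \<le> real n * ?\<mu> - real (card s)"
    have "{\<omega> \<in> space P. (\<Sum>i<n. f (Y i \<omega>)) \<ge> x} = {\<omega> \<in> space P. ?\<Phi> {i. i < n \<and> Y i \<omega> \<in> basis}}"
      unfolding f centered_visit_sum ..
    also have "measure P \<dots> = measure M {z \<in> space M. ?\<Phi> {i. i < n \<and> (T ^^ (n - 1 - i)) z \<in> basis}}"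
      by (rule visit_pattern_law[OF prob_space_axioms T chain basis_sets n, where \<Phi> = ?\<Phi>])
    also have "{z \<in> space M. ?\<Phi> {i. i < n \<and> (T ^^ (n - 1 - i)) z \<in> basis}}
        = {z \<in> space M. x \<le> (\<Sum>i<n. ?\<mu> - indicator basis ((T ^^ (n - 1 - i)) z))}"
      unfolding centered_visit_sum ..
    also have "\<dots> = {z \<in> space M. x \<le> (\<Sum>i<n. ?\<mu> - indicator basis ((T ^^ i) z))}"
    proof -
      have "(\<Sum>i<n. ?\<mu> - indicator basis ((T ^^ (n - Suc i)) z))
          = (\<Sum>i<n. ?\<mu> - indicator basis ((T ^^ i) z))" for z
        by (rule sum.nat_diff_reindex)
      then show ?thesis by simp
    qed
    finally show ?thesis .
  qed
  obtain \<kappa> where \<kappa>: "0 < \<kappa>" and dev: "\<And>n x. n \<ge> 1 \<Longrightarrow> \<kappa> * real n powr (1 / p) \<le> x \<Longrightarrow>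
      x \<le> inverse \<kappa> * real n \<Longrightarrow> inverse \<kappa> * (real n / x powr p)
       \<le> measure M {z \<in> space M. x \<le> (\<Sum>i<n. ?\<mu> - indicator basis ((T ^^ i) z))}"
    using dynamical_deviation[OF p c tail] by blast
  show ?thesis
    using \<kappa> dev law by (intro exI[of _ \<kappa>]) auto
qed

end
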